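(* Let $n\ge d\ge 1$ be integers, let $r\ge1$, and let $A$ be a set of $r$ partitions of $d$ with $n$ parts (zeros allowed). Let $J\subseteq R=k[x_1,\dots,x_n]$ be the ideal $$J=\bigl(\mathbf{x}^{\mathbf a}-\sigma\cdot\mathbf{x}^{\mathbf a} : \sigma\in\mathfrak{S}_n,\ \mathbf a\vdash d,\ \#\mathbf a=n,\ \mathbf a\notin A\bigr)+\bigl(\mathbf{x}^{\mathbf a} : \mathbf a\in A\bigr)_{\mathfrak{S}_n}.$$ Then $J$ is a symmetric ideal generated in degree $d$ such that $\dim_k J_d=\dim_k R_d-(P(d)-r)$. Furthermore, if $n>d$ and $n\ge 1+\frac{\sum_{i=0}^{d-1}P(i)}{r}$, then $J$ is $r$-generated.
   Context: $k$ is an infinite field with $\operatorname{char}(k)=0$ or $\operatorname{char}(k)>n$. $R$ has the standard grading; $R_d$, $J_d$ are degree-$d$ components. $P(i)$ is the number of integer partitions of $i$ (with $P(0)=1$). A partition of $d$ with $n$ parts ($\mathbf a\vdash d$, $\#\mathbf a=n$) is a tuple $\mathbf a=(a_1\ge\dots\ge a_n\ge 0)$ with sum $d$, zeros being allowed as padding; $\mathbf{x}^{\mathbf a}=x_1^{a_1}\cdots x_n^{a_n}$. The symmetric group $\mathfrak{S}_n$ acts on $R$ by $\sigma\cdot f(x_1,\dots,x_n)=f(x_{\sigma(1)},\dots,x_{\sigma(n)})$; a symmetric ideal is one stable under this action. For a set $F\subseteq R$, $(F)_{\mathfrak{S}_n}$ is the ideal generated by all $\sigma\cdot f$, $\sigma\in\mathfrak{S}_n$,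 $f\in F$. A symmetric ideal $J$ is $r$-generated if there exist $r$ homogeneous polynomials $f_1,\dots,f_r\in R$ of the same degree such that $J=(f_1,\dots,f_r)_{\mathfrak{S}_n}$. *)

theory Defs
  imports
    "HOL-Library.Poly_Mapping"
    "HOL-Combinatorics.Permutations"
    "HOL-Algebra.Ideal"
    "HOL-Computational_Algebra.Computational_Algebra"
begin

text \<open>
  Polynomials in variables indexed by the natural numbers are finitely supported functions
  from exponent vectors to coefficients. The ring \<open>R = k[x\<^sub>1,\<dots>,x\<^sub>n]\<close> consists of those which
  only involve the variables with index in \<open>{..<n}\<close>, so \<open>x\<^sub>i\<close> is represented by index \<open>i - 1\<close>.
\<close>

type_synonym 'k mpoly = "(nat \<Rightarrow>\<^sub>0 nat) \<Rightarrow>\<^sub>0 'k"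

definition poly_ring :: "nat \<Rightarrow> 'k::field mpoly ring" where
  "poly_ring n =
    \<lparr>carrier = {f. \<forall>m \<in> Poly_Mapping.keys f. Poly_Mapping.keys m \<subseteq> {..<n}},
     monoid.mult = (*), one = 1, ring.zero = 0, add = (+)\<rparr>"

definition mconst :: "'k::field \<Rightarrow> 'k mpoly" where
  "mconst c = Poly_Mapping.single 0 c"

definition mvar :: "nat \<Rightarrow> 'k::field mpoly" where
  "mvar i = Poly_Mapping.single (Poly_Mapping.single i 1) 1"

definition mscale :: "'k::field \<Rightarrow> 'k mpoly \<Rightarrow> 'k mpoly" where
  "mscale c f = mconst c * f"

global_interpretation mpoly: vector_space "mscale :: 'k::field \<Rightarrow> 'k mpoly \<Rightarrow> 'k mpoly"
  by unfold_locales
    (simp_all add: mscale_def mconst_def distrib_left distrib_right single_add mult_single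
      single_one mult.assoc [symmetric])

definition mdeg :: "(nat \<Rightarrow>\<^sub>0 nat) \<Rightarrow> nat" where
  "mdeg m = (\<Sum>i\<in>Poly_Mapping.keys m. Poly_Mapping.lookup m i)"

text \<open>The degree \<open>e\<close> component of the standard grading (it contains \<open>0\<close>).\<close>

definition graded_part :: "nat \<Rightarrow> nat \<Rightarrow> 'k::field mpoly set" where
  "graded_part n e = {f \<in> carrier (poly_ring n). \<forall>m \<in> Poly_Mapping.keys f. mdeg m = e}"

text \<open>Substitution of the variable with index \<open>\<sigma> i\<close> for the one with index \<open>i\<close>.\<close>

definition perm_act :: "(nat \<Rightarrow> nat) \<Rightarrow> 'k::field mpoly \<Rightarrow> 'k mpoly" where
  "perm_act \<sigma> f =
    (\<Sum>m\<in>Poly_Mapping.keys f. mconst (Poly_Mapping.lookup f m) *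
       (\<Prod>i\<in>Poly_Mapping.keys m. mvar (\<sigma> i) ^ Poly_Mapping.lookup m i))"

definition symmetric_ideal :: "nat \<Rightarrow> 'k::field mpoly set \<Rightarrow> bool" where
  "symmetric_ideal n J \<longleftrightarrow>
    ideal J (poly_ring n) \<and> (\<forall>\<sigma> f. \<sigma> permutes {..<n} \<longrightarrow> f \<in> J \<longrightarrow> perm_act \<sigma> f \<in> J)"

definition sym_genideal :: "nat \<Rightarrow> 'k::field mpoly set \<Rightarrow> 'k mpoly set" where
  "sym_genideal n F = Idl\<^bsub>poly_ring n\<^esub> {perm_act \<sigma> f | \<sigma> f. \<sigma> permutes {..<n} \<and> f \<in> F}"

definition generated_in_degree :: "nat \<Rightarrow> nat \<Rightarrow> 'k::field mpoly set \<Rightarrow> bool" where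
  "generated_in_degree n e J \<longleftrightarrow> (\<exists>S \<subseteq> graded_part n e. J = Idl\<^bsub>poly_ring n\<^esub> S)"

definition r_generated :: "nat \<Rightarrow> nat \<Rightarrow> 'k::field mpoly set \<Rightarrow> bool" where
  "r_generated n r J \<longleftrightarrow>
    (\<exists>e f. (\<forall>i<r. f i \<in> graded_part n e) \<and> J = sym_genideal n (f ` {..<r}))"

definition padded_partitions :: "nat \<Rightarrow> nat \<Rightarrow> nat list set" where
  "padded_partitions d n = {a. length a = n \<and> sorted_wrt (\<ge>) a \<and> sum_list a = d}"

definition partition_number :: "nat \<Rightarrow> nat" where
  "partition_number i = card {a :: nat list. sorted_wrt (\<ge>) a \<and> 0 \<notin> set a \<and> sum_list a = i}"

definition xpow :: "nat list \<Rightarrow> 'k::field mpoly" where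
  "xpow a = (\<Prod>i<length a. mvar i ^ (a ! i))"

lemma poly_ring_cring: "cring (poly_ring n :: 'k::field mpoly ring)"
proof -
  let ?C = "{f :: 'k mpoly. \<forall>m \<in> Poly_Mapping.keys f. Poly_Mapping.keys m \<subseteq> {..<n}}"
  have add: "f + g \<in> ?C" if "f \<in> ?C" "g \<in> ?C" for f g
    using that Poly_Mapping.keys_add [of f g] by blast
  have mult: "f * g \<in> ?C" if "f \<in> ?C" "g \<in> ?C" for f g
  proof -
    have "Poly_Mapping.keys m \<subseteq> {..<n}" if m: "m \<in> Poly_Mapping.keys (f * g)" for m
    proof -
      obtain a b where "m = a + b" "a \<in> Poly_Mapping.keys f" "b \<in> Poly_Mapping.keys g"
        using subsetD [OF Poly_Mapping.keys_mult m] by blast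
      then show ?thesis
        using \<open>f \<in> ?C\<close> \<open>g \<in> ?C\<close> Poly_Mapping.keys_add [of a b] by blast
    qed
    then show ?thesis by blast
  qed
  have uminus: "\<exists>g\<in>?C. g + f = 0" if "f \<in> ?C" for f
    using that by (intro bexI [where x = "- f"]) simp_all
  have zero_one: "0 \<in> ?C" "1 \<in> ?C" by simp_all
  show ?thesis
  proof (intro cringI abelian_groupI comm_monoidI)
    fix f :: "'k mpoly"
    assume "f \<in> carrier (poly_ring n)"
    then show "\<exists>g\<in>carrier (poly_ring n). g \<oplus>\<^bsub>poly_ring n\<^esub> f = \<zero>\<^bsub>poly_ring n\<^esub>"
      using uminus [of f] by (simp add: poly_ring_def)
  qed (use add mult zero_one in \<open>simp_all add: poly_ring_def algebra_simps del: mem_Collect_eq\<close>)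
qed

end

theory Submission
  imports Defs
begin

text \<open>
  Write \<open>G\<close> for the symmetric group, \<open>R\<^sub>d\<^sup>0\<close> for the forms of degree \<open>d\<close> whose \<open>G\<close>-average
  vanishes, and \<open>P(i)\<close> for the number of partitions of \<open>i\<close>.

  The ideal \<open>J\<close> is generated by forms of degree \<open>d\<close>, so \<open>J\<^sub>d\<close> is just their linear span. Summing
  the coefficients over the orbit of a monomial \<open>\<^bold>x\<^sup>a\<close> with \<open>a \<notin> A\<close> gives a functional that kills
  this span, and the monomials \<open>\<^bold>x\<^sup>a\<close>, \<open>a \<notin> A\<close>, span a complement. This is the dimension formula.

  For the last claim, the span of the generators is \<open>R\<^sub>d\<^sup>0\<close> plus the \<open>r\<close> orbit sums of the \<open>\<^bold>x\<^sup>a\<close> with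
  \<open>a \<in> A\<close>. If \<open>g\<^sub>1, \<dots>, g\<^sub>r\<close> generate \<open>R\<^sub>d\<^sup>0\<close> as a \<open>G\<close>-module, then the sums of \<open>g\<^sub>i\<close> and the
  \<open>i\<close>-th orbit average generate \<open>J\<close>: averaging such a sum over \<open>G\<close> isolates the orbit average. So
  everything comes down to generating \<open>R\<^sub>d\<^sup>0\<close> by \<open>r\<close> elements as soon as
  \<open>P(0) + \<dots> + P(d - 1) \<le> r (n - 1)\<close>. A counting argument with irreducible representations is
  avoided; the generators are constructed. Say that \<open>y\<close> has type \<open>t\<close> if it is fixed by all
  permutations of the variables with index at least \<open>t\<close>. There are two steps.

  \<^item> \<^emph>\<open>Generators of small type.\<close> The module of forms of degree \<open>d\<close> has \<open>G\<close>-generators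
    \<open>y\<^sub>q\<close>, one for each multiset \<open>q\<close> of integers \<open>\<ge> 2\<close> with sum at most \<open>d\<close>, where \<open>y\<^sub>q\<close> has type
    \<open>d\<close> minus the sum of \<open>q\<close>; these types add up to \<open>P(0) + \<dots> + P(d - 1)\<close>
    (lemmas \<open>graded_part_generators\<close> and \<open>sum_codegree_no_one_msets\<close>). Here
    \<open>R\<^sub>j\<close> is split as \<open>(e\<^sub>1, e\<^sub>2, \<dots>)\<^sub>j\<close> plus a stable complement \<open>U\<^sub>j\<close>, so that forms are
    combinations of products of elementary symmetric functions with elements of the \<open>U\<^sub>j\<close>. The
    point is that \<open>U\<^sub>0 + \<dots> + U\<^sub>t\<close> is generated by a single element of type \<open>t\<close>: evaluation on the
    orbit of a point with \<open>t\<close> distinct nonzero coordinates and all others zero is injective on it,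
    because a polynomial of degree at most \<open>t\<close> that vanishes on this orbit has its leading form in
    \<open>(e\<^sub>1, e\<^sub>2, \<dots>)\<close> (lemma \<open>vanishing_on_orbit\<close>).

  \<^item> \<^emph>\<open>Exchange.\<close> Two generators of types \<open>t \<ge> u\<close> may be replaced by two of types \<open>t + 1\<close> and
    \<open>u - 1\<close>, as long as \<open>t + 2 \<le> n\<close> (lemma \<open>exchange\<close>). In \<open>R\<^sub>d\<^sup>0\<close> elements of type \<open>0\<close> vanish and can be
    dropped. Repeating this packs generators with types of total \<open>T\<close> into at most
    \<open>\<lceil>T / (n - 1)\<rceil>\<close> generators (lemma \<open>few_generators\<close>).

  The hypothesis on the characteristic serves to average over the groups of permutations, and the
  infinite field provides the distinct coordinates of the evaluation point.
\<close>

section \<open>Substitution homomorphisms\<close>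

text \<open>The action of a permutation, the evaluation at a point and the specialization of one variable are
  all instances of this substitution, so that a single proof of multiplicativity covers them.\<close>

definition msubst :: "(nat \<Rightarrow> 'k mpoly) \<Rightarrow> 'k::field mpoly \<Rightarrow> 'k mpoly" where
  "msubst \<phi> f = (\<Sum>m\<in>Poly_Mapping.keys f. mconst (Poly_Mapping.lookup f m) *
       (\<Prod>i\<in>Poly_Mapping.keys m. \<phi> i ^ Poly_Mapping.lookup m i))"

lemma perm_act_eq_msubst: "perm_act \<sigma> f = msubst (\<lambda>i. mvar (\<sigma> i)) f"
  by (simp add: perm_act_def msubst_def)

lemma mconst_simps [simp]:
  "mconst 0 = 0" "mconst 1 = 1" "mconst (a + b) = mconst a + mconst b"
  "mconst (a * b) = mconst a * mconst b" "mconst (- a) = - mconst a" "mconst (a - b) = mconst a - mconst b"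
  by (simp_all add: mconst_def single_add mult_single single_uminus single_diff)

lemma mconst_sum: "mconst (\<Sum>i\<in>X. f i) = (\<Sum>i\<in>X. mconst (f i))"
  by (induction X rule: infinite_finite_induct) auto

lemma mconst_power: "mconst (a ^ j) = mconst a ^ j"
  by (induction j) auto

lemma mconst_eq_iff [simp]: "mconst a = mconst b \<longleftrightarrow> a = b"
  by (metis mconst_def lookup_single_eq)

definition mono_at :: "(nat \<Rightarrow> 'k mpoly) \<Rightarrow> (nat \<Rightarrow>\<^sub>0 nat) \<Rightarrow> 'k::field mpoly" where
  "mono_at \<phi> m = (\<Prod>i\<in>Poly_Mapping.keys m. \<phi> i ^ Poly_Mapping.lookup m i)"

lemma mono_at_superset:
  assumes "finite X" "Poly_Mapping.keys m \<subseteq> X"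
  shows "mono_at \<phi> m = (\<Prod>i\<in>X. \<phi> i ^ Poly_Mapping.lookup m i)"
  unfolding mono_at_def
  by (rule prod.mono_neutral_left) (use assms in \<open>auto simp: in_keys_iff\<close>)

lemma mono_at_0 [simp]: "mono_at \<phi> 0 = 1"
  by (simp add: mono_at_def)

lemma mono_at_add: "mono_at \<phi> (m + m') = mono_at \<phi> m * mono_at \<phi> m'"
proof -
  let ?X = "Poly_Mapping.keys m \<union> Poly_Mapping.keys m'"
  have "Poly_Mapping.keys (m + m') \<subseteq> ?X" by (rule Poly_Mapping.keys_add)
  then show ?thesis
    by (simp add: mono_at_superset[of ?X] lookup_add power_add prod.distrib)
qed

lemma msubst_superset:
  assumes "finite X" "Poly_Mapping.keys f \<subseteq> X"
  shows "msubst \<phi> f = (\<Sum>m\<in>X. mconst (Poly_Mapping.lookup f m) * mono_at \<phi> m)"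
  unfolding msubst_def mono_at_def[symmetric]
  by (rule sum.mono_neutral_left) (use assms in \<open>auto simp: in_keys_iff\<close>)

lemma msubst_0 [simp]: "msubst \<phi> 0 = 0"
  by (simp add: msubst_def)

lemma msubst_add [simp]: "msubst \<phi> (f + g) = msubst \<phi> f + msubst \<phi> g"
proof -
  let ?X = "Poly_Mapping.keys f \<union> Poly_Mapping.keys g"
  have "Poly_Mapping.keys (f + g) \<subseteq> ?X" by (rule Poly_Mapping.keys_add)
  then show ?thesis
    by (simp add: msubst_superset[of ?X] lookup_add distrib_right sum.distrib)
qed

lemma msubst_single: "msubst \<phi> (Poly_Mapping.single m c) = mconst c * mono_at \<phi> m"
  by (cases "c = 0") (simp_all add: msubst_def mono_at_def)

lemma msubst_sum [simp]: "msubst \<phi> (\<Sum>i\<in>X. f i) = (\<Sum>i\<in>X. msubst \<phi> (f i))"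
  by (induction X rule: infinite_finite_induct) auto

lemma mpoly_eq_sum_single:
  "f = (\<Sum>m\<in>Poly_Mapping.keys f. Poly_Mapping.single m (Poly_Mapping.lookup f m))"
  by (rule poly_mapping_eqI)
     (auto simp: lookup_sum lookup_single when_def in_keys_iff sum.delta' cong: if_cong)

lemma msubst_mult [simp]: "msubst \<phi> (f * g) = msubst \<phi> f * msubst \<phi> g"
proof -
  have "f * g = (\<Sum>m\<in>Poly_Mapping.keys f. \<Sum>m'\<in>Poly_Mapping.keys g.
      Poly_Mapping.single (m + m') (Poly_Mapping.lookup f m * Poly_Mapping.lookup g m'))"
    by (subst (1) mpoly_eq_sum_single[of f], subst (1) mpoly_eq_sum_single[of g])
       (simp add: sum_product mult_single)
  then have "msubst \<phi> (f * g) = (\<Sum>m\<in>Poly_Mapping.keys f. \<Sum>m'\<in>Poly_Mapping.keys g.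
      (mconst (Poly_Mapping.lookup f m) * mono_at \<phi> m) * (mconst (Poly_Mapping.lookup g m') * mono_at \<phi> m'))"
    by (simp add: msubst_single mono_at_add mult_ac)
  also have "\<dots> = msubst \<phi> f * msubst \<phi> g"
    by (simp add: sum_product msubst_def mono_at_def)
  finally show ?thesis .
qed

lemma msubst_mconst [simp]: "msubst \<phi> (mconst c) = mconst c"
  unfolding mconst_def[of c] msubst_single by (simp add: mconst_def)

lemma msubst_mvar [simp]: "msubst \<phi> (mvar i) = \<phi> i"
  by (simp add: mvar_def msubst_single mono_at_def)

lemma msubst_1 [simp]: "msubst \<phi> 1 = 1"
  using msubst_mconst[of \<phi> 1] by simp

lemma msubst_uminus [simp]: "msubst \<phi> (- f) = - msubst \<phi> f"
  by (metis add.inverse_unique msubst_0 msubst_add right_minus)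

lemma msubst_diff [simp]: "msubst \<phi> (f - g) = msubst \<phi> f - msubst \<phi> g"
  by (metis diff_conv_add_uminus msubst_add msubst_uminus)

lemma msubst_prod [simp]: "msubst \<phi> (\<Prod>i\<in>X. f i) = (\<Prod>i\<in>X. msubst \<phi> (f i))"
  by (induction X rule: infinite_finite_induct) auto

lemma msubst_power [simp]: "msubst \<phi> (f ^ j) = msubst \<phi> f ^ j"
  by (induction j) auto

lemma msubst_mscale [simp]: "msubst \<phi> (mscale c f) = mscale c (msubst \<phi> f)"
  by (simp add: mscale_def)

lemma msubst_msubst: "msubst \<phi> (msubst \<psi> f) = msubst (\<lambda>i. msubst \<phi> (\<psi> i)) f"
  by (simp add: msubst_def[of \<psi>] msubst_def[of "\<lambda>i. msubst \<phi> (\<psi> i)"])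

lemma mono_at_mvar: "mono_at mvar m = Poly_Mapping.single m (1::'k::field)"
proof -
  have pow: "Poly_Mapping.single (Poly_Mapping.single i (1::nat)) (1::'k) ^ j
      = Poly_Mapping.single (Poly_Mapping.single i j) 1" for i j
    by (induction j) (simp_all add: mult_single flip: single_add single_one)
  have prod: "finite X \<Longrightarrow> (\<Prod>i\<in>X. Poly_Mapping.single (g i) (1::'k)) = Poly_Mapping.single (\<Sum>i\<in>X. g i) 1"
    for X :: "nat set" and g :: "nat \<Rightarrow> nat \<Rightarrow>\<^sub>0 nat"
    by (induction X rule: finite_induct) (simp_all add: mult_single flip: single_one)
  have "(\<Sum>i\<in>Poly_Mapping.keys m. Poly_Mapping.single i (Poly_Mapping.lookup m i)) = m"
    by (rule poly_mapping_eqI)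
       (auto simp: lookup_sum lookup_single when_def in_keys_iff sum.delta' cong: if_cong)
  then show ?thesis by (simp add: mono_at_def mvar_def pow[unfolded One_nat_def] prod)
qed

lemma single_eq_mono: "Poly_Mapping.single m c = mconst c * mono_at mvar m"
  by (simp add: mono_at_mvar mconst_def mult_single)

lemma msubst_cong:
  assumes "\<And>m i. m \<in> Poly_Mapping.keys f \<Longrightarrow> i \<in> Poly_Mapping.keys m \<Longrightarrow> \<phi> i = \<psi> i"
  shows "msubst \<phi> f = msubst \<psi> f"
  unfolding msubst_def using assms by (intro sum.cong refl arg_cong2[where f = "(*)"] prod.cong) auto

lemma msubst_id [simp]: "msubst mvar f = f"
  by (subst (2) mpoly_eq_sum_single) (simp add: msubst_def single_eq_mono mono_at_def)

section \<open>Degree\<close>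

lemma mdeg_superset:
  assumes "finite X" "Poly_Mapping.keys m \<subseteq> X"
  shows "mdeg m = (\<Sum>i\<in>X. Poly_Mapping.lookup m i)"
  unfolding mdeg_def by (rule sum.mono_neutral_left) (use assms in \<open>auto simp: in_keys_iff\<close>)

lemma mdeg_0 [simp]: "mdeg 0 = 0"
  by (simp add: mdeg_def)

lemma mdeg_single [simp]: "mdeg (Poly_Mapping.single i j) = j"
  by (simp add: mdeg_def)

lemma mdeg_add [simp]: "mdeg (m + m') = mdeg m + mdeg m'"
proof -
  let ?X = "Poly_Mapping.keys m \<union> Poly_Mapping.keys m'"
  have "Poly_Mapping.keys (m + m') \<subseteq> ?X" by (rule Poly_Mapping.keys_add)
  then show ?thesis by (simp add: mdeg_superset[of ?X] lookup_add sum.distrib)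
qed

text \<open>The condition is \<open>deg f \<le> s - j\<close>, written without subtraction: for \<open>s < j\<close> it leaves only
  \<open>f = 0\<close>, which is what cofactors of a relation of degree \<open>j\<close> in a polynomial of degree at most
  \<open>s\<close> have to satisfy.\<close>

definition deg_le :: "nat \<Rightarrow> nat \<Rightarrow> nat \<Rightarrow> 'k::field mpoly set" where
  "deg_le n j s = {f \<in> carrier (poly_ring n). \<forall>m\<in>Poly_Mapping.keys f. mdeg m + j \<le> s}"

lemma poly_ring_sel [simp]:
  "carrier (poly_ring n) = {f. \<forall>m \<in> Poly_Mapping.keys f. Poly_Mapping.keys m \<subseteq> {..<n}}"
  "mult (poly_ring n) = (*)" "one (poly_ring n) = 1" "zero (poly_ring n) = 0" "add (poly_ring n) = (+)"
  by (simp_all add: poly_ring_def)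

text \<open>
  The polynomial ring, its graded parts and its degree filtration are all spanned by monomials. Their
  closure properties are proved here once, in terms of the set of admissible monomials.\<close>

definition supp_in :: "(nat \<Rightarrow>\<^sub>0 nat) set \<Rightarrow> 'k::field mpoly set" where
  "supp_in M = {f. Poly_Mapping.keys f \<subseteq> M}"

lemma supp_in_subspace: "mpoly.subspace (supp_in M)"
proof (rule mpoly.subspaceI)
  fix c and x :: "'a mpoly"
  assume "x \<in> supp_in M"
  then show "mscale c x \<in> supp_in M"
    using Poly_Mapping.keys_mult[of "mconst c" x]
    by (cases "c = 0") (auto simp: supp_in_def mscale_def mconst_def)
qed (use Poly_Mapping.keys_add in \<open>fastforce simp: supp_in_def\<close>)+

lemma supp_in_mult:
  assumes "f \<in> supp_in M" "g \<in> supp_in N" "\<And>a b. a \<in> M \<Longrightarrow> b \<in> N \<Longrightarrow> a + b \<in> K"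
  shows "f * g \<in> supp_in K"
  using assms Poly_Mapping.keys_mult[of f g] by (fastforce simp: supp_in_def)

lemma carrier_supp_in: "carrier (poly_ring n) = supp_in {m. Poly_Mapping.keys m \<subseteq> {..<n}}"
  by (auto simp: supp_in_def)

lemma graded_part_supp_in: "graded_part n e = supp_in {m. Poly_Mapping.keys m \<subseteq> {..<n} \<and> mdeg m = e}"
  by (auto simp: supp_in_def graded_part_def)

lemma deg_le_supp_in: "deg_le n j s = supp_in {m. Poly_Mapping.keys m \<subseteq> {..<n} \<and> mdeg m + j \<le> s}"
  by (auto simp: supp_in_def deg_le_def)

lemmas carrier_subspace = supp_in_subspace[of "{m. Poly_Mapping.keys m \<subseteq> {..<n}}" for n, folded carrier_supp_in]
lemmas graded_part_subspace = supp_in_subspace[of "{m. Poly_Mapping.keys m \<subseteq> {..<n} \<and> mdeg m = e}" for n e, folded graded_part_supp_in]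
lemmas deg_le_subspace = supp_in_subspace[of "{m. Poly_Mapping.keys m \<subseteq> {..<n} \<and> mdeg m + j \<le> s}" for n j s, folded deg_le_supp_in]

lemma keys_add_subset: "Poly_Mapping.keys (a::nat \<Rightarrow>\<^sub>0 nat) \<subseteq> N \<Longrightarrow> Poly_Mapping.keys b \<subseteq> N \<Longrightarrow> Poly_Mapping.keys (a + b) \<subseteq> N"
  using Poly_Mapping.keys_add[of a b] by blast

lemma carrier_mult:
  "f \<in> carrier (poly_ring n) \<Longrightarrow> g \<in> carrier (poly_ring n) \<Longrightarrow> f * g \<in> carrier (poly_ring n)"
  unfolding carrier_supp_in by (erule (1) supp_in_mult) (simp add: keys_add_subset)

lemma graded_part_mult:
  "f \<in> graded_part n a \<Longrightarrow> g \<in> graded_part n b \<Longrightarrow> f * g \<in> graded_part n (a + b)"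
  unfolding graded_part_supp_in by (erule (1) supp_in_mult) (simp add: keys_add_subset)

lemma deg_le_mult:
  "f \<in> deg_le n i s \<Longrightarrow> g \<in> deg_le n j t \<Longrightarrow> f * g \<in> deg_le n (i + j) (s + t)"
  unfolding deg_le_supp_in by (erule (1) supp_in_mult) (simp add: keys_add_subset)

lemma mconst_graded [intro]: "mconst c \<in> graded_part n 0"
  by (cases "c = 0") (simp_all add: graded_part_def mconst_def)

lemma one_graded [simp, intro]: "1 \<in> graded_part n 0"
  using mconst_graded[of 1] by simp

lemma mvar_graded [intro]: "i < n \<Longrightarrow> mvar i \<in> graded_part n (Suc 0)"
  by (simp add: graded_part_def mvar_def)

lemma graded_part_power: "f \<in> graded_part n a \<Longrightarrow> f ^ j \<in> graded_part n (j * a)"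
  by (induction j) (auto intro: graded_part_mult)

lemma graded_part_prod:
  "(\<And>i. i \<in> X \<Longrightarrow> f i \<in> graded_part n (a i)) \<Longrightarrow> (\<Prod>i\<in>X. f i) \<in> graded_part n (\<Sum>i\<in>X. a i)"
  by (induction X rule: infinite_finite_induct) (auto intro: graded_part_mult)

lemma graded_imp_carrier: "f \<in> graded_part n e \<Longrightarrow> f \<in> carrier (poly_ring n)"
  by (simp add: graded_part_def)

lemma graded_imp_deg_le: "f \<in> graded_part n e \<Longrightarrow> e + j \<le> s \<Longrightarrow> f \<in> deg_le n j s"
  by (auto simp: graded_part_def deg_le_def)

lemma deg_le_mono: "f \<in> deg_le n j s \<Longrightarrow> n \<le> n' \<Longrightarrow> s + i \<le> t + j \<Longrightarrow> f \<in> deg_le n' i t"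
  by (fastforce simp: deg_le_def)

lemma graded_part_mono: "f \<in> graded_part n e \<Longrightarrow> n \<le> n' \<Longrightarrow> f \<in> graded_part n' e"
  by (fastforce simp: graded_part_def)

lemma deg_le_eq_0: "f \<in> deg_le n j s \<Longrightarrow> s < j \<Longrightarrow> f = 0"
  by (auto simp: deg_le_def simp flip: keys_eq_empty)

lemma single_graded: "Poly_Mapping.keys m \<subseteq> {..<n} \<Longrightarrow> mdeg m = e \<Longrightarrow> Poly_Mapping.single m c \<in> graded_part n e"
  by (cases "c = 0") (simp_all add: graded_part_def)

lemma carrier_deg_le:
  assumes "f \<in> carrier (poly_ring n)"
  obtains s where "f \<in> deg_le n 0 s"
proof
  show "f \<in> deg_le n 0 (Max (mdeg ` Poly_Mapping.keys f))" using assms by (simp add: deg_le_def)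
qed

text \<open>A substitution maps into a subspace as soon as it does so on monomials.\<close>

lemma supp_in_linear_image:
  assumes V: "mpoly.subspace V" and f: "f \<in> supp_in M"
    and mono: "\<And>m. m \<in> M \<Longrightarrow> msubst \<phi> (Poly_Mapping.single m 1) \<in> V"
  shows "msubst \<phi> f \<in> V"
proof -
  have "msubst \<phi> f = (\<Sum>m\<in>Poly_Mapping.keys f. mscale (Poly_Mapping.lookup f m) (msubst \<phi> (Poly_Mapping.single m 1)))"
    by (simp add: msubst_single mscale_def) (simp add: msubst_def mono_at_def)
  also have "\<dots> \<in> V"
    using f mono by (intro mpoly.subspace_sum[OF V] mpoly.subspace_scale[OF V]) (auto simp: supp_in_def)
  finally show ?thesis .
qed

lemma supp_in_span:
  assumes V: "mpoly.subspace V" and f: "f \<in> supp_in M"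
    and "\<And>m. m \<in> M \<Longrightarrow> Poly_Mapping.single m 1 \<in> V"
  shows "f \<in> V"
  using supp_in_linear_image[OF V f, of mvar] assms(3) by simp

subsection \<open>Homogeneous components\<close>

definition hcomp :: "nat \<Rightarrow> 'k::field mpoly \<Rightarrow> 'k mpoly" where
  "hcomp j f = Poly_Mapping.mapp (\<lambda>m c. c when mdeg m = j) f"

lemma lookup_hcomp: "Poly_Mapping.lookup (hcomp j f) m = (Poly_Mapping.lookup f m when mdeg m = j)"
  by (auto simp: hcomp_def lookup_mapp when_def in_keys_iff)

lemma hcomp_add [simp]: "hcomp j (f + g) = hcomp j f + hcomp j g"
  by (rule poly_mapping_eqI) (simp add: lookup_hcomp lookup_add when_add_distrib)

lemma hcomp_0 [simp]: "hcomp j 0 = 0"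
  by (rule poly_mapping_eqI) (simp add: lookup_hcomp)

lemma hcomp_sum [simp]: "hcomp j (\<Sum>i\<in>X. f i) = (\<Sum>i\<in>X. hcomp j (f i))"
  by (induction X rule: infinite_finite_induct) auto

lemma lookup_mscale [simp]: "Poly_Mapping.lookup (mscale c f) m = c * Poly_Mapping.lookup f m"
proof -
  have "mscale c f = Poly_Mapping.map ((*) c) f"
    by (simp add: mscale_def mconst_def mult_map_scale_conv_mult)
  then show ?thesis by (simp add: Poly_Mapping.map.rep_eq when_def)
qed

lemma hcomp_mscale [simp]: "hcomp j (mscale c f) = mscale c (hcomp j f)"
  by (rule poly_mapping_eqI) (simp add: lookup_hcomp when_def)

lemma keys_hcomp: "Poly_Mapping.keys (hcomp j f) = {m \<in> Poly_Mapping.keys f. mdeg m = j}"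
  by (auto simp: in_keys_iff lookup_hcomp when_def split: if_splits)

lemma hcomp_graded: "f \<in> carrier (poly_ring n) \<Longrightarrow> hcomp j f \<in> graded_part n j"
  by (auto simp: graded_part_def keys_hcomp)

lemma hcomp_eq: "f \<in> graded_part n e \<Longrightarrow> hcomp j f = (if j = e then f else 0)"
  by (rule poly_mapping_eqI) (auto simp: lookup_hcomp graded_part_def when_def in_keys_iff)

lemma sum_hcomp: 
  assumes "f \<in> deg_le n 0 s" 
  shows "(\<Sum>j\<le>s. hcomp j f) = f"
proof (rule poly_mapping_eqI)
  fix m
  have "Poly_Mapping.lookup f m = 0" if "\<not> mdeg m \<le> s"
    using assms that by (auto simp: deg_le_def in_keys_iff)
  then show "Poly_Mapping.lookup (\<Sum>j\<le>s. hcomp j f) m = Poly_Mapping.lookup f m"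
    by (auto simp: lookup_sum lookup_hcomp when_def)
qed

lemma hcomp_deg_le_eq_0:
  assumes "f \<in> deg_le n i s" "s < i + j"
  shows "hcomp j f = 0"
proof -
  have "Poly_Mapping.keys (hcomp j f) = {}"
    using assms by (fastforce simp: keys_hcomp deg_le_def)
  then show ?thesis by simp
qed

lemma hcomp_mult_graded:
  assumes f: "f \<in> graded_part n a" and g: "g \<in> carrier (poly_ring n)"
  shows "hcomp j (f * g) = (if a \<le> j then f * hcomp (j - a) g else 0)"
proof -
  obtain s where s: "g \<in> deg_le n 0 s" by (rule carrier_deg_le[OF g])
  have "hcomp j (f * g) = hcomp j (\<Sum>l\<le>s. f * hcomp l g)"
    using sum_hcomp[OF s] by (simp add: flip: sum_distrib_left)
  also have "\<dots> = (\<Sum>l\<le>s. if j = a + l then f * hcomp l g else 0)"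
    using hcomp_eq[OF graded_part_mult[OF f hcomp_graded[OF g]]] by simp
  also have "\<dots> = (\<Sum>l\<le>s. if l = j - a then (if a \<le> j then f * hcomp (j - a) g else 0) else 0)"
    by (intro sum.cong) auto
  also have "\<dots> = (if a \<le> j then f * hcomp (j - a) g else 0)"
    using hcomp_deg_le_eq_0[OF s, of "j - a"] by auto
  finally show ?thesis .
qed

section \<open>Evaluation\<close>

text \<open>Substituting constants yields a constant polynomial; the value is its constant coefficient.\<close>

definition eval_at :: "(nat \<Rightarrow> 'k) \<Rightarrow> 'k::field mpoly \<Rightarrow> 'k" where
  "eval_at x f = Poly_Mapping.lookup (msubst (\<lambda>i. mconst (x i)) f) 0"

lemma mconst_eval_at: "mconst (eval_at x f) = msubst (\<lambda>i. mconst (x i)) f"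
proof -
  have "\<exists>c. msubst (\<lambda>i. mconst (x i)) f = mconst c"
  proof -
    have "(\<Prod>i\<in>X. mconst (x i) ^ e i) = mconst (\<Prod>i\<in>X. x i ^ e i)" for X e
      by (induction X rule: infinite_finite_induct) (auto simp: mconst_power)
    then show ?thesis
      unfolding msubst_def by (auto simp flip: mconst_sum mconst_simps(4))
  qed
  then show ?thesis by (auto simp: eval_at_def mconst_def)
qed

lemma eval_at_eqI: "msubst (\<lambda>i. mconst (x i)) f = mconst c \<Longrightarrow> eval_at x f = c"
  by (simp flip: mconst_eval_at)

lemma eval_at_simps [simp]:
  "eval_at x (f + g) = eval_at x f + eval_at x g" "eval_at x (f - g) = eval_at x f - eval_at x g"
  "eval_at x (f * g) = eval_at x f * eval_at x g" "eval_at x (mconst c) = c" "eval_at x (mvar i) = x i"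
  "eval_at x 0 = 0" "eval_at x 1 = 1"
  by (rule eval_at_eqI, simp add: mconst_eval_at)+

lemma eval_at_mscale [simp]: "eval_at x (mscale c f) = c * eval_at x f"
  by (simp add: mscale_def)

lemma eval_at_prod [simp]: "eval_at x (\<Prod>i\<in>X. f i) = (\<Prod>i\<in>X. eval_at x (f i))"
  by (induction X rule: infinite_finite_induct) auto

lemma eval_at_msubst: "eval_at x (msubst \<phi> f) = eval_at (\<lambda>i. eval_at x (\<phi> i)) f"
  by (rule eval_at_eqI) (simp add: msubst_msubst mconst_eval_at)

section \<open>Elementary symmetric functions\<close>

text \<open>Reading the elementary symmetric functions off the product \<open>\<Prod>(1 + x\<^sub>j T)\<close> makes both their symmetry
  and the recursion in the number of variables immediate.\<close>

definition esym :: "(nat \<Rightarrow> 'a::comm_ring_1) \<Rightarrow> nat \<Rightarrow> nat \<Rightarrow> 'a" where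
  "esym x n i = coeff (\<Prod>j<n. [:1, x j:]) i"

lemma esym_0 [simp]: "esym x n 0 = 1"
  by (induction n) (auto simp: esym_def coeff_mult)

lemma esym_Suc: "esym x (Suc n) (Suc i) = esym x n (Suc i) + x n * esym x n i"
  by (simp add: esym_def mult.commute[of _ "[:1, x n:]"])

lemma esym_0_Suc [simp]: "esym x 0 (Suc i) = 0"
  by (simp add: esym_def)

lemma esym_eq_0: "n < i \<Longrightarrow> esym x n i = 0"
proof (induction n arbitrary: i)
  case 0
  then show ?case by (cases i) auto
next
  case (Suc n)
  then show ?case by (cases i) (auto simp: esym_Suc)
qed

lemma esym_permute: "\<sigma> permutes {..<n} \<Longrightarrow> esym (\<lambda>i. x (\<sigma> i)) n i = esym x n i"
  unfolding esym_def by (subst (2) prod.permute[of \<sigma>]) (auto simp: o_def)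

lemma msubst_esym: "msubst \<phi> (esym x n i) = esym (\<lambda>j. msubst \<phi> (x j)) n i"
proof (induction n arbitrary: i)
  case 0
  then show ?case by (cases i) auto
next
  case (Suc n)
  then show ?case by (cases i) (auto simp: esym_Suc)
qed

lemma eval_at_esym: "eval_at y (esym x n i) = esym (\<lambda>j. eval_at y (x j)) n i"
proof (induction n arbitrary: i)
  case 0
  then show ?case by (cases i) auto
next
  case (Suc n)
  then show ?case by (cases i) (auto simp: esym_Suc)
qed

lemma esym_vieta: "(\<Prod>j<n. X - x j) = (\<Sum>i\<le>n. (- 1) ^ i * esym x n i * X ^ (n - i))"
proof (induction n)
  case (Suc n)
  let ?t = "\<lambda>n i. (- 1) ^ i * esym x n i * X ^ (n - i)"
  have "(\<Sum>i\<le>Suc n. ?t (Suc n) i) = X ^ Suc n + (\<Sum>i\<le>n. ?t (Suc n) (Suc i))"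
    by (subst sum.atMost_Suc_shift) simp
  also have "(\<Sum>i\<le>n. ?t (Suc n) (Suc i)) =
      (\<Sum>i\<le>n. (- 1) ^ Suc i * esym x n (Suc i) * X ^ (n - i)) - x n * (\<Sum>i\<le>n. ?t n i)"
    by (simp add: esym_Suc sum_distrib_left algebra_simps sum_subtractf sum_negf flip: sum.distrib)
  also have "X ^ Suc n + ((\<Sum>i\<le>n. (- 1) ^ Suc i * esym x n (Suc i) * X ^ (n - i)) - x n * (\<Sum>i\<le>n. ?t n i))
     = (X ^ Suc n + (\<Sum>i\<le>n. (- 1) ^ Suc i * esym x n (Suc i) * X ^ (n - i))) - x n * (\<Sum>i\<le>n. ?t n i)"
    by simp
  also have "X ^ Suc n + (\<Sum>i\<le>n. (- 1) ^ Suc i * esym x n (Suc i) * X ^ (n - i)) =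
      (\<Sum>i\<le>Suc n. (- 1) ^ i * esym x n i * X ^ (Suc n - i))"
    by (subst sum.atMost_Suc_shift) simp
  also have "\<dots> = (\<Sum>i\<le>n. (- 1) ^ i * esym x n i * X ^ (Suc n - i))"
    by (simp add: esym_eq_0)
  also have "\<dots> = X * (\<Sum>i\<le>n. ?t n i)"
    by (simp add: sum_distrib_left Suc_diff_le mult_ac)
  finally show ?case by (simp add: Suc algebra_simps)
qed simp

lemma esym_mvar_graded: "(esym mvar n i :: 'k::field mpoly) \<in> graded_part n i"
proof (induction n arbitrary: i)
  case 0
  then show ?case using mpoly.subspace_0[OF graded_part_subspace] by (cases i) auto
next
  case (Suc n)
  have IH: "(esym mvar n j :: 'k mpoly) \<in> graded_part (Suc n) j" for j
    by (rule graded_part_mono[OF Suc.IH]) simp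
  have IH': "(mvar n * esym mvar n j :: 'k mpoly) \<in> graded_part (Suc n) (Suc j)" for j
    using graded_part_mult[OF mvar_graded[OF lessI] IH] by simp
  have "(esym mvar (Suc n) (Suc j) :: 'k mpoly) \<in> graded_part (Suc n) (Suc j)" for j
    unfolding esym_Suc by (rule mpoly.subspace_add[OF graded_part_subspace IH IH'])
  then show ?case using one_graded by (cases i) (simp_all only: esym_0)
qed

section \<open>Polynomials vanishing on an orbit of points\<close>

text \<open>Division by \<open>x\<^sub>n - v\<close>, where \<open>x\<^sub>n\<close> is the last variable: the remainder is the specialization at
  \<open>x\<^sub>n = v\<close>, and the quotient has degree one less. On monomials this is the factorization of
  \<open>x\<^sub>n\<^sup>k - v\<^sup>k\<close>.\<close>

lemma deg_le_var_split:
  assumes f: "f \<in> deg_le (Suc n) j s"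
  shows "msubst (mvar(n := mconst v)) f \<in> deg_le n j s"
    and "\<exists>q\<in>deg_le (Suc n) (Suc j) s. f = msubst (mvar(n := mconst v)) f + (mvar n - mconst v) * q"
proof -
  let ?\<phi> = "mvar(n := mconst v)"
  let ?M = "{m. Poly_Mapping.keys m \<subseteq> {..<Suc n} \<and> mdeg m + j \<le> s}"
  have split: "mono_at \<psi> m = (\<Prod>i<n. \<psi> i ^ Poly_Mapping.lookup m i) * \<psi> n ^ Poly_Mapping.lookup m n"
    if "Poly_Mapping.keys m \<subseteq> {..<Suc n}" for m \<psi>
    using that by (subst mono_at_superset[of "{..<Suc n}"]) auto
  have mono: "msubst ?\<phi> (Poly_Mapping.single m 1) \<in> deg_le n j s \<and>
      (\<exists>q\<in>deg_le (Suc n) (Suc j) s. Poly_Mapping.single m 1 =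
        msubst ?\<phi> (Poly_Mapping.single m 1) + (mvar n - mconst v) * q)" if m: "m \<in> ?M" for m
  proof -
    define k where "k = Poly_Mapping.lookup m n"
    define e where "e = (\<Sum>i<n. Poly_Mapping.lookup m i)"
    define a :: "'a mpoly" where "a = (\<Prod>i<n. mvar i ^ Poly_Mapping.lookup m i)"
    have ek: "e + k + j \<le> s"
      using m mdeg_superset[of "{..<Suc n}" m] by (simp add: e_def k_def)
    have "a \<in> graded_part n (\<Sum>i<n. Poly_Mapping.lookup m i * Suc 0)"
      unfolding a_def by (intro graded_part_prod graded_part_power) auto
    then have a: "a \<in> graded_part n e" by (simp add: e_def)
    have 1: "Poly_Mapping.single m 1 = a * mvar n ^ k"
      using m split[of m mvar] by (simp add: mono_at_mvar a_def k_def)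
    have 2: "msubst ?\<phi> (Poly_Mapping.single m 1) = a * mconst v ^ k"
      using m split[of m ?\<phi>] by (simp add: msubst_single a_def k_def)
    have "a * mconst v ^ k \<in> graded_part n (e + k * 0)"
      by (intro graded_part_mult graded_part_power a mconst_graded)
    then have 3: "a * mconst v ^ k \<in> deg_le n j s"
      using ek by (auto intro: graded_imp_deg_le)
    define q where "q = a * (\<Sum>i<k. mconst v ^ (k - Suc i) * mvar n ^ i)"
    have "mconst v ^ (k - Suc i) * mvar n ^ i \<in> deg_le (Suc n) (Suc 0) k" if "i < k" for i
    proof (rule graded_imp_deg_le)
      show "mconst v ^ (k - Suc i) * mvar n ^ i \<in> graded_part (Suc n) ((k - Suc i) * 0 + i * Suc 0)"
        by (intro graded_part_mult graded_part_power mconst_graded mvar_graded) auto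
    qed (use that in auto)
    then have "(\<Sum>i<k. mconst v ^ (k - Suc i) * mvar n ^ i) \<in> deg_le (Suc n) (Suc 0) k"
      by (intro mpoly.subspace_sum[OF deg_le_subspace]) auto
    moreover have "a \<in> deg_le (Suc n) 0 e"
      using graded_imp_deg_le[OF a, of 0 e] by (auto intro: deg_le_mono)
    ultimately have "q \<in> deg_le (Suc n) (0 + Suc 0) (e + k)"
      unfolding q_def by (intro deg_le_mult)
    then have 4: "q \<in> deg_le (Suc n) (Suc j) s"
      by (rule deg_le_mono) (use ek in auto)
    have "a * mvar n ^ k - a * mconst v ^ k = (mvar n - mconst v) * q"
      by (simp add: q_def mult.left_commute flip: right_diff_distrib power_diff_sumr2)
    then have "a * mvar n ^ k = a * mconst v ^ k + (mvar n - mconst v) * q" by (simp add: algebra_simps)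
    then show ?thesis unfolding 2 unfolding 1 using 3 4 by blast
  qed
  show "msubst ?\<phi> f \<in> deg_le n j s"
    by (rule supp_in_linear_image[OF deg_le_subspace f[unfolded deg_le_supp_in]]) (use mono in blast)
  let ?V = "{f. \<exists>q\<in>deg_le (Suc n) (Suc j) s. f = msubst ?\<phi> f + (mvar n - mconst v) * q}"
  have "mpoly.subspace ?V"
  proof (rule mpoly.subspaceI)
    show "0 \<in> ?V" using mpoly.subspace_0[OF deg_le_subspace] by (auto intro!: bexI[of _ 0])
  next
    fix x y assume "x \<in> ?V" "y \<in> ?V"
    then obtain q r where qr: "q \<in> deg_le (Suc n) (Suc j) s" "r \<in> deg_le (Suc n) (Suc j) s"
      "x = msubst ?\<phi> x + (mvar n - mconst v) * q" "y = msubst ?\<phi> y + (mvar n - mconst v) * r" by blast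
    have "x + y = (msubst ?\<phi> x + (mvar n - mconst v) * q) + (msubst ?\<phi> y + (mvar n - mconst v) * r)"
      using arg_cong2[OF qr(3,4), of "(+)"] .
    also have "\<dots> = msubst ?\<phi> (x + y) + (mvar n - mconst v) * (q + r)" by (simp add: distrib_left)
    finally show "x + y \<in> ?V"
      using mpoly.subspace_add[OF deg_le_subspace qr(1,2)] by blast
  next
    fix c x assume "x \<in> ?V"
    then obtain q where q: "q \<in> deg_le (Suc n) (Suc j) s" "x = msubst ?\<phi> x + (mvar n - mconst v) * q" by blast
    have "mscale c x = mscale c (msubst ?\<phi> x + (mvar n - mconst v) * q)" using q(2) by simp
    also have "\<dots> = msubst ?\<phi> (mscale c x) + (mvar n - mconst v) * mscale c q"
      by (simp add: mscale_def algebra_simps)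
    finally show "mscale c x \<in> ?V"
      using mpoly.subspace_scale[OF deg_le_subspace q(1)] by blast
  qed
  then have "f \<in> ?V"
    by (rule supp_in_span[OF _ f[unfolded deg_le_supp_in]]) (use mono in blast)
  then show "\<exists>q\<in>deg_le (Suc n) (Suc j) s. f = msubst ?\<phi> f + (mvar n - mconst v) * q" by blast
qed

text \<open>An elementary symmetric function minus its value at \<open>p\<close>; it vanishes on all rearrangements of \<open>p\<close>.\<close>

definition orbit_rel :: "nat \<Rightarrow> (nat \<Rightarrow> 'k) \<Rightarrow> nat \<Rightarrow> 'k::field mpoly" where
  "orbit_rel n p i = esym mvar n i - mconst (esym p n i)"

text \<open>The ideal of these relations, with control of degrees: only combinations in which no single
  product exceeds degree \<open>s\<close> are admitted. This is stronger than asking for an element of the ideal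
  that has degree at most \<open>s\<close>, and it is what makes statements about leading forms possible.\<close>

definition orbit_ideal :: "nat \<Rightarrow> (nat \<Rightarrow> 'k) \<Rightarrow> nat \<Rightarrow> 'k::field mpoly set" where
  "orbit_ideal n p s = mpoly.span {orbit_rel n p i * h | i h. 1 \<le> i \<and> h \<in> deg_le n i s}"

lemma orbit_ideal_subspace: "mpoly.subspace (orbit_ideal n p s)"
  by (simp add: orbit_ideal_def mpoly.subspace_span)

lemma orbit_idealI: "1 \<le> i \<Longrightarrow> h \<in> deg_le n i s \<Longrightarrow> orbit_rel n p i * h \<in> orbit_ideal n p s"
  unfolding orbit_ideal_def by (rule mpoly.span_base) blast

lemma orbit_ideal_mult:
  assumes "f \<in> orbit_ideal n p s" and g: "g \<in> deg_le n a b" and "b + s \<le> a + t"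
  shows "f * g \<in> orbit_ideal n p t"
  using assms(1) unfolding orbit_ideal_def[of n p s]
proof (induction f rule: mpoly.span_induct_alt)
  case base
  show ?case by (simp add: mpoly.subspace_0[OF orbit_ideal_subspace])
next
  case (step c x y)
  then obtain i h where x: "x = orbit_rel n p i * h" "1 \<le> i" "h \<in> deg_le n i s" by blast
  have "h * g \<in> deg_le n (i + a) (s + b)" by (intro deg_le_mult x g)
  then have "h * g \<in> deg_le n i t" by (rule deg_le_mono) (use assms(3) in auto)
  then have "x * g \<in> orbit_ideal n p t" using orbit_idealI[OF x(2)] by (simp add: x(1) mult.assoc)
  moreover have "(mscale c x + y) * g = mscale c (x * g) + y * g" by (simp add: mscale_def algebra_simps)
  ultimately show ?case using step.IH
    by (simp add: mpoly.subspace_add[OF orbit_ideal_subspace] mpoly.subspace_scale[OF orbit_ideal_subspace])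
qed

lemma orbit_ideal_vanishes:
  assumes "f \<in> orbit_ideal n p s" "\<sigma> permutes {..<n}"
  shows "eval_at (\<lambda>i. p (\<sigma> i)) f = 0"
  using assms(1) unfolding orbit_ideal_def
proof (induction f rule: mpoly.span_induct_alt)
  case (step c x y)
  then show ?case
    using esym_permute[OF assms(2), of p] by (auto simp: orbit_rel_def eval_at_esym)
qed simp

text \<open>By the formula of Vieta, \<open>\<Prod>(X - p\<^sub>j)\<close> and \<open>\<Prod>(X - x\<^sub>j)\<close> differ by a combination of the relations.
  The second product vanishes at \<open>X = x\<^sub>n\<close>.\<close>

lemma prod_vars_in_orbit_ideal:
  "(\<Prod>j<Suc n. mvar n - mconst (p j)) \<in> orbit_ideal (Suc n) p (Suc n)"
proof -
  let ?N = "Suc n"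
  let ?t = "\<lambda>e i. (- 1) ^ i * e i * mvar n ^ (?N - i) :: 'a mpoly"
  have "(\<Prod>j<?N. mvar n - mconst (p j)) = (\<Sum>i\<le>?N. ?t (esym (\<lambda>j. mconst (p j)) ?N) i)"
    by (rule esym_vieta)
  moreover have "0 = (\<Prod>j<?N. mvar n - mvar j :: 'a mpoly)" by simp
  then have "0 = (\<Sum>i\<le>?N. ?t (esym mvar ?N) i)" unfolding esym_vieta .
  ultimately have "(\<Prod>j<?N. mvar n - mconst (p j)) =
      (\<Sum>i\<le>?N. ?t (esym (\<lambda>j. mconst (p j)) ?N) i) - (\<Sum>i\<le>?N. ?t (esym mvar ?N) i)" by simp
  also have "\<dots> = (\<Sum>i\<le>?N. orbit_rel ?N p i * (mconst (- ((- 1) ^ i)) * mvar n ^ (?N - i)))"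
  proof -
    have "esym (\<lambda>j. mconst (p j)) ?N i = mconst (esym p ?N i)" for i
      using msubst_esym[of "\<lambda>j. mconst (p j)" mvar ?N i]
      by (simp add: eval_at_esym flip: mconst_eval_at)
    then show ?thesis
      by (simp add: orbit_rel_def mconst_power algebra_simps flip: sum_subtractf del: sum.atMost_Suc)
  qed
  also have "\<dots> \<in> orbit_ideal ?N p ?N"
  proof (rule mpoly.subspace_sum[OF orbit_ideal_subspace])
    fix i assume i: "i \<in> {..?N}"
    show "orbit_rel ?N p i * (mconst (- ((- 1) ^ i)) * mvar n ^ (?N - i)) \<in> orbit_ideal ?N p ?N"
    proof (cases "i = 0")
      case True
      then show ?thesis
        using mpoly.subspace_0[OF orbit_ideal_subspace] by (simp add: orbit_rel_def)
    next
      case False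
      have "mconst (- ((- 1) ^ i)) * mvar n ^ (?N - i) \<in> graded_part ?N (0 + (?N - i) * Suc 0)"
        by (intro graded_part_mult mconst_graded graded_part_power mvar_graded) auto
      then have "mconst (- ((- 1) ^ i)) * mvar n ^ (?N - i) \<in> deg_le ?N i ?N"
        by (rule graded_imp_deg_le) (use i in auto)
      then show ?thesis using False by (intro orbit_idealI) auto
    qed
  qed
  finally show ?thesis .
qed

text \<open>The relations in \<open>n\<close> variables for the point without its last coordinate are relations in \<open>n + 1\<close>
  variables, modulo \<open>x\<^sub>n - p\<^sub>n\<close>. This follows inductively from the recursion of the elementary symmetric
  functions, which expresses the \<open>i\<close>-th relation in fewer variables by the one of index \<open>i - 1\<close>.\<close>

lemma orbit_rel_restrict:
  "\<exists>q\<in>deg_le (Suc n) 1 i. orbit_rel n p i - (mvar n - mconst (p n)) * q \<in> orbit_ideal (Suc n) p i"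
proof (induction i)
  case 0
  show ?case
    by (rule bexI[of _ 0])
       (simp_all add: orbit_rel_def mpoly.subspace_0[OF deg_le_subspace] mpoly.subspace_0[OF orbit_ideal_subspace])
next
  case (Suc i)
  let ?x = "mvar n - mconst (p n)"
  from Suc obtain q where q: "q \<in> deg_le (Suc n) 1 i" "orbit_rel n p i - ?x * q \<in> orbit_ideal (Suc n) p i" by blast
  define q' where "q' = - (mvar n * q) - mconst (esym p n i)"
  have "mvar n * q \<in> deg_le (Suc n) (0 + 1) (1 + i)"
    by (intro deg_le_mult q graded_imp_deg_le[OF mvar_graded]) auto
  moreover have "mconst (esym p n i) \<in> deg_le (Suc n) 1 (Suc i)"
    by (rule graded_imp_deg_le[OF mconst_graded]) auto
  ultimately have "q' \<in> deg_le (Suc n) 1 (Suc i)"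
    unfolding q'_def by (intro mpoly.subspace_diff[OF deg_le_subspace] mpoly.subspace_neg[OF deg_le_subspace]) auto
  moreover have "orbit_rel n p (Suc i) - ?x * q' = orbit_rel (Suc n) p (Suc i) * 1 - (orbit_rel n p i - ?x * q) * mvar n"
    by (simp add: orbit_rel_def esym_Suc q'_def algebra_simps)
  moreover have "orbit_rel (Suc n) p (Suc i) * 1 \<in> orbit_ideal (Suc n) p (Suc i)"
    by (rule orbit_idealI) (auto intro: graded_imp_deg_le)
  moreover have "(orbit_rel n p i - ?x * q) * mvar n \<in> orbit_ideal (Suc n) p (Suc i)"
    by (rule orbit_ideal_mult[OF q(2), of _ 0 1]) (auto intro: graded_imp_deg_le[OF mvar_graded])
  ultimately show ?case using mpoly.subspace_diff[OF orbit_ideal_subspace] by metis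
qed

lemma orbit_ideal_restrict:
  assumes "g \<in> orbit_ideal n p s"
  shows "\<exists>q\<in>deg_le (Suc n) 1 s. g - (mvar n - mconst (p n)) * q \<in> orbit_ideal (Suc n) p s"
  using assms unfolding orbit_ideal_def[of n]
proof (induction g rule: mpoly.span_induct_alt)
  case base
  show ?case
    by (rule bexI[of _ 0])
       (simp_all add: mpoly.subspace_0[OF deg_le_subspace] mpoly.subspace_0[OF orbit_ideal_subspace])
next
  case (step c x y)
  let ?x = "mvar n - mconst (p n)"
  from step obtain i h where x: "x = orbit_rel n p i * h" "h \<in> deg_le n i s" by blast
  from x(2) have h: "h \<in> deg_le (Suc n) i s" by (rule deg_le_mono) auto
  from step obtain r where r: "r \<in> deg_le (Suc n) 1 s" "y - ?x * r \<in> orbit_ideal (Suc n) p s" by blast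
  obtain q where q: "q \<in> deg_le (Suc n) 1 i" "orbit_rel n p i - ?x * q \<in> orbit_ideal (Suc n) p i"
    using orbit_rel_restrict by blast
  have "q * h \<in> deg_le (Suc n) (1 + i) (i + s)" by (intro deg_le_mult q h)
  then have "q * h \<in> deg_le (Suc n) 1 s" by (rule deg_le_mono) auto
  then have "mscale c (q * h) + r \<in> deg_le (Suc n) 1 s"
    by (intro mpoly.subspace_add[OF deg_le_subspace] mpoly.subspace_scale[OF deg_le_subspace] r)
  moreover have "(orbit_rel n p i - ?x * q) * h \<in> orbit_ideal (Suc n) p s"
    by (rule orbit_ideal_mult[OF q(2) h]) auto
  then have "mscale c ((orbit_rel n p i - ?x * q) * h) + (y - ?x * r) \<in> orbit_ideal (Suc n) p s"
    by (intro mpoly.subspace_add[OF orbit_ideal_subspace] mpoly.subspace_scale[OF orbit_ideal_subspace] r)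
  moreover have "mscale c ((orbit_rel n p i - ?x * q) * h) + (y - ?x * r) =
      mscale c x + y - ?x * (mscale c (q * h) + r)"
    by (simp add: x mscale_def algebra_simps)
  ultimately show ?case by auto
qed

lemma orbit_ideal_permute:
  assumes "\<sigma> permutes {..<n}"
  shows "orbit_ideal n (\<lambda>i. p (\<sigma> i)) s = orbit_ideal n p s"
  by (simp add: orbit_ideal_def orbit_rel_def esym_permute[OF assms])

text \<open>Induction on the number of variables. Let \<open>v\<^sub>0, v\<^sub>1, \<dots>\<close> be the distinct coordinates of \<open>p\<close>. At
  \<open>x\<^sub>n = v\<^sub>0\<close> the polynomial \<open>f\<close> vanishes on the orbit of \<open>p\<close> with one coordinate \<open>v\<^sub>0\<close> removed,
  so by induction it is a combination of relations there; hence \<open>f\<close> is \<open>(x\<^sub>n - v\<^sub>0) f'\<close> modulo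
  relations. The quotient \<open>f'\<close> has smaller degree and vanishes on the points of the orbit with
  \<open>x\<^sub>n \<noteq> v\<^sub>0\<close>, and the argument continues with \<open>v\<^sub>1\<close>, and so on. It ends when the degree drops below
  zero, or when all coordinates of \<open>p\<close> are distinct and have been used up; then the product of the
  \<open>x\<^sub>n - v\<^sub>i\<close> is itself a combination of relations.

  The number of distinct coordinates must survive the first step, in which the degree does not drop.
  Therefore \<open>v\<^sub>0\<close> is taken to be a repeated coordinate if there is one.\<close>

theorem vanishing_on_orbit:
  assumes "f \<in> deg_le n 0 s"
    and "\<And>\<sigma>. \<sigma> permutes {..<n} \<Longrightarrow> eval_at (\<lambda>i. p (\<sigma> i)) f = 0"
    and "min n (s + 1) \<le> card (p ` {..<n})"
  shows "f \<in> orbit_ideal n p s"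
  using assms
proof (induction n arbitrary: s p f)
  case 0
  have "f = msubst (\<lambda>i. mconst (p i)) f"
    using 0(1) by (subst msubst_id[symmetric], intro msubst_cong) (auto simp: deg_le_def)
  also have "\<dots> = 0" using 0(2)[OF permutes_id] by (simp flip: mconst_eval_at)
  finally show ?case by (simp add: mpoly.subspace_0[OF orbit_ideal_subspace])
next
  case (Suc n)
  note f = Suc.prems(1) and van = Suc.prems(2) and crd = Suc.prems(3) and IH = Suc.IH
  let ?N = "Suc n"
  \<comment> \<open>the coordinate treated first\<close>
  obtain v0 where v0: "v0 \<in> p ` {..<?N}"
    "\<not> inj_on p {..<?N} \<Longrightarrow> \<exists>a<?N. \<exists>b<?N. a \<noteq> b \<and> p a = v0 \<and> p b = v0"
  proof (cases "inj_on p {..<?N}")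
    case True
    then show ?thesis by (intro that[of "p 0"]) auto
  next
    case False
    then obtain a b where "a < ?N" "b < ?N" "a \<noteq> b" "p a = p b" by (auto simp: inj_on_def)
    then have "p a \<in> p ` {..<?N}" "\<exists>a'<?N. \<exists>b<?N. a' \<noteq> b \<and> p a' = p a \<and> p b = p a" by auto
    then show ?thesis by (rule that)
  qed
  obtain ws where ws: "set ws = p ` {..<?N} - {v0}" "distinct ws"
    using finite_distinct_list[of "p ` {..<?N} - {v0}"] by auto
  define vs where "vs = v0 # ws"
  have vs: "set vs = p ` {..<?N}" "distinct vs" "vs ! 0 = v0" using ws v0 by (auto simp: vs_def)
  have len: "length vs = card (p ` {..<?N})" using distinct_card[OF vs(2)] vs(1) by simp
  define \<pi> where "\<pi> j = (\<Prod>l<j. mvar n - mconst (vs ! l))" for j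
  have pi_deg: "\<pi> j \<in> deg_le ?N 0 j" for j
  proof (induction j)
    case 0
    show ?case unfolding \<pi>_def by (simp, rule graded_imp_deg_le[OF one_graded]) simp
  next
    case (Suc j)
    have "mvar n - mconst (vs ! j) \<in> deg_le ?N 0 1"
      by (intro mpoly.subspace_diff[OF deg_le_subspace] graded_imp_deg_le[OF mvar_graded]
          graded_imp_deg_le[OF mconst_graded]) auto
    from deg_le_mult[OF Suc this] show ?case by (simp add: \<pi>_def)
  qed
  have main: "\<exists>g\<in>deg_le ?N j s. f - \<pi> j * g \<in> orbit_ideal ?N p s" if "j \<le> length vs" for j
    using that
  proof (induction j)
    case 0
    show ?case using f by (intro bexI[of _ f]) (auto simp: \<pi>_def mpoly.subspace_0[OF orbit_ideal_subspace])
  next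
    case (Suc j)
    then obtain g where g: "g \<in> deg_le ?N j s" "f - \<pi> j * g \<in> orbit_ideal ?N p s" by auto
    show ?case
    proof (cases "s < j")
      case True
      then have "g = 0" using g(1) deg_le_eq_0 by blast
      then show ?thesis using g(2) mpoly.subspace_0[OF deg_le_subspace] by (intro bexI[of _ 0]) auto
    next
      case False
      then have sj: "j \<le> s" by simp
      define v where "v = vs ! j"
      have jl: "j < length vs" using Suc.prems by simp
      then have "v \<in> p ` {..<?N}" unfolding v_def vs(1)[symmetric] by (rule nth_mem)
      then obtain a where a: "a < ?N" "p a = v"
        and rep: "j = 0 \<Longrightarrow> \<not> inj_on p {..<?N} \<Longrightarrow> \<exists>b<?N. b \<noteq> a \<and> p b = p a"
      proof (cases "j = 0 \<and> \<not> inj_on p {..<?N}")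
        case True
        then have "v = v0" using vs(3) by (simp add: v_def)
        obtain a b where "a < ?N" "b < ?N" "a \<noteq> b" "p a = v0" "p b = v0"
          using v0(2) True by blast
        then show ?thesis using \<open>v = v0\<close> by (intro that[of a]) auto
      qed auto
      define \<tau> where "\<tau> = Transposition.transpose a n"
      have \<tau>: "\<tau> permutes {..<?N}" unfolding \<tau>_def using a by (intro permutes_swap_id) auto
      define p' where "p' i = p (\<tau> i)" for i
      have p'n: "p' n = v" by (simp add: p'_def \<tau>_def a)
      define g' where "g' = msubst (mvar(n := mconst v)) g"
      obtain q2 where g': "g' \<in> deg_le n j s" and q2: "q2 \<in> deg_le ?N (Suc j) s" "g = g' + (mvar n - mconst v) * q2"
        using deg_le_var_split[OF g(1), of v] unfolding g'_def by blast
      have "g' \<in> orbit_ideal n p' (s - j)"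
      proof (rule IH)
        show "g' \<in> deg_le n 0 (s - j)" using g' by (rule deg_le_mono) (use sj in auto)
      next
        fix \<sigma> assume \<sigma>: "\<sigma> permutes {..<n}"
        then have \<sigma>n: "\<sigma> n = n" by (auto simp: permutes_def)
        have perm: "(\<tau> \<circ> \<sigma>) permutes {..<?N}"
          using \<sigma> \<tau> by (intro permutes_compose permutes_subset[OF \<sigma>]) auto
        have "eval_at (\<lambda>i. p ((\<tau> \<circ> \<sigma>) i)) (f - \<pi> j * g) = 0"
          by (rule orbit_ideal_vanishes[OF g(2) perm])
        \<comment> \<open>the factors divided out so far do not vanish, because the last coordinate is \<open>vs ! j\<close>\<close>
        then have "(\<Prod>l<j. p (\<tau> (\<sigma> n)) - vs ! l) * eval_at (\<lambda>i. p ((\<tau> \<circ> \<sigma>) i)) g = 0"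
          using van[OF perm] by (simp add: \<pi>_def)
        moreover have "p (\<tau> (\<sigma> n)) = vs ! j" using p'n by (simp add: p'_def \<sigma>n v_def)
        then have "(\<Prod>l<j. p (\<tau> (\<sigma> n)) - vs ! l) \<noteq> 0"
          using jl vs(2) by (auto simp: nth_eq_iff_index_eq)
        ultimately have "eval_at (\<lambda>i. p ((\<tau> \<circ> \<sigma>) i)) g = 0" by simp
        moreover have "eval_at (\<lambda>i. p' (\<sigma> i)) g' = eval_at (\<lambda>i. p ((\<tau> \<circ> \<sigma>) i)) g"
          unfolding g'_def eval_at_msubst using p'n
          by (intro arg_cong2[where f = eval_at] refl ext) (auto simp: \<sigma>n p'_def)
        ultimately show "eval_at (\<lambda>i. p' (\<sigma> i)) g' = 0" by simp
      next
        have "\<tau> ` {..<n} = {..<?N} - {a}"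
        proof -
          have "{..<n} = {..<?N} - {n}" by auto
          then have "\<tau> ` {..<n} = \<tau> ` {..<?N} - \<tau> ` {n}"
            by (simp only: image_set_diff[OF permutes_inj[OF \<tau>]])
          also have "\<tau> ` {n} = {a}" by (simp add: \<tau>_def)
          finally show ?thesis unfolding permutes_image[OF \<tau>] .
        qed
        moreover have "p' = p \<circ> \<tau>" by (auto simp: p'_def)
        ultimately have img: "p' ` {..<n} = p ` ({..<?N} - {a})"
          by (simp only: image_comp[symmetric])
        have sub: "p ` {..<?N} \<subseteq> insert (p a) (p ` ({..<?N} - {a}))" by auto
        show "min n (s - j + 1) \<le> card (p' ` {..<n})"
        proof (cases "j = 0 \<and> \<not> inj_on p {..<?N}")
          case True
          then obtain b where "b < ?N" "b \<noteq> a" "p b = p a" using rep by blast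
          then have "p a \<in> p ` ({..<?N} - {a})" by (intro image_eqI[of _ _ b]) auto
          then have "p ` {..<?N} = p ` ({..<?N} - {a})" using sub by blast
          moreover have "card (p ` {..<?N}) \<noteq> ?N"
            using True eq_card_imp_inj_on[of "{..<?N}" p] by auto
          moreover have "card (p ` {..<?N}) \<le> ?N" using card_image_le[of "{..<?N}" p] by simp
          ultimately show ?thesis using crd img by simp
        next
          case False
          have "card (p ` {..<?N}) \<le> Suc (card (p ` ({..<?N} - {a})))"
            using card_mono[OF _ sub] card_insert_le_m1 by (simp add: card_insert_if split: if_splits)
          moreover have "card (p ` {..<?N}) = ?N" if "j = 0"
            using False that card_image[of p "{..<?N}"] by simp
          ultimately show ?thesis using crd img sj by (cases "j = 0") auto
        qed
      qed
      from orbit_ideal_restrict[OF this] obtain q1 where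
        q1: "q1 \<in> deg_le ?N 1 (s - j)" "g' - (mvar n - mconst v) * q1 \<in> orbit_ideal ?N p' (s - j)"
        unfolding p'n by blast
      have "q1 \<in> deg_le ?N (Suc j) s" using q1(1) by (rule deg_le_mono) (use sj in auto)
      then have q: "q1 + q2 \<in> deg_le ?N (Suc j) s"
        using q2 by (intro mpoly.subspace_add[OF deg_le_subspace])
      moreover have "orbit_ideal ?N p' (s - j) = orbit_ideal ?N p (s - j)"
        using orbit_ideal_permute[OF \<tau>, of p "s - j"] by (simp add: p'_def[abs_def])
      ultimately have "g' - (mvar n - mconst v) * q1 \<in> orbit_ideal ?N p (s - j)"
        using q1(2) by simp
      then have "(g' - (mvar n - mconst v) * q1) * \<pi> j \<in> orbit_ideal ?N p s"
        by (rule orbit_ideal_mult[OF _ pi_deg]) (use sj in auto)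
      then have "(f - \<pi> j * g) + (g' - (mvar n - mconst v) * q1) * \<pi> j \<in> orbit_ideal ?N p s"
        by (intro mpoly.subspace_add[OF orbit_ideal_subspace] g)
      moreover have "(f - \<pi> j * g) + (g' - (mvar n - mconst v) * q1) * \<pi> j = f - \<pi> (Suc j) * (q1 + q2)"
        unfolding \<pi>_def q2(2) by (simp add: v_def algebra_simps)
      ultimately show ?thesis using q by auto
    qed
  qed
  from main[OF order_refl] obtain g where
    g: "g \<in> deg_le ?N (length vs) s" "f - \<pi> (length vs) * g \<in> orbit_ideal ?N p s" by blast
  show ?case
  proof (cases "s < length vs")
    case True
    then have "g = 0" using g(1) deg_le_eq_0 by blast
    then show ?thesis using g(2) by simp
  next
    case False
    then have card: "card (p ` {..<?N}) = ?N"
      using crd len card_image_le[of "{..<?N}" p] by auto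
    then have "inj_on p {..<?N}" by (intro eq_card_imp_inj_on) auto
    have "\<pi> (length vs) = (\<Prod>v\<in>set vs. mvar n - mconst v)"
      unfolding \<pi>_def using vs(2)
      by (subst prod.distinct_set_conv_list) (simp_all add: prod.list_conv_set_nth atLeast0LessThan)
    also have "\<dots> = (\<Prod>j<?N. mvar n - mconst (p j))"
      unfolding vs(1) using \<open>inj_on p {..<?N}\<close> by (subst prod.reindex) (simp_all del: prod.lessThan_Suc)
    finally have "\<pi> (length vs) \<in> orbit_ideal ?N p ?N" using prod_vars_in_orbit_ideal by metis
    then have "\<pi> (length vs) * g \<in> orbit_ideal ?N p s"
      by (rule orbit_ideal_mult[OF _ g(1)]) (simp add: len card)
    then have "(f - \<pi> (length vs) * g) + \<pi> (length vs) * g \<in> orbit_ideal ?N p s"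
      by (intro mpoly.subspace_add[OF orbit_ideal_subspace] g)
    then show ?thesis by simp
  qed
qed

section \<open>The symmetric group action\<close>

lemma perm_act_simps [simp]:
  "perm_act \<sigma> (f + g) = perm_act \<sigma> f + perm_act \<sigma> g" "perm_act \<sigma> (f - g) = perm_act \<sigma> f - perm_act \<sigma> g"
  "perm_act \<sigma> (f * g) = perm_act \<sigma> f * perm_act \<sigma> g" "perm_act \<sigma> 0 = 0" "perm_act \<sigma> 1 = 1"
  "perm_act \<sigma> (mscale c f) = mscale c (perm_act \<sigma> f)" "perm_act \<sigma> (mvar i) = mvar (\<sigma> i)"
  "perm_act \<sigma> (f ^ j) = perm_act \<sigma> f ^ j"
  by (simp_all add: perm_act_eq_msubst)

lemma perm_act_sum [simp]: "perm_act \<sigma> (\<Sum>i\<in>X. h i) = (\<Sum>i\<in>X. perm_act \<sigma> (h i))"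
  by (simp add: perm_act_eq_msubst)

lemma perm_act_prod [simp]: "perm_act \<sigma> (\<Prod>i\<in>X. h i) = (\<Prod>i\<in>X. perm_act \<sigma> (h i))"
  by (simp add: perm_act_eq_msubst)

lemma perm_act_perm_act: "perm_act \<sigma> (perm_act \<tau> f) = perm_act (\<sigma> \<circ> \<tau>) f"
  by (simp add: perm_act_eq_msubst msubst_msubst)

lemma perm_act_id [simp]: "perm_act id f = f"
  by (simp add: perm_act_eq_msubst)

lemma perm_act_esym [simp]: "\<sigma> permutes {..<n} \<Longrightarrow> perm_act \<sigma> (esym mvar n i) = esym mvar n i"
  by (simp add: perm_act_eq_msubst msubst_esym esym_permute[of \<sigma> n mvar])

lemma eval_at_perm_act: "eval_at x (perm_act \<sigma> f) = eval_at (\<lambda>i. x (\<sigma> i)) f"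
  by (simp add: perm_act_eq_msubst eval_at_msubst)

lemma perm_act_graded:
  assumes f: "f \<in> graded_part n e" and \<sigma>: "\<sigma> permutes {..<n}"
  shows "perm_act \<sigma> f \<in> graded_part n e"
  unfolding perm_act_eq_msubst
proof (rule supp_in_linear_image[OF graded_part_subspace f[unfolded graded_part_supp_in]])
  fix m assume m: "m \<in> {m. Poly_Mapping.keys m \<subseteq> {..<n} \<and> mdeg m = e}"
  have "(\<Prod>i\<in>Poly_Mapping.keys m. mvar (\<sigma> i) ^ Poly_Mapping.lookup m i)
      \<in> graded_part n (\<Sum>i\<in>Poly_Mapping.keys m. Poly_Mapping.lookup m i * Suc 0)"
    using m permutes_in_image[OF \<sigma>] by (intro graded_part_prod graded_part_power mvar_graded) auto
  then show "msubst (\<lambda>i. mvar (\<sigma> i)) (Poly_Mapping.single m 1) \<in> graded_part n e"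
    using m by (simp add: msubst_single mono_at_def mdeg_def)
qed

lemma perm_act_inv:
  assumes "\<sigma> permutes X"
  shows "perm_act (Hilbert_Choice.inv \<sigma>) (perm_act \<sigma> f) = f" "perm_act \<sigma> (perm_act (Hilbert_Choice.inv \<sigma>) f) = f"
  by (simp_all add: perm_act_perm_act permutes_inv_o[OF assms])

definition gspan :: "nat \<Rightarrow> 'k::field mpoly set \<Rightarrow> 'k mpoly set" where
  "gspan n F = mpoly.span {perm_act \<sigma> f | \<sigma> f. \<sigma> permutes {..<n} \<and> f \<in> F}"

definition stable :: "nat \<Rightarrow> 'k::field mpoly set \<Rightarrow> bool" where
  "stable n V \<longleftrightarrow> mpoly.subspace V \<and> (\<forall>\<sigma> f. \<sigma> permutes {..<n} \<longrightarrow> f \<in> V \<longrightarrow> perm_act \<sigma> f \<in> V)"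

lemma stableD: "stable n V \<Longrightarrow> \<sigma> permutes {..<n} \<Longrightarrow> f \<in> V \<Longrightarrow> perm_act \<sigma> f \<in> V"
  and stable_subspace: "stable n V \<Longrightarrow> mpoly.subspace V"
  by (auto simp: stable_def)

lemma gspan_base:
  assumes "f \<in> F"
  shows "f \<in> gspan n F"
  unfolding gspan_def
  by (rule mpoly.span_base, rule CollectI, rule exI[of _ id], rule exI[of _ f]) (simp add: assms)

lemma stable_span:
  assumes "\<And>\<sigma> f. \<sigma> permutes {..<n} \<Longrightarrow> f \<in> B \<Longrightarrow> perm_act \<sigma> f \<in> mpoly.span B"
  shows "stable n (mpoly.span B)"
  unfolding stable_def
proof (intro conjI allI impI)
  show "mpoly.subspace (mpoly.span B)" by (rule mpoly.subspace_span)
  fix \<sigma> f assume \<sigma>: "\<sigma> permutes {..<n}" and "f \<in> mpoly.span B"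
  from this(2) show "perm_act \<sigma> f \<in> mpoly.span B"
    by (induction f rule: mpoly.span_induct_alt)
       (auto simp: mpoly.span_zero mpoly.span_add mpoly.span_scale assms[OF \<sigma>])
qed

lemma stable_gspan: "stable n (gspan n F)"
  unfolding gspan_def
proof (rule stable_span, rule mpoly.span_base)
  fix \<sigma> f assume \<sigma>: "\<sigma> permutes {..<n}"
    and "f \<in> {perm_act \<sigma> f | \<sigma> f. \<sigma> permutes {..<n} \<and> f \<in> F}"
  then obtain \<tau> g where "f = perm_act \<tau> g" "\<tau> permutes {..<n}" "g \<in> F" by blast
  then show "perm_act \<sigma> f \<in> {perm_act \<sigma> f | \<sigma> f. \<sigma> permutes {..<n} \<and> f \<in> F}"
    using permutes_compose[OF _ \<sigma>] by (auto simp: perm_act_perm_act)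
qed

lemma gspan_minimal: "stable n V \<Longrightarrow> F \<subseteq> V \<Longrightarrow> gspan n F \<subseteq> V"
  unfolding gspan_def by (rule mpoly.span_minimal) (auto simp: stable_def)

lemma gspan_mono: "F \<subseteq> F' \<Longrightarrow> gspan n F \<subseteq> gspan n F'"
  by (rule gspan_minimal[OF stable_gspan]) (auto intro: gspan_base)

lemma stable_graded_part: "stable n (graded_part n e)"
  by (simp add: stable_def graded_part_subspace perm_act_graded)

text \<open>This is what the introduction calls type \<open>t\<close>: such a \<open>y\<close> generates a quotient of the permutation
  module on the injections of \<open>{..<t}\<close> into \<open>{..<n}\<close>. In particular the elements of type \<open>0\<close> are the
  invariants, while \<open>n - 1\<close> imposes no condition.\<close>

definition tail_fixed :: "nat \<Rightarrow> nat \<Rightarrow> 'k::field mpoly \<Rightarrow> bool" where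
  "tail_fixed n t y \<longleftrightarrow> (\<forall>\<sigma>. \<sigma> permutes {t..<n} \<longrightarrow> perm_act \<sigma> y = y)"

definition sym_avg :: "nat set \<Rightarrow> 'k::field mpoly \<Rightarrow> 'k mpoly" where
  "sym_avg X f = mscale (inverse (of_nat (fact (card X)))) (\<Sum>\<sigma> | \<sigma> permutes X. perm_act \<sigma> f)"

lemma perm_act_sym_avg:
  assumes "\<tau> permutes X"
  shows "perm_act \<tau> (sym_avg X f) = sym_avg X f"
proof -
  have "(\<Sum>\<sigma> | \<sigma> permutes X. perm_act (\<tau> \<circ> \<sigma>) f) = (\<Sum>\<sigma> | \<sigma> permutes X. perm_act \<sigma> f)"
    by (rule setum_permutations_compose_left[OF assms, symmetric])
  then show ?thesis unfolding sym_avg_def perm_act_simps perm_act_sum perm_act_perm_act by metis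
qed

lemma sym_avg_perm_act:
  assumes "\<tau> permutes X"
  shows "sym_avg X (perm_act \<tau> f) = sym_avg X f"
  unfolding sym_avg_def sum_permutations_compose_right[OF assms, of "\<lambda>\<sigma>. perm_act \<sigma> f"]
  by (simp add: perm_act_perm_act)

lemma sym_avg_linear [simp]:
  "sym_avg X (f + g) = sym_avg X f + sym_avg X g" "sym_avg X (f - g) = sym_avg X f - sym_avg X g"
  "sym_avg X (mscale c f) = mscale c (sym_avg X f)" "sym_avg X 0 = 0"
  by (simp_all add: sym_avg_def sum.distrib sum_subtractf mpoly.scale_right_distrib
      mpoly.scale_right_diff_distrib mpoly.scale_left_commute flip: mpoly.scale_sum_right)

lemma sym_avg_mem:
  assumes V: "stable n V" and "X \<subseteq> {..<n}" "f \<in> V"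
  shows "sym_avg X f \<in> V"
  unfolding sym_avg_def using assms permutes_subset[of _ X "{..<n}"] stable_subspace[OF V]
  by (intro mpoly.subspace_scale mpoly.subspace_sum) (auto intro: stableD)

text \<open>Over \<open>'k\<close> the averages over all groups of permutations of subsets of the variables exist. The
  parameter \<open>ty\<close> ties the locale to the field.\<close>

locale nonmodular =
  fixes n :: nat and ty :: "'k::field itself"
  assumes fact_nonzero: "(of_nat (fact n) :: 'k) \<noteq> 0"
begin

lemma fact_card_nonzero:
  assumes "X \<subseteq> {..<n}"
  shows "(of_nat (fact (card X)) :: 'k) \<noteq> 0"
proof
  assume "(of_nat (fact (card X)) :: 'k) = 0"
  moreover have "card X \<le> n" using card_mono[OF _ assms] by simp
  then obtain q :: nat where "(fact n :: nat) = fact (card X) * q" using fact_dvd by (blast elim: dvdE)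
  ultimately show False using fact_nonzero by simp
qed

lemma mscale_card_permutations:
  assumes "X \<subseteq> {..<n}"
  shows "mscale (inverse (of_nat (fact (card X)))) (\<Sum>\<sigma> | \<sigma> permutes X. f) = (f :: 'k mpoly)"
proof -
  have fin: "finite X" using assms finite_subset by blast
  have "of_nat m * f = mscale (of_nat m) f" for m
    by (induction m) (simp_all add: distrib_right mpoly.scale_left_distrib)
  then show ?thesis
    using fact_card_nonzero[OF assms] by (simp add: card_permutations[OF refl fin])
qed

lemma sym_avg_fixed:
  assumes "X \<subseteq> {..<n}" "\<And>\<sigma>. \<sigma> permutes X \<Longrightarrow> perm_act \<sigma> f = (f :: 'k mpoly)"
  shows "sym_avg X f = f"
proof -
  have "(\<Sum>\<sigma> | \<sigma> permutes X. perm_act \<sigma> f) = (\<Sum>\<sigma> | \<sigma> permutes X. f)"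
    by (rule sum.cong) (auto simp: assms(2))
  then show ?thesis unfolding sym_avg_def using mscale_card_permutations[OF assms(1)] by metis
qed

lemma diff_sym_avg_mem:
  assumes "X \<subseteq> {..<n}" "mpoly.subspace V" "\<And>\<sigma>. \<sigma> permutes X \<Longrightarrow> f - perm_act \<sigma> f \<in> V"
  shows "f - sym_avg X f \<in> (V :: 'k mpoly set)"
proof -
  have "f - sym_avg X f = mscale (inverse (of_nat (fact (card X)))) (\<Sum>\<sigma> | \<sigma> permutes X. f - perm_act \<sigma> f)"
    unfolding sum_subtractf mpoly.scale_right_diff_distrib mscale_card_permutations[OF assms(1)]
    by (simp add: sym_avg_def)
  also have "\<dots> \<in> V"
    using assms(3) by (intro mpoly.subspace_scale[OF assms(2)] mpoly.subspace_sum[OF assms(2)]) simp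
  finally show ?thesis .
qed

section \<open>Exchanging generators\<close>

text \<open>Let \<open>w\<close> be the translate of \<open>z\<close> that is fixed by all permutations fixing the indices
  \<open>< u - 1\<close> and \<open>t\<close>, and put \<open>y' = y + w\<close>, which has type \<open>t + 1\<close>. The transposition \<open>s\<close> of \<open>t\<close> and
  \<open>t + 1\<close> fixes \<open>y\<close>, so \<open>y' - s y' = w - s w\<close> lies in the module generated by \<open>y'\<close>. Translating this
  difference gives \<open>w - \<sigma> w\<close> for every \<open>\<sigma>\<close> that fixes the indices \<open>< u - 1\<close>, hence also \<open>w - z'\<close>
  for the average \<open>z'\<close> of \<open>w\<close> over these \<open>\<sigma>\<close>, which has type \<open>u - 1\<close>. So \<open>y'\<close> and \<open>z'\<close>
  generate \<open>w\<close>, and with it \<open>z\<close> and \<open>y\<close>.\<close>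

lemma exchange:
  fixes y z :: "'k mpoly"
  assumes y: "tail_fixed n t y" and z: "tail_fixed n u z" and u: "1 \<le> u" "u \<le> t" and t: "t + 2 \<le> n"
    and V: "stable n V" "y \<in> V" "z \<in> V"
  shows "\<exists>y'\<in>V. \<exists>z'\<in>V. tail_fixed n (t + 1) y' \<and> tail_fixed n (u - 1) z' \<and> {y, z} \<subseteq> gspan n {y', z'}"
proof -
  define \<tau> where "\<tau> = Transposition.transpose (u - 1) t"
  define w where "w = perm_act \<tau> z"
  have \<tau>: "\<tau> permutes {..<n}" unfolding \<tau>_def using u t by (intro permutes_swap_id) auto
  have w_fixed: "perm_act \<sigma> w = w" if \<sigma>: "\<sigma> permutes {u - 1..<n} - {t}" for \<sigma>
  proof -
    have inv: "\<tau> \<circ> \<tau> = id" by (simp add: \<tau>_def)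
    have "(\<tau> \<circ> \<sigma> \<circ> \<tau>) permutes {u..<n}"
      unfolding permutes_def
    proof (intro conjI allI impI)
      have "bij (\<tau> \<circ> \<sigma> \<circ> \<tau>)"
        using permutes_bij[OF \<tau>] permutes_bij[OF \<sigma>] by (intro bij_comp)
      then show "\<exists>!x. (\<tau> \<circ> \<sigma> \<circ> \<tau>) x = i" for i by (simp add: bij_iff)
      fix i assume "i \<notin> {u..<n}"
      then have "\<tau> i \<notin> {u - 1..<n} - {t}"
        using u t by (auto simp: \<tau>_def transpose_def)
      then have "\<sigma> (\<tau> i) = \<tau> i" by (rule permutes_not_in[OF \<sigma>])
      then show "(\<tau> \<circ> \<sigma> \<circ> \<tau>) i = i" by (simp add: \<tau>_def)
    qed
    then have "perm_act (\<tau> \<circ> \<sigma> \<circ> \<tau>) z = z" using z by (simp add: tail_fixed_def)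
    then have "perm_act \<tau> (perm_act (\<tau> \<circ> \<sigma> \<circ> \<tau>) z) = w" by (simp add: w_def)
    then show ?thesis using inv by (simp add: w_def perm_act_perm_act o_assoc)
  qed
  define y' where "y' = y + w"
  define z' where "z' = sym_avg {u - 1..<n} w"
  let ?D = "gspan n {y'}"
  have D: "stable n ?D" "mpoly.subspace ?D" by (rule stable_gspan stable_subspace[OF stable_gspan])+
  have key: "w - perm_act \<sigma> w \<in> ?D" if \<sigma>: "\<sigma> permutes {u - 1..<n}" for \<sigma>
  proof (cases "\<sigma> t = t")
    case True
    then have "\<sigma> permutes {u - 1..<n} - {t}" using \<sigma> by (auto intro: permutes_superset)
    then show ?thesis using w_fixed mpoly.subspace_0[OF D(2)] by simp
  next
    case False
    \<comment> \<open>\<open>\<rho> \<circ> s\<close> agrees with \<open>\<sigma>\<close> at \<open>t\<close>, and only the image of \<open>t\<close> matters for the action on \<open>w\<close>\<close>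
    define s where "s = Transposition.transpose t (t + 1)"
    define \<rho> where "\<rho> = Transposition.transpose (t + 1) (\<sigma> t)"
    have s: "s permutes {t..<n}" unfolding s_def using t by (intro permutes_swap_id) auto
    have s': "s permutes {..<n}" by (rule permutes_subset[OF s]) auto
    have st: "\<sigma> t \<in> {u - 1..<n}" using permutes_in_image[OF \<sigma>] u t by auto
    then have \<rho>: "\<rho> permutes {u - 1..<n} - {t}"
      unfolding \<rho>_def using u t False by (intro permutes_swap_id) auto
    have "y' - perm_act s y' \<in> ?D"
      by (intro mpoly.subspace_diff[OF D(2)] stableD[OF D(1) s'] gspan_base) simp_all
    moreover have "y' - perm_act s y' = w - perm_act s w"
      using y s by (simp add: y'_def tail_fixed_def)
    moreover have "\<rho> permutes {..<n}" by (rule permutes_subset[OF \<rho>]) auto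
    ultimately have "perm_act \<rho> (w - perm_act s w) \<in> ?D"
      using stableD[OF D(1)] by metis
    then have *: "w - perm_act (\<rho> \<circ> s) w \<in> ?D" using w_fixed[OF \<rho>] by (simp add: perm_act_perm_act)
    define \<kappa> where "\<kappa> = Hilbert_Choice.inv (\<rho> \<circ> s) \<circ> \<sigma>"
    have rs: "(\<rho> \<circ> s) permutes {u - 1..<n}"
      using u by (intro permutes_compose permutes_subset[OF s] permutes_subset[OF \<rho>]) auto
    have "(\<rho> \<circ> s) t = \<sigma> t" by (simp add: \<rho>_def s_def)
    then have "\<kappa> t = t" unfolding \<kappa>_def using permutes_inv_eq[OF rs, of "\<sigma> t" t] by simp
    moreover have "\<kappa> permutes {u - 1..<n}"
      unfolding \<kappa>_def by (intro permutes_compose \<sigma> permutes_inv rs)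
    ultimately have "\<kappa> permutes {u - 1..<n} - {t}" by (auto intro: permutes_superset)
    then have "perm_act (\<rho> \<circ> s) (perm_act \<kappa> w) = perm_act (\<rho> \<circ> s) w" by (simp add: w_fixed)
    then have "perm_act \<sigma> w = perm_act (\<rho> \<circ> s) w"
      unfolding perm_act_perm_act \<kappa>_def o_assoc permutes_inv_o(1)[OF rs] by simp
    with * show ?thesis by simp
  qed
  let ?E = "gspan n {y', z'}"
  have E: "stable n ?E" "mpoly.subspace ?E" by (rule stable_gspan stable_subspace[OF stable_gspan])+
  have "w - z' \<in> ?D"
    unfolding z'_def by (rule diff_sym_avg_mem[OF _ D(2) key]) auto
  then have "w - z' \<in> ?E" using gspan_mono[of "{y'}" "{y', z'}" n] by blast
  then have wE: "w \<in> ?E"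
    using mpoly.subspace_add[OF E(2), of "w - z'" z'] gspan_base[of z' "{y', z'}" n] by simp
  then have "perm_act \<tau> w \<in> ?E" using stableD[OF E(1) \<tau>] by simp
  then have "z \<in> ?E" by (simp add: w_def perm_act_perm_act \<tau>_def)
  moreover have "y \<in> ?E"
    using mpoly.subspace_diff[OF E(2) gspan_base[of y' "{y', z'}" n] wE] by (simp add: y'_def)
  moreover have "w \<in> V" unfolding w_def by (rule stableD[OF V(1) \<tau> V(3)])
  moreover have "tail_fixed n (t + 1) y'"
    unfolding tail_fixed_def
  proof (intro allI impI)
    fix \<sigma> assume \<sigma>: "\<sigma> permutes {t + 1..<n}"
    have "\<sigma> permutes {t..<n}" by (rule permutes_subset[OF \<sigma>]) auto
    moreover have "\<sigma> permutes {u - 1..<n} - {t}" by (rule permutes_subset[OF \<sigma>]) (use u in auto)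
    ultimately show "perm_act \<sigma> y' = y'" using y by (simp add: y'_def w_fixed tail_fixed_def)
  qed
  moreover have "tail_fixed n (u - 1) z'"
    by (simp add: tail_fixed_def z'_def perm_act_sym_avg)
  moreover have "y' \<in> V"
    unfolding y'_def by (rule mpoly.subspace_add[OF stable_subspace[OF V(1)] V(2) \<open>w \<in> V\<close>])
  moreover have "z' \<in> V"
    unfolding z'_def by (rule sym_avg_mem[OF V(1) _ \<open>w \<in> V\<close>]) auto
  ultimately show ?thesis by blast
qed

subsection \<open>Packing generators\<close>

text \<open>The list records the types only. Generators may be permuted, exchanged and dropped, and all of this
  is visible in the list of types.\<close>

definition typed_gens :: "'k mpoly set \<Rightarrow> nat list \<Rightarrow> bool" where
  "typed_gens V ts \<longleftrightarrow> (\<exists>ys. list_all2 (\<lambda>t y. y \<in> V \<and> tail_fixed n t y) ts ys \<and> V \<subseteq> gspan n (set ys))"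

lemma typed_gens_permute:
  assumes "typed_gens V ts" "mset ts' = mset ts"
  shows "typed_gens V ts'"
proof -
  from assms(1) obtain ys where ys: "list_all2 (\<lambda>t y. y \<in> V \<and> tail_fixed n t y) ts ys" "V \<subseteq> gspan n (set ys)"
    unfolding typed_gens_def by blast
  from list_all2_reorder_left_invariance[OF ys(1) assms(2)] obtain ys' where
    "list_all2 (\<lambda>t y. y \<in> V \<and> tail_fixed n t y) ts' ys'" "mset ys' = mset ys" by blast
  with ys(2) show ?thesis unfolding typed_gens_def by (metis mset_eq_setD)
qed

lemma typed_gens_exchange:
  assumes V: "stable n V" and "typed_gens V (t # u # ts)" "1 \<le> u" "u \<le> t" "t + 2 \<le> n"
  shows "typed_gens V ((t + 1) # (u - 1) # ts)"
proof -
  from assms(2) obtain y z ys where ys: "list_all2 (\<lambda>t y. y \<in> V \<and> tail_fixed n t y) ts ys"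
    "y \<in> V" "tail_fixed n t y" "z \<in> V" "tail_fixed n u z"
    and gen: "V \<subseteq> gspan n (insert y (insert z (set ys)))"
    unfolding typed_gens_def by (auto simp: list_all2_Cons1)
  obtain y' z' where yz: "y' \<in> V" "z' \<in> V" "tail_fixed n (t + 1) y'" "tail_fixed n (u - 1) z'"
    "{y, z} \<subseteq> gspan n {y', z'}"
    using exchange[OF ys(3,5) assms(3-5) V ys(2,4)] by blast
  have "{y, z} \<subseteq> gspan n (set (y' # z' # ys))"
    using yz(5) gspan_mono[of "{y', z'}" "set (y' # z' # ys)" n] by auto
  then have "gspan n (insert y (insert z (set ys))) \<subseteq> gspan n (set (y' # z' # ys))"
    by (intro gspan_minimal[OF stable_gspan]) (auto intro: gspan_base)
  with gen have "V \<subseteq> gspan n (set (y' # z' # ys))" by blast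
  moreover have "list_all2 (\<lambda>t y. y \<in> V \<and> tail_fixed n t y) ((t + 1) # (u - 1) # ts) (y' # z' # ys)"
    using yz ys by simp
  ultimately show ?thesis unfolding typed_gens_def by blast
qed

context
  fixes V :: "'k mpoly set" and N :: nat
  assumes V: "stable n V" and N: "n = Suc N"
    and no_inv: "\<And>f. f \<in> V \<Longrightarrow> (\<And>\<sigma>. \<sigma> permutes {..<n} \<Longrightarrow> perm_act \<sigma> f = f) \<Longrightarrow> f = 0"
begin

lemma typed_gens_zero:
  assumes "typed_gens V (0 # ts)"
  shows "typed_gens V ts"
proof -
  from assms obtain y ys where ys: "list_all2 (\<lambda>t y. y \<in> V \<and> tail_fixed n t y) ts ys" "y \<in> V" "tail_fixed n 0 y"
    and V: "V \<subseteq> gspan n (insert y (set ys))"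
    unfolding typed_gens_def by (auto simp: list_all2_Cons1)
  have "y = 0" using ys(2,3) by (intro no_inv) (simp_all add: tail_fixed_def atLeast0LessThan)
  then have "gspan n (insert y (set ys)) \<subseteq> gspan n (set ys)"
    using mpoly.subspace_0[OF stable_subspace[OF stable_gspan]]
    by (intro gspan_minimal[OF stable_gspan]) (auto intro: gspan_base)
  with V ys(1) show ?thesis unfolding typed_gens_def by blast
qed

text \<open>Repeated exchange moves weight from \<open>u\<close> to \<open>t\<close> until either the first type is the largest possible
  one or the second generator has become invariant and disappears.\<close>

lemma typed_gens_merge_le:
  assumes "typed_gens V (t # u # ts)" "u \<le> t" "t \<le> N"
  shows "if t + u \<le> N then typed_gens V ((t + u) # ts) else typed_gens V (N # (t + u - N) # ts)"
  using assms
proof (induction u arbitrary: t)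
  case 0
  then have "typed_gens V (0 # t # ts)" by (elim typed_gens_permute) simp
  then show ?case using 0 typed_gens_zero by simp
next
  case (Suc u)
  show ?case
  proof (cases "t = N")
    case True
    then show ?thesis using Suc.prems by simp
  next
    case False
    have "typed_gens V ((t + 1) # (Suc u - 1) # ts)"
      by (rule typed_gens_exchange[OF V Suc.prems(1)]) (use Suc.prems(2,3) N False in auto)
    from Suc.IH[of "t + 1", OF this[unfolded diff_Suc_1]] show ?thesis
      using Suc.prems(2,3) False by (simp split: if_splits)
  qed
qed

lemma typed_gens_merge:
  assumes "typed_gens V (t # u # ts)" "u \<le> N" "t \<le> N"
  shows "if t + u \<le> N then typed_gens V ((t + u) # ts) else typed_gens V (N # (t + u - N) # ts)"
proof (cases "u \<le> t")
  case True
  then show ?thesis using typed_gens_merge_le assms by blast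
next
  case False
  have "typed_gens V (u # t # ts)" using assms(1) by (rule typed_gens_permute) simp
  from typed_gens_merge_le[OF this] show ?thesis
    using False assms(2) unfolding add.commute[of u t] by linarith
qed

text \<open>Merging the entries one after another into the first one leaves, apart from full generators of type
  \<open>N\<close>, a single generator of smaller type.\<close>

lemma typed_gens_pack:
  assumes "typed_gens V (c # ts @ replicate q N)" "c \<le> N" "\<forall>t\<in>set ts. t \<le> N"
  shows "\<exists>c' q'. c' \<le> N \<and> typed_gens V (c' # replicate q' N) \<and>
    c' + q' * N = c + sum_list ts + q * N"
  using assms
proof (induction ts arbitrary: c q)
  case Nil
  then show ?case by auto
next
  case (Cons u ts)
  then have "typed_gens V (c # u # ts @ replicate q N)" by simp
  from typed_gens_merge[OF this] Cons.prems
  have *: "if c + u \<le> N then typed_gens V ((c + u) # ts @ replicate q N)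
     else typed_gens V (N # (c + u - N) # ts @ replicate q N)" by simp
  show ?case
  proof (cases "c + u \<le> N")
    case True
    then show ?thesis using Cons.IH[of "c + u" q] * Cons.prems by (simp add: add.assoc)
  next
    case False
    then have "typed_gens V ((c + u - N) # ts @ replicate (Suc q) N)"
      using * by (auto elim: typed_gens_permute)
    moreover have "c + u - N \<le> N" using Cons.prems(2,3) by auto
    ultimately obtain c' q' where
      "c' \<le> N" "typed_gens V (c' # replicate q' N)"
      "c' + q' * N = (c + u - N) + sum_list ts + Suc q * N"
      using Cons.IH[of "c + u - N" "Suc q"] Cons.prems(3) by auto
    then show ?thesis using False by (intro exI[of _ c'] exI[of _ q']) auto
  qed
qed

theorem few_generators:
  assumes gens: "typed_gens V ts" and le: "\<forall>t\<in>set ts. t \<le> N" and sum: "sum_list ts \<le> r * N" and n: "1 \<le> N"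
  shows "\<exists>g. (\<forall>i<r. g i \<in> V) \<and> V \<subseteq> gspan n (g ` {..<r})"
proof -
  have "\<exists>ts'. typed_gens V ts' \<and> length ts' \<le> r"
  proof (cases ts)
    case Nil
    then show ?thesis using gens by auto
  next
    case (Cons c us)
    then have "typed_gens V (c # us @ replicate 0 N)" using gens by simp
    from typed_gens_pack[OF this] Cons le obtain c' q' where c: "c' \<le> N"
      "typed_gens V (c' # replicate q' N)" "c' + q' * N = sum_list ts" by auto
    then have "c' + q' * N \<le> r * N" using sum by simp
    show ?thesis
    proof (cases "c' = 0")
      case True
      have "typed_gens V (replicate q' N)" by (rule typed_gens_zero) (use c(2) True in simp)
      moreover have "q' \<le> r" using \<open>c' + q' * N \<le> r * N\<close> True n by simp
      ultimately show ?thesis by (intro exI[of _ "replicate q' N"]) simp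
    next
      case False
      then have "q' * N < r * N" using \<open>c' + q' * N \<le> r * N\<close> by linarith
      then have "q' < r" by simp
      then show ?thesis using c(2) by (intro exI[of _ "c' # replicate q' N"]) simp
    qed
  qed
  then obtain ts' ys where ys: "list_all2 (\<lambda>t y. y \<in> V \<and> tail_fixed n t y) ts' ys" "V \<subseteq> gspan n (set ys)"
    and "length ts' \<le> r" unfolding typed_gens_def by blast
  then have len: "length ys \<le> r" using list_all2_lengthD by fastforce
  have "\<forall>i<length ys. ys ! i \<in> V" using ys(1) unfolding list_all2_conv_all_nth by simp
  then have mem: "set ys \<subseteq> V" unfolding in_set_conv_nth subset_iff by blast
  define g where "g i = (if i < length ys then ys ! i else 0)" for i
  have "set ys \<subseteq> g ` {..<r}"
  proof
    fix y assume "y \<in> set ys"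
    then obtain i where "i < length ys" "y = ys ! i" by (auto simp: in_set_conv_nth)
    then show "y \<in> g ` {..<r}" using len by (intro image_eqI[of _ _ i]) (auto simp: g_def)
  qed
  then have "V \<subseteq> gspan n (g ` {..<r})" using ys(2) gspan_mono by blast
  moreover have "\<forall>i<r. g i \<in> V"
    using mem mpoly.subspace_0[OF stable_subspace[OF V]] nth_mem by (auto simp: g_def)
  ultimately show ?thesis by blast
qed

end

end

section \<open>Coinvariants\<close>

lemma perm_act_hcomp:
  assumes f: "f \<in> carrier (poly_ring n)" and \<sigma>: "\<sigma> permutes {..<n}"
  shows "perm_act \<sigma> (hcomp j f) = hcomp j (perm_act \<sigma> f)"
proof -
  obtain s where fs: "f \<in> deg_le n 0 s" by (rule carrier_deg_le[OF f])
  have "hcomp j (perm_act \<sigma> f) = hcomp j (\<Sum>l\<le>s. perm_act \<sigma> (hcomp l f))"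
    using sum_hcomp[OF fs] by (simp flip: perm_act_sum)
  also have "\<dots> = (\<Sum>l\<le>s. if j = l then perm_act \<sigma> (hcomp l f) else 0)"
    using hcomp_eq[OF perm_act_graded[OF hcomp_graded[OF f] \<sigma>]] by simp
  also have "\<dots> = perm_act \<sigma> (hcomp j f)"
    using hcomp_deg_le_eq_0[OF fs, of j] by auto
  finally show ?thesis by simp
qed

lemma perm_act_deg_le:
  assumes f: "f \<in> deg_le n 0 s" and \<sigma>: "\<sigma> permutes {..<n}"
  shows "perm_act \<sigma> f \<in> deg_le n 0 s"
proof -
  have "perm_act \<sigma> (\<Sum>l\<le>s. hcomp l f) \<in> deg_le n 0 s"
    unfolding perm_act_sum
  proof (rule mpoly.subspace_sum[OF deg_le_subspace])
    fix l assume "l \<in> {..s}"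
    moreover have "perm_act \<sigma> (hcomp l f) \<in> graded_part n l"
      using f by (intro perm_act_graded[OF hcomp_graded \<sigma>]) (simp add: deg_le_def)
    ultimately show "perm_act \<sigma> (hcomp l f) \<in> deg_le n 0 s" by (auto intro: graded_imp_deg_le)
  qed
  then show ?thesis by (simp add: sum_hcomp[OF f])
qed

definition esym_ideal :: "nat \<Rightarrow> nat \<Rightarrow> 'k::field mpoly set" where
  "esym_ideal n j = mpoly.span {esym mvar n i * h | i h. 1 \<le> i \<and> i \<le> j \<and> h \<in> graded_part n (j - i)}"

lemma stable_esym_ideal: "stable n (esym_ideal n j)"
  unfolding esym_ideal_def
proof (rule stable_span, rule mpoly.span_base)
  fix \<sigma> f assume \<sigma>: "\<sigma> permutes {..<n}"
    and "f \<in> {esym mvar n i * h | i h. 1 \<le> i \<and> i \<le> j \<and> h \<in> graded_part n (j - i)}"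
  then obtain i h where "f = esym mvar n i * h" "1 \<le> i" "i \<le> j" "h \<in> graded_part n (j - i)" by blast
  then show "perm_act \<sigma> f \<in> {esym mvar n i * h | i h. 1 \<le> i \<and> i \<le> j \<and> h \<in> graded_part n (j - i)}"
    using perm_act_graded[OF _ \<sigma>] \<sigma> by auto
qed

lemma esym_ideal_graded: "esym_ideal n j \<subseteq> graded_part n j"
  unfolding esym_ideal_def
proof (rule mpoly.span_minimal[OF _ graded_part_subspace], safe)
  fix i and h :: "'a mpoly" assume "i \<le> j" "h \<in> graded_part n (j - i)"
  then show "esym mvar n i * h \<in> graded_part n j"
    using graded_part_mult[OF esym_mvar_graded, of h n "j - i" i] by simp
qed

text \<open>In a product of a relation with its cofactor only the elementary symmetric function contributes to
  degree \<open>s\<close>; the constant term of the relation contributes to smaller degrees only. Here the control of degrees in the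
  definition of \<open>orbit_ideal\<close> is used.\<close>

lemma top_form_orbit_ideal:
  assumes "f \<in> orbit_ideal n p s"
  shows "hcomp s f \<in> esym_ideal n s"
  using assms unfolding orbit_ideal_def
proof (induction f rule: mpoly.span_induct_alt)
  case base
  show ?case by (simp add: esym_ideal_def mpoly.span_zero)
next
  case (step c x y)
  then obtain i h where x: "x = orbit_rel n p i * h" "1 \<le> i" "h \<in> deg_le n i s" by blast
  have h: "h \<in> carrier (poly_ring n)" using x(3) by (simp add: deg_le_def)
  have "hcomp s (mconst (esym p n i) * h) = 0"
    using hcomp_deg_le_eq_0[OF x(3), of s] x(2) hcomp_mscale[of s "esym p n i" h] by (simp add: mscale_def)
  moreover have "hcomp s x = hcomp s (esym mvar n i * h) - hcomp s (mconst (esym p n i) * h)"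
    unfolding x(1) orbit_rel_def left_diff_distrib by (metis add_diff_cancel_right' diff_add_cancel hcomp_add)
  ultimately have "hcomp s x = (if i \<le> s then esym mvar n i * hcomp (s - i) h else 0)"
    by (simp add: hcomp_mult_graded[OF esym_mvar_graded h])
  then have "hcomp s x \<in> esym_ideal n s"
    unfolding esym_ideal_def using x(2) hcomp_graded[OF h]
    by (auto intro!: mpoly.span_base simp: mpoly.span_zero)
  then show ?case
    using step.IH unfolding hcomp_add hcomp_mscale esym_ideal_def
    by (intro mpoly.span_add mpoly.span_scale)
qed

context nonmodular
begin

text \<open>The argument of Maschke: averaging the conjugates of a linear projection onto \<open>A\<close> makes it
  equivariant, and its kernel is then a stable complement.\<close>

lemma stable_complement:
  assumes A: "stable n (A :: 'k mpoly set)" and B: "stable n B" and AB: "A \<subseteq> B"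
  obtains U where "stable n U" "U \<subseteq> B" "A \<inter> U \<subseteq> {0}" "\<And>b. b \<in> B \<Longrightarrow> \<exists>a\<in>A. b - a \<in> U"
proof -
  interpret P: vector_space_pair "mscale :: 'k \<Rightarrow> _" "mscale :: 'k \<Rightarrow> _" ..
  from P.linear_exists_right_inverse_on[OF mpoly.linear_ident stable_subspace[OF A]] obtain g
    where g: "range g \<subseteq> A" "Vector_Spaces.linear mscale mscale g" "\<And>a. a \<in> A \<Longrightarrow> g a = a" by auto
  note glin = g(2)[unfolded Vector_Spaces.linear_iff]
  define c :: 'k where "c = inverse (of_nat (fact (card {..<n})))"
  define \<pi> where "\<pi> f = mscale c (\<Sum>\<sigma> | \<sigma> permutes {..<n}. perm_act (Hilbert_Choice.inv \<sigma>) (g (perm_act \<sigma> f)))" for f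
  have lin: "\<pi> (f + h) = \<pi> f + \<pi> h" "\<pi> (mscale a f) = mscale a (\<pi> f)" for f h a
    using glin by (simp_all add: \<pi>_def sum.distrib mpoly.scale_right_distrib mpoly.scale_left_commute
        flip: mpoly.scale_sum_right)
  have mem: "\<pi> f \<in> A" for f
    unfolding \<pi>_def
    by (intro mpoly.subspace_scale mpoly.subspace_sum stable_subspace[OF A] stableD[OF A])
       (use g(1) permutes_inv in auto)
  have fix_A: "\<pi> a = a" if "a \<in> A" for a
  proof -
    have "perm_act (Hilbert_Choice.inv \<sigma>) (g (perm_act \<sigma> a)) = a" if "\<sigma> permutes {..<n}" for \<sigma>
      using g(3)[OF stableD[OF A that \<open>a \<in> A\<close>]] perm_act_inv(1)[OF that] by simp
    then have "(\<Sum>\<sigma> | \<sigma> permutes {..<n}. perm_act (Hilbert_Choice.inv \<sigma>) (g (perm_act \<sigma> a))) =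
        (\<Sum>\<sigma> | \<sigma> permutes {..<n}. a)" by (intro sum.cong) auto
    then show ?thesis using mscale_card_permutations[of "{..<n}" a] by (simp only: \<pi>_def c_def)
  qed
  have equi: "\<pi> (perm_act \<tau> f) = perm_act \<tau> (\<pi> f)" if \<tau>: "\<tau> permutes {..<n}" for \<tau> f
  proof -
    let ?h = "\<lambda>\<rho>. perm_act (\<tau> \<circ> Hilbert_Choice.inv \<rho>) (g (perm_act \<rho> f))"
    have "perm_act \<tau> (\<pi> f) = mscale c (\<Sum>\<rho> | \<rho> permutes {..<n}. ?h \<rho>)"
      by (simp add: \<pi>_def perm_act_perm_act)
    also have "\<dots> = mscale c (\<Sum>\<sigma> | \<sigma> permutes {..<n}. ?h (\<sigma> \<circ> \<tau>))"
      by (subst sum_permutations_compose_right[OF \<tau>]) simp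
    also have "\<dots> = mscale c (\<Sum>\<sigma> | \<sigma> permutes {..<n}. perm_act (Hilbert_Choice.inv \<sigma>) (g (perm_act \<sigma> (perm_act \<tau> f))))"
    proof (intro arg_cong2[where f = mscale] refl sum.cong)
      fix \<sigma> assume "\<sigma> \<in> {\<sigma>. \<sigma> permutes {..<n}}"
      then have \<sigma>: "\<sigma> permutes {..<n}" by simp
      have "\<tau> \<circ> Hilbert_Choice.inv (\<sigma> \<circ> \<tau>) = Hilbert_Choice.inv \<sigma>"
        using o_inv_distrib[OF permutes_bij[OF \<sigma>] permutes_bij[OF \<tau>]] permutes_inv_o(1)[OF \<tau>]
        by (simp add: o_assoc)
      then show "?h (\<sigma> \<circ> \<tau>) = perm_act (Hilbert_Choice.inv \<sigma>) (g (perm_act \<sigma> (perm_act \<tau> f)))"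
        by (simp only: perm_act_perm_act)
    qed
    finally show ?thesis by (simp only: \<pi>_def[of "perm_act \<tau> f"])
  qed
  define U where "U = {f \<in> B. \<pi> f = 0}"
  show ?thesis
  proof
    show "stable n U"
      unfolding stable_def
    proof (intro conjI allI impI)
      have "\<pi> 0 = 0" using lin(2)[of 0 0] by simp
      then show "mpoly.subspace U"
        using stable_subspace[OF B] lin by (auto simp: U_def mpoly.subspace_def)
      show "perm_act \<sigma> f \<in> U" if "\<sigma> permutes {..<n}" "f \<in> U" for \<sigma> f
        using that stableD[OF B] equi by (simp add: U_def)
    qed
    show "U \<subseteq> B" by (auto simp: U_def)
    show "A \<inter> U \<subseteq> {0}" using fix_A by (auto simp: U_def)
    fix b assume b: "b \<in> B"
    have "\<pi> (b + mscale (- 1) (\<pi> b)) = 0" unfolding lin using fix_A[OF mem] by simp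
    then have "b - \<pi> b \<in> U"
      using b AB mem mpoly.subspace_diff[OF stable_subspace[OF B]] by (auto simp: U_def)
    then show "\<exists>a\<in>A. b - a \<in> U" using mem by blast
  qed
qed

end

section \<open>Modules generated by one element of small type\<close>

text \<open>Finitely many functionals recover a vector up to their common kernel, by means of suitable vectors
  \<open>b x\<close> of the same subspace. The induction splits off one functional at a time and continues in
  its kernel.\<close>

lemma dual_frame:
  fixes l :: "'i \<Rightarrow> 'k::field mpoly \<Rightarrow> 'k"
  assumes "finite X" and V: "mpoly.subspace V"
    and add: "\<And>x f g. l x (f + g) = l x f + l x g" and scale: "\<And>x c f. l x (mscale c f) = c * l x f"
  shows "\<exists>b. (\<forall>x\<in>X. b x \<in> V) \<and> (\<forall>u\<in>V. \<forall>x\<in>X. l x (u - (\<Sum>y\<in>X. mscale (l y u) (b y))) = 0)"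
  using assms(1,2)
proof (induction X arbitrary: V rule: finite_induct)
  case (insert x X)
  have zero: "l y 0 = 0" for y using scale[of y 0 0] by simp
  have neg: "l y (- f) = - l y f" for y f using add[of y "- f" f] zero by (simp add: eq_neg_iff_add_eq_0)
  have diff: "l y (f - g) = l y f - l y g" for y f g using add[of y f "- g"] neg by simp
  show ?case
  proof (cases "\<forall>u\<in>V. l x u = 0")
    case True
    obtain b where b: "\<And>y. y \<in> X \<Longrightarrow> b y \<in> V"
      "\<And>u y. u \<in> V \<Longrightarrow> y \<in> X \<Longrightarrow> l y (u - (\<Sum>y\<in>X. mscale (l y u) (b y))) = 0"
      using insert.IH[OF insert.prems] by blast
    define b' where "b' = b(x := 0)"
    have sum: "(\<Sum>y\<in>insert x X. mscale (l y u) (b' y)) = (\<Sum>y\<in>X. mscale (l y u) (b y))" for u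
      using insert.hyps by (simp add: b'_def) (auto intro!: sum.cong)
    have "u - (\<Sum>y\<in>X. mscale (l y u) (b y)) \<in> V" if "u \<in> V" for u
      using that b(1) by (intro mpoly.subspace_diff mpoly.subspace_sum mpoly.subspace_scale insert.prems)
    then have "l y (u - (\<Sum>y\<in>insert x X. mscale (l y u) (b' y))) = 0" if "u \<in> V" "y \<in> insert x X" for u y
      unfolding sum using that b(2) True by auto
    moreover have "\<forall>y\<in>insert x X. b' y \<in> V"
      using b(1) mpoly.subspace_0[OF insert.prems] by (auto simp: b'_def)
    ultimately show ?thesis by blast
  next
    case False
    then obtain v0 where "v0 \<in> V" "l x v0 \<noteq> 0" by blast
    then obtain v where v: "v \<in> V" "l x v = 1"
      using scale[of x "inverse (l x v0)" v0] mpoly.subspace_scale[OF insert.prems] by force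
    let ?V = "{u \<in> V. l x u = 0}"
    have "mpoly.subspace ?V"
      using insert.prems by (auto simp: mpoly.subspace_def zero add scale)
    from insert.IH[OF this] obtain b where b: "\<And>y. y \<in> X \<Longrightarrow> b y \<in> ?V"
      "\<And>u y. u \<in> ?V \<Longrightarrow> y \<in> X \<Longrightarrow> l y (u - (\<Sum>y\<in>X. mscale (l y u) (b y))) = 0" by blast
    define b' where "b' = b(x := v - (\<Sum>y\<in>X. mscale (l y v) (b y)))"
    have bV: "\<forall>y\<in>insert x X. b' y \<in> V"
      using b(1) v unfolding b'_def
      by (auto intro!: mpoly.subspace_diff[OF insert.prems] mpoly.subspace_sum[OF insert.prems]
          mpoly.subspace_scale[OF insert.prems])
    have "l y (u - (\<Sum>y\<in>insert x X. mscale (l y u) (b' y))) = 0" if u: "u \<in> V" and y: "y \<in> insert x X" for u y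
    proof -
      define w where "w = u - mscale (l x u) v"
      have w: "w \<in> ?V"
        using u v by (auto simp: w_def diff scale intro!: mpoly.subspace_diff[OF insert.prems]
            mpoly.subspace_scale[OF insert.prems])
      have "(\<Sum>y\<in>X. mscale (l y u) (b' y)) = (\<Sum>y\<in>X. mscale (l y u) (b y))"
        using insert.hyps by (intro sum.cong) (auto simp: b'_def)
      then have "u - (\<Sum>y\<in>insert x X. mscale (l y u) (b' y)) =
          u - (mscale (l x u) (v - (\<Sum>y\<in>X. mscale (l y v) (b y))) + (\<Sum>y\<in>X. mscale (l y u) (b y)))"
        using insert.hyps by (simp add: b'_def)
      also have "\<dots> = w - (\<Sum>y\<in>X. mscale (l y w) (b y))"
        by (simp add: w_def diff scale mpoly.scale_right_diff_distrib mpoly.scale_left_diff_distrib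
            sum_subtractf mpoly.scale_sum_right)
      finally have eq: "u - (\<Sum>y\<in>insert x X. mscale (l y u) (b' y)) = w - (\<Sum>y\<in>X. mscale (l y w) (b y))" .
      have "w - (\<Sum>y\<in>X. mscale (l y w) (b y)) \<in> ?V"
        using b(1) by (intro mpoly.subspace_diff mpoly.subspace_sum mpoly.subspace_scale \<open>mpoly.subspace ?V\<close> w)
      then show ?thesis unfolding eq using y b(2)[OF w] by auto
    qed
    then show ?thesis using bV by blast
  qed
qed simp

context nonmodular
begin

text \<open>If the evaluations at the rearrangements of \<open>p\<close> are jointly injective on \<open>V\<close>, then a dual frame
  writes every \<open>u\<close> as a sum of its values times fixed vectors of \<open>V\<close>. Averaging this formula over
  the group turns the fixed vectors into the translates of a single \<open>Y\<close>, that is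
  \<open>u = \<Sum>\<^sub>\<rho> (\<rho> u)(p) \<rho>\<^sup>-\<^sup>1 Y\<close>. As \<open>p\<close> does not change under permutations of the indices \<open>\<ge> t\<close>, neither do
  the values, and \<open>Y\<close> may be averaged over these as well.\<close>

lemma generator_from_orbit:
  fixes V :: "'k mpoly set"
  assumes V: "stable n V"
    and tail: "\<And>\<sigma> i. \<sigma> permutes {t..<n} \<Longrightarrow> p (\<sigma> i) = p i"
    and inj: "\<And>u. u \<in> V \<Longrightarrow> (\<And>\<sigma>. \<sigma> permutes {..<n} \<Longrightarrow> eval_at p (perm_act \<sigma> u) = 0) \<Longrightarrow> u = 0"
  shows "\<exists>Y\<in>V. tail_fixed n t Y \<and> V \<subseteq> gspan n {Y}"
proof -
  let ?G = "{\<sigma>. \<sigma> permutes {..<n}}"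
  let ?H = "{\<sigma>. \<sigma> permutes {t..<n}}"
  define l where "l \<sigma> u = eval_at p (perm_act \<sigma> u)" for \<sigma> and u :: "'k mpoly"
  have lin: "l \<sigma> (f + g) = l \<sigma> f + l \<sigma> g" "l \<sigma> (mscale c f) = c * l \<sigma> f" for \<sigma> f g c
    by (simp_all add: l_def)
  have fin: "finite ?G" by (simp add: finite_permutations)
  from dual_frame[of ?G V l, OF fin stable_subspace[OF V] lin] obtain b where
    b: "\<And>\<sigma>. \<sigma> \<in> ?G \<Longrightarrow> b \<sigma> \<in> V" and
    b': "\<And>u \<sigma>. u \<in> V \<Longrightarrow> \<sigma> \<in> ?G \<Longrightarrow> l \<sigma> (u - (\<Sum>\<tau>\<in>?G. mscale (l \<tau> u) (b \<tau>))) = 0" by blast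
  have frame: "u = (\<Sum>\<tau>\<in>?G. mscale (l \<tau> u) (b \<tau>))" if u: "u \<in> V" for u
  proof -
    have "u - (\<Sum>\<tau>\<in>?G. mscale (l \<tau> u) (b \<tau>)) = 0"
    proof (rule inj)
      show "u - (\<Sum>\<tau>\<in>?G. mscale (l \<tau> u) (b \<tau>)) \<in> V"
        using u b by (intro mpoly.subspace_diff mpoly.subspace_sum mpoly.subspace_scale stable_subspace[OF V])
      show "eval_at p (perm_act \<sigma> (u - (\<Sum>\<tau>\<in>?G. mscale (l \<tau> u) (b \<tau>)))) = 0" if "\<sigma> permutes {..<n}" for \<sigma>
        using b'[OF u, of \<sigma>] that by (simp only: l_def mem_Collect_eq)
    qed
    then show ?thesis by simp
  qed
  define c :: 'k where "c = inverse (of_nat (fact (card {..<n})))"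
  define Y0 where "Y0 = mscale c (\<Sum>\<kappa>\<in>?G. perm_act \<kappa> (b \<kappa>))"
  have Y0: "Y0 \<in> V"
    unfolding Y0_def using b
    by (intro mpoly.subspace_sum mpoly.subspace_scale stable_subspace[OF V] stableD[OF V]) auto
  \<comment> \<open>the frame formula for \<open>\<tau> u\<close>, moved back by \<open>\<tau>\<close> and averaged over all \<open>\<tau>\<close>\<close>
  have frame0: "u = (\<Sum>\<rho>\<in>?G. mscale (l \<rho> u) (perm_act (Hilbert_Choice.inv \<rho>) Y0))" if u: "u \<in> V" for u
  proof -
    have "u = (\<Sum>\<sigma>\<in>?G. mscale (l (\<sigma> \<circ> \<tau>) u) (perm_act (Hilbert_Choice.inv \<tau>) (b \<sigma>)))" if \<tau>: "\<tau> \<in> ?G" for \<tau>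
    proof -
      have \<tau>: "\<tau> permutes {..<n}" using \<tau> by simp
      have "u = perm_act (Hilbert_Choice.inv \<tau>) (perm_act \<tau> u)" by (simp add: perm_act_inv(1)[OF \<tau>])
      also have "perm_act \<tau> u = (\<Sum>\<sigma>\<in>?G. mscale (l \<sigma> (perm_act \<tau> u)) (b \<sigma>))"
        by (rule frame[OF stableD[OF V \<tau> u]])
      finally show ?thesis by (simp add: l_def perm_act_perm_act)
    qed
    then have "(\<Sum>\<tau>\<in>?G. u) = (\<Sum>\<tau>\<in>?G. \<Sum>\<sigma>\<in>?G. mscale (l (\<sigma> \<circ> \<tau>) u) (perm_act (Hilbert_Choice.inv \<tau>) (b \<sigma>)))"
      by (intro sum.cong refl) blast
    also have "\<dots> = (\<Sum>\<sigma>\<in>?G. \<Sum>\<tau>\<in>?G. mscale (l (\<sigma> \<circ> \<tau>) u) (perm_act (Hilbert_Choice.inv \<tau>) (b \<sigma>)))"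
      by (rule sum.swap)
    also have "\<dots> = (\<Sum>\<sigma>\<in>?G. \<Sum>\<rho>\<in>?G. mscale (l \<rho> u) (perm_act (Hilbert_Choice.inv \<rho>) (perm_act \<sigma> (b \<sigma>))))"
    proof (rule sum.cong[OF refl])
      fix \<sigma> assume "\<sigma> \<in> ?G"
      then have \<sigma>: "\<sigma> permutes {..<n}" by simp
      let ?F = "\<lambda>\<rho>. mscale (l \<rho> u) (perm_act (Hilbert_Choice.inv \<rho>) (perm_act \<sigma> (b \<sigma>)))"
      have "?F (\<sigma> \<circ> \<tau>) = mscale (l (\<sigma> \<circ> \<tau>) u) (perm_act (Hilbert_Choice.inv \<tau>) (b \<sigma>))" if "\<tau> \<in> ?G" for \<tau>
      proof -
        have \<tau>: "\<tau> permutes {..<n}" using that by simp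
        have "Hilbert_Choice.inv (\<sigma> \<circ> \<tau>) \<circ> \<sigma> = Hilbert_Choice.inv \<tau>"
          using o_inv_distrib[OF permutes_bij[OF \<sigma>] permutes_bij[OF \<tau>]] permutes_inv_o(2)[OF \<sigma>]
          by (simp flip: o_assoc)
        then show ?thesis by (simp add: perm_act_perm_act)
      qed
      then have "(\<Sum>\<tau>\<in>?G. mscale (l (\<sigma> \<circ> \<tau>) u) (perm_act (Hilbert_Choice.inv \<tau>) (b \<sigma>))) = (\<Sum>\<tau>\<in>?G. ?F (\<sigma> \<circ> \<tau>))"
        by (intro sum.cong refl) metis
      also have "\<dots> = (\<Sum>\<rho>\<in>?G. ?F \<rho>)" by (rule setum_permutations_compose_left[OF \<sigma>, symmetric])
      finally show "(\<Sum>\<tau>\<in>?G. mscale (l (\<sigma> \<circ> \<tau>) u) (perm_act (Hilbert_Choice.inv \<tau>) (b \<sigma>))) = (\<Sum>\<rho>\<in>?G. ?F \<rho>)" .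
    qed
    also have "\<dots> = (\<Sum>\<rho>\<in>?G. mscale (l \<rho> u) (perm_act (Hilbert_Choice.inv \<rho>) (\<Sum>\<sigma>\<in>?G. perm_act \<sigma> (b \<sigma>))))"
      by (subst sum.swap) (simp add: mpoly.scale_sum_right)
    finally have "mscale c (\<Sum>\<tau>\<in>?G. u) =
        mscale c (\<Sum>\<rho>\<in>?G. mscale (l \<rho> u) (perm_act (Hilbert_Choice.inv \<rho>) (\<Sum>\<sigma>\<in>?G. perm_act \<sigma> (b \<sigma>))))" by simp
    moreover have "mscale c (\<Sum>\<tau>\<in>?G. u) = u"
      unfolding c_def by (rule mscale_card_permutations) simp
    ultimately show ?thesis
      by (simp add: Y0_def mpoly.scale_sum_right mult.commute)
  qed
  define Y where "Y = sym_avg {t..<n} Y0"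
  have "Y \<in> V" unfolding Y_def by (rule sym_avg_mem[OF V _ Y0]) auto
  moreover have "tail_fixed n t Y" by (simp add: tail_fixed_def Y_def perm_act_sym_avg)
  moreover have "u \<in> gspan n {Y}" if u: "u \<in> V" for u
  proof -
    have "u = (\<Sum>\<rho>\<in>?G. mscale (l \<rho> u) (perm_act (Hilbert_Choice.inv \<rho>) (perm_act h Y0)))" if h: "h \<in> ?H" for h
    proof -
      define k where "k = Hilbert_Choice.inv h"
      have k: "k permutes {t..<n}" using h by (simp add: k_def permutes_inv)
      then have k': "k permutes {..<n}" by (rule permutes_subset) auto
      have hk: "Hilbert_Choice.inv k = h" using h permutes_inv_inv by (auto simp: k_def)
      have "u = (\<Sum>\<rho>\<in>?G. mscale (l (k \<circ> \<rho>) u) (perm_act (Hilbert_Choice.inv (k \<circ> \<rho>)) Y0))"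
        unfolding setum_permutations_compose_left[OF k', symmetric,
            of "\<lambda>\<rho>. mscale (l \<rho> u) (perm_act (Hilbert_Choice.inv \<rho>) Y0)"] by (rule frame0[OF u])
      also have "\<dots> = (\<Sum>\<rho>\<in>?G. mscale (l \<rho> u) (perm_act (Hilbert_Choice.inv \<rho>) (perm_act h Y0)))"
      proof (rule sum.cong[OF refl])
        fix \<rho> assume "\<rho> \<in> ?G"
        then have \<rho>: "\<rho> permutes {..<n}" by simp
        have "l (k \<circ> \<rho>) u = l \<rho> u"
          by (simp add: l_def eval_at_perm_act tail[OF k] flip: perm_act_perm_act)
        moreover have "Hilbert_Choice.inv (k \<circ> \<rho>) = Hilbert_Choice.inv \<rho> \<circ> h"
          using o_inv_distrib[OF permutes_bij[OF k'] permutes_bij[OF \<rho>]] hk by simp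
        ultimately show "mscale (l (k \<circ> \<rho>) u) (perm_act (Hilbert_Choice.inv (k \<circ> \<rho>)) Y0) =
            mscale (l \<rho> u) (perm_act (Hilbert_Choice.inv \<rho>) (perm_act h Y0))"
          by (simp add: perm_act_perm_act)
      qed
      finally show ?thesis .
    qed
    then have "(\<Sum>h\<in>?H. u) = (\<Sum>h\<in>?H. \<Sum>\<rho>\<in>?G. mscale (l \<rho> u) (perm_act (Hilbert_Choice.inv \<rho>) (perm_act h Y0)))"
      by (intro sum.cong refl) blast
    also have "\<dots> = (\<Sum>\<rho>\<in>?G. mscale (l \<rho> u) (perm_act (Hilbert_Choice.inv \<rho>) (\<Sum>h\<in>?H. perm_act h Y0)))"
      by (subst sum.swap) (simp add: mpoly.scale_sum_right)
    finally have "mscale (inverse (of_nat (fact (card {t..<n})))) (\<Sum>h\<in>?H. u) =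
        mscale (inverse (of_nat (fact (card {t..<n})))) (\<Sum>\<rho>\<in>?G. mscale (l \<rho> u) (perm_act (Hilbert_Choice.inv \<rho>) (\<Sum>h\<in>?H. perm_act h Y0)))"
      by simp
    moreover have "mscale (inverse (of_nat (fact (card {t..<n})))) (\<Sum>h\<in>?H. u) = u"
      by (rule mscale_card_permutations) auto
    ultimately have "u = (\<Sum>\<rho>\<in>?G. mscale (l \<rho> u) (perm_act (Hilbert_Choice.inv \<rho>) Y))"
      by (simp add: Y_def sym_avg_def mpoly.scale_sum_right mult.commute)
    also have "\<dots> \<in> gspan n {Y}"
    proof (intro mpoly.subspace_sum mpoly.subspace_scale stable_subspace[OF stable_gspan] stableD[OF stable_gspan] gspan_base)
      show "Hilbert_Choice.inv \<rho> permutes {..<n}" if "\<rho> \<in> ?G" for \<rho> using that permutes_inv by auto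
    qed simp
    finally show ?thesis .
  qed
  ultimately show ?thesis by blast
qed

end

section \<open>Generators of the forms of degree d\<close>

text \<open>These multisets index the monomials in \<open>e\<^sub>2, e\<^sub>3, \<dots>\<close> of degree at most \<open>d\<close>. The function \<open>e\<^sub>1\<close> is kept
  apart, since its powers serve to bring the components of an inhomogeneous generator to the same degree.\<close>

definition no_one_msets :: "nat \<Rightarrow> nat multiset set" where
  "no_one_msets d = {q. (\<forall>x\<in>#q. 2 \<le> x) \<and> \<Sum>\<^sub># q \<le> d}"

definition esym_mset :: "nat \<Rightarrow> nat multiset \<Rightarrow> 'k::field mpoly" where
  "esym_mset n q = (\<Prod>x\<in>#q. esym mvar n x)"

lemma esym_mset_graded: "esym_mset n q \<in> graded_part n (\<Sum>\<^sub># q)"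
  unfolding esym_mset_def by (induction q) (auto intro: graded_part_mult esym_mvar_graded)

lemma perm_act_esym_mset [simp]: "\<sigma> permutes {..<n} \<Longrightarrow> perm_act \<sigma> (esym_mset n q) = esym_mset n q"
  unfolding esym_mset_def by (induction q) auto

lemma perm_act_carrier:
  assumes "f \<in> carrier (poly_ring n)" "\<sigma> permutes {..<n}"
  shows "perm_act \<sigma> f \<in> carrier (poly_ring n)"
proof -
  obtain s where "f \<in> deg_le n 0 s" by (rule carrier_deg_le[OF assms(1)])
  from perm_act_deg_le[OF this assms(2)] show ?thesis by (simp add: deg_le_def)
qed

lemma mult_mscale: "f * mscale c g = mscale c (f * g)"
  by (simp add: mscale_def mult.left_commute)

context nonmodular
begin

context
  fixes U :: "nat \<Rightarrow> 'k mpoly set"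
  assumes U_stable: "\<And>j. stable n (U j)" and U_graded: "\<And>j. U j \<subseteq> graded_part n j"
    and U_disjoint: "\<And>j. esym_ideal n j \<inter> U j \<subseteq> {0}"
begin

text \<open>The evaluation point has \<open>t\<close> distinct nonzero coordinates followed by zeros. An element of
  \<open>U\<^sub>0 + \<dots> + U\<^sub>t\<close> that vanishes on its orbit has its leading form in the ideal of the elementary
  symmetric functions and in the complement of that ideal, so it is zero. The point has \<open>t + 1\<close>
  distinct coordinates, as \<open>t < n\<close>; this is just enough for degree \<open>t\<close>.\<close>

lemma low_degree_generator:
  assumes inf: "infinite (UNIV :: 'k set)" and t: "t < n"
  shows "\<exists>Y. tail_fixed n t Y \<and> {u \<in> deg_le n 0 t. \<forall>j. hcomp j u \<in> U j} \<subseteq> gspan n {Y} \<and> Y \<in> deg_le n 0 t"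
proof -
  let ?W = "{u \<in> deg_le n 0 t. \<forall>j. hcomp j u \<in> U j}"
  have "infinite (UNIV - {0 :: 'k})" using inf by simp
  from infinite_countable_subset[OF this] obtain a :: "nat \<Rightarrow> 'k"
    where a: "inj a \<and> range a \<subseteq> UNIV - {0}" ..
  have a0: "a i \<noteq> 0" for i using a rangeI[of a i] by (metis Diff_iff singletonI subsetD)
  define p where "p i = (if i < t then a i else 0)" for i
  have card: "t + 1 \<le> card (p ` {..<n})"
  proof -
    have ai: "a i = a j \<longleftrightarrow> i = j" for i j by (rule inj_eq[OF conjunct1[OF a]])
    have "inj_on p {..t}"
    proof (rule inj_onI)
      fix i j assume "i \<in> {..t}" "j \<in> {..t}" "p i = p j"
      then show "i = j" using a0[of i] a0[of j] by (cases "i < t"; cases "j < t") (simp_all add: p_def ai)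
    qed
    then have "card (p ` {..t}) = t + 1" by (simp add: card_image)
    moreover have "p ` {..t} \<subseteq> p ` {..<n}" using t by (intro image_mono) auto
    ultimately show ?thesis using card_mono[of "p ` {..<n}" "p ` {..t}"] by simp
  qed
  have stable: "stable n ?W"
    unfolding stable_def
  proof (intro conjI allI impI)
    show "mpoly.subspace ?W"
      using deg_le_subspace[of n 0 t, where 'a = 'k] stable_subspace[OF U_stable]
      by (simp add: mpoly.subspace_def)
    fix \<sigma> f assume \<sigma>: "\<sigma> permutes {..<n}" and f: "f \<in> ?W"
    then have "f \<in> carrier (poly_ring n)" by (simp add: deg_le_def)
    then show "perm_act \<sigma> f \<in> ?W"
      using f stableD[OF U_stable \<sigma>] perm_act_deg_le[of f n t, OF _ \<sigma>] by (simp flip: perm_act_hcomp[OF _ \<sigma>])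
  qed
  have "\<exists>Y\<in>?W. tail_fixed n t Y \<and> ?W \<subseteq> gspan n {Y}"
  proof (rule generator_from_orbit[OF stable, of t p])
    fix \<sigma> i assume \<sigma>: "\<sigma> permutes {t..<n}"
    show "p (\<sigma> i) = p i"
      using permutes_in_image[OF \<sigma>, of i] permutes_not_in[OF \<sigma>, of i] by (cases "i \<in> {t..<n}") (auto simp: p_def)
  next
    fix u assume u: "u \<in> ?W" and van: "\<And>\<sigma>. \<sigma> permutes {..<n} \<Longrightarrow> eval_at p (perm_act \<sigma> u) = 0"
    \<comment> \<open>the leading form vanishes, so the degree can be lowered step by step\<close>
    have "u = 0" if "u \<in> deg_le n 0 s" "s \<le> t" for s
      using that
    proof (induction s)
      case 0
      have "u \<in> orbit_ideal n p 0"
        using van card 0 by (intro vanishing_on_orbit) (auto simp: eval_at_perm_act)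
      from top_form_orbit_ideal[OF this] have "hcomp 0 u \<in> esym_ideal n 0 \<inter> U 0" using u by blast
      then have "hcomp 0 u = 0" using U_disjoint by blast
      then show ?case using sum_hcomp[OF 0(1)] by simp
    next
      case (Suc s)
      have "u \<in> orbit_ideal n p (Suc s)"
        using van card Suc.prems by (intro vanishing_on_orbit) (auto simp: eval_at_perm_act)
      from top_form_orbit_ideal[OF this] have "hcomp (Suc s) u \<in> esym_ideal n (Suc s) \<inter> U (Suc s)" using u by blast
      then have 0: "hcomp (Suc s) u = 0" using U_disjoint by blast
      have "mdeg m \<noteq> Suc s" if "m \<in> Poly_Mapping.keys u" for m
        using keys_hcomp[of "Suc s" u] that unfolding 0 by auto
      then have "u \<in> deg_le n 0 s" using Suc.prems(1) by (force simp: deg_le_def le_Suc_eq)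
      then show ?case using Suc by simp
    qed
    then show "u = 0" using u by blast
  qed
  then show ?thesis by blast
qed

text \<open>Splitting off the part in \<open>U\<^sub>j\<close>, the rest of a form of degree \<open>j\<close> is a combination of elementary
  symmetric functions with cofactors of smaller degree. Hence all forms are combinations of products
  of elementary symmetric functions with elements of the \<open>U\<^sub>j\<close>.\<close>

lemma graded_in_coinvariant_products:
  assumes E: "mpoly.subspace E"
    and base: "\<And>q c j u. \<lbrakk>\<forall>x\<in>#q. 2 \<le> x; \<Sum>\<^sub># q + c + j = d; u \<in> U j\<rbrakk> \<Longrightarrow> esym_mset n q * esym mvar n 1 ^ c * u \<in> E"
    and compl: "\<And>j b. b \<in> graded_part n j \<Longrightarrow> \<exists>a\<in>esym_ideal n j. b - a \<in> U j"
    and "\<forall>x\<in>#q. 2 \<le> x" "\<Sum>\<^sub># q + c + j = d" "f \<in> graded_part n j"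
  shows "esym_mset n q * esym mvar n 1 ^ c * f \<in> E"
  using assms(4-)
proof (induction j arbitrary: f q c rule: less_induct)
  case (less j)
  let ?e = "\<lambda>q c. esym_mset n q * esym mvar n 1 ^ c :: 'k mpoly"
  obtain a where a: "a \<in> esym_ideal n j" "f - a \<in> U j" using compl[OF less.prems(3)] by blast
  have "?e q c * a \<in> E"
    using a(1) unfolding esym_ideal_def
  proof (induction a rule: mpoly.span_induct_alt)
    case base
    show ?case using mpoly.subspace_0[OF E] by simp
  next
    case (step k x y)
    then obtain i h where x: "x = esym mvar n i * h" "1 \<le> i" "i \<le> j" "h \<in> graded_part n (j - i)" by blast
    have "?e q c * x \<in> E"
    proof (cases "i = 1")
      case True
      have "?e q (Suc c) * h \<in> E"
        by (rule less.IH[of "j - 1"]) (use x less.prems True in auto)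
      then show ?thesis using True by (simp add: x(1) mult_ac)
    next
      case False
      have "?e (add_mset i q) c * h \<in> E"
        by (rule less.IH[of "j - i"]) (use x less.prems False in auto)
      then show ?thesis by (simp add: x(1) esym_mset_def mult_ac)
    qed
    moreover have "?e q c * (mscale k x + y) = mscale k (?e q c * x) + ?e q c * y"
      by (simp add: mscale_def algebra_simps)
    ultimately show ?case using step.IH by (simp add: mpoly.subspace_add[OF E] mpoly.subspace_scale[OF E])
  qed
  moreover have "?e q c * (f - a) \<in> E" by (rule base[OF less.prems(1,2) a(2)])
  ultimately have "?e q c * (f - a) + ?e q c * a \<in> E" by (intro mpoly.subspace_add[OF E])
  then show ?case by (simp add: algebra_simps)
qed

end

text \<open>Let \<open>Y\<^sub>t\<close> generate \<open>U\<^sub>0 + \<dots> + U\<^sub>t\<close>, and let \<open>q\<close> have sum \<open>d - t\<close>. Multiplying the component of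
  degree \<open>j\<close> by \<open>e\<^sub>q e\<^sub>1\<^sup>t\<^sup>-\<^sup>j\<close> is an equivariant linear map into degree \<open>d\<close>, and the image of \<open>Y\<^sub>t\<close>
  generates \<open>e\<^sub>q e\<^sub>1\<^sup>t\<^sup>-\<^sup>j U\<^sub>j\<close> for all \<open>j \<le> t\<close> at the same time. These are all the products that
  are needed.\<close>

theorem graded_part_generators:
  assumes inf: "infinite (UNIV :: 'k set)" and d: "d < n"
  shows "\<exists>y. (\<forall>q\<in>no_one_msets d. y q \<in> graded_part n d \<and> tail_fixed n (d - \<Sum>\<^sub># q) (y q)) \<and>
    (graded_part n d :: 'k mpoly set) \<subseteq> gspan n (y ` no_one_msets d)"
proof -
  have "\<exists>U. stable n U \<and> U \<subseteq> graded_part n j \<and> esym_ideal n j \<inter> U \<subseteq> {0} \<and>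
      (\<forall>b\<in>graded_part n j. \<exists>a\<in>esym_ideal n j. b - a \<in> (U :: 'k mpoly set))" for j
    by (rule stable_complement[OF stable_esym_ideal stable_graded_part esym_ideal_graded]) blast
  then have "\<forall>j. \<exists>U. stable n U \<and> U \<subseteq> graded_part n j \<and> esym_ideal n j \<inter> U \<subseteq> {0} \<and>
      (\<forall>b\<in>graded_part n j. \<exists>a\<in>esym_ideal n j. b - a \<in> (U :: 'k mpoly set))" by blast
  from choice[OF this] obtain U :: "nat \<Rightarrow> 'k mpoly set" where U: "\<And>j. stable n (U j)" "\<And>j. U j \<subseteq> graded_part n j"
    "\<And>j. esym_ideal n j \<inter> U j \<subseteq> {0}"
    and compl: "\<And>j b. b \<in> graded_part n j \<Longrightarrow> \<exists>a\<in>esym_ideal n j. b - a \<in> U j" by blast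
  let ?W = "\<lambda>t. {u \<in> deg_le n 0 t. \<forall>j. hcomp j u \<in> U j}"
  have "\<forall>t. \<exists>Y. t \<le> d \<longrightarrow> tail_fixed n t Y \<and> ?W t \<subseteq> gspan n {Y} \<and> Y \<in> deg_le n 0 t"
    using low_degree_generator[OF U inf] d by (meson le_less_trans)
  from choice[OF this] obtain Y where Y: "\<And>t. t \<le> d \<Longrightarrow> tail_fixed n t (Y t)" "\<And>t. t \<le> d \<Longrightarrow> ?W t \<subseteq> gspan n {Y t}"
    "\<And>t. t \<le> d \<Longrightarrow> Y t \<in> deg_le n 0 t" by blast
  define \<Theta> where "\<Theta> q t v = (\<Sum>j\<le>t. esym_mset n q * esym mvar n 1 ^ (t - j) * hcomp j v)"
    for q t and v :: "'k mpoly"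
  have \<Theta>_lin: "\<Theta> q t (f + g) = \<Theta> q t f + \<Theta> q t g" "\<Theta> q t (mscale c f) = mscale c (\<Theta> q t f)" "\<Theta> q t 0 = 0"
    for q t f g c
    by (simp_all add: \<Theta>_def distrib_left sum.distrib mult_mscale flip: mpoly.scale_sum_right)
  have \<Theta>_perm: "\<Theta> q t (perm_act \<sigma> f) = perm_act \<sigma> (\<Theta> q t f)"
    if "\<sigma> permutes {..<n}" "f \<in> carrier (poly_ring n)" for q t f \<sigma>
    using that by (simp add: \<Theta>_def perm_act_hcomp del: poly_ring_sel)
  define y where "y q = \<Theta> q (d - \<Sum>\<^sub># q) (Y (d - \<Sum>\<^sub># q))" for q
  let ?E = "gspan n (y ` no_one_msets d)"
  have E: "stable n ?E" "mpoly.subspace ?E" by (rule stable_gspan stable_subspace[OF stable_gspan])+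
  have Yc: "Y t \<in> carrier (poly_ring n)" if "t \<le> d" for t using Y(3)[OF that] by (simp add: deg_le_def)
  have "y q \<in> graded_part n d \<and> tail_fixed n (d - \<Sum>\<^sub># q) (y q)" if q: "q \<in> no_one_msets d" for q
  proof
    let ?t = "d - \<Sum>\<^sub># q"
    have le: "\<Sum>\<^sub># q \<le> d" using q by (simp add: no_one_msets_def)
    show "y q \<in> graded_part n d"
      unfolding y_def \<Theta>_def
    proof (rule mpoly.subspace_sum[OF graded_part_subspace])
      fix j assume "j \<in> {..?t}"
      moreover have "esym_mset n q * esym mvar n 1 ^ (?t - j) * hcomp j (Y ?t)
          \<in> graded_part n (\<Sum>\<^sub># q + (?t - j) * 1 + j)"
        by (intro graded_part_mult graded_part_power esym_mset_graded esym_mvar_graded hcomp_graded Yc) simp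
      ultimately show "esym_mset n q * esym mvar n 1 ^ (?t - j) * hcomp j (Y ?t) \<in> graded_part n d"
        using le by simp
    qed
    have "perm_act \<sigma> (y q) = y q" if \<sigma>: "\<sigma> permutes {?t..<n}" for \<sigma>
    proof -
      have "\<sigma> permutes {..<n}" by (rule permutes_subset[OF \<sigma>]) auto
      from \<Theta>_perm[OF this Yc, of ?t] show ?thesis
        using Y(1)[of ?t] \<sigma> by (simp add: y_def tail_fixed_def)
    qed
    then show "tail_fixed n ?t (y q)" by (simp add: tail_fixed_def)
  qed
  moreover have "f \<in> ?E" if f: "f \<in> graded_part n d" for f
  proof -
    have "esym_mset n {#} * esym mvar n 1 ^ 0 * f \<in> ?E"
    proof (rule graded_in_coinvariant_products[OF U E(2) _ compl])
      fix q c j u assume q: "\<forall>x\<in>#q. 2 \<le> x" "\<Sum>\<^sub># q + c + j = d" and u: "u \<in> U j"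
      let ?t = "c + j"
      let ?V = "{v \<in> carrier (poly_ring n). \<Theta> q ?t v \<in> ?E}"
      have qmem: "q \<in> no_one_msets d" and t: "d - \<Sum>\<^sub># q = ?t" "?t \<le> d"
        using q by (auto simp: no_one_msets_def)
      have "stable n ?V"
        unfolding stable_def
      proof (intro conjI allI impI)
        show "mpoly.subspace ?V"
          using carrier_subspace[of n, where 'a = 'k] E(2) \<Theta>_lin by (simp add: mpoly.subspace_def del: poly_ring_sel)
        fix \<sigma> v assume \<sigma>: "\<sigma> permutes {..<n}" and v: "v \<in> ?V"
        then have "perm_act \<sigma> v \<in> carrier (poly_ring n)" using perm_act_carrier[OF _ \<sigma>] by blast
        then show "perm_act \<sigma> v \<in> ?V"
          using v \<Theta>_perm[OF \<sigma>] stableD[OF E(1) \<sigma>] by (simp del: poly_ring_sel)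
      qed
      moreover have "Y ?t \<in> ?V"
      proof -
        have "\<Theta> q ?t (Y ?t) = y q" by (simp only: y_def t(1))
        moreover have "y q \<in> ?E" by (rule gspan_base) (use qmem in blast)
        ultimately show ?thesis using Yc[OF t(2)] by simp
      qed
      ultimately have "gspan n {Y ?t} \<subseteq> ?V" by (intro gspan_minimal) auto
      moreover have ug: "u \<in> graded_part n j" using U(2) u by blast
      then have "u \<in> ?W ?t"
        using u mpoly.subspace_0[OF stable_subspace[OF U(1)]] by (auto simp: hcomp_eq intro: graded_imp_deg_le)
      ultimately have "\<Theta> q ?t u \<in> ?E" using Y(2)[OF t(2)] by blast
      moreover have "\<Theta> q ?t u = esym_mset n q * esym mvar n 1 ^ c * u"
      proof -
        have "\<Theta> q ?t u = (\<Sum>i\<le>?t. if i = j then esym_mset n q * esym mvar n 1 ^ (?t - i) * u else 0)"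
          unfolding \<Theta>_def by (intro sum.cong) (auto simp: hcomp_eq[OF ug])
        then show ?thesis by simp
      qed
      ultimately show "esym_mset n q * esym mvar n 1 ^ c * u \<in> ?E" by simp
    qed (use f in auto)
    then show ?thesis by (simp add: esym_mset_def)
  qed
  ultimately show ?thesis by blast
qed

end

section \<open>Counting partitions\<close>

definition desc_list :: "nat multiset \<Rightarrow> nat list" where
  "desc_list q = rev (sorted_list_of_multiset q)"

lemma mset_desc_list [simp]: "mset (desc_list q) = q"
  by (simp add: desc_list_def)

lemma desc_list_sorted: "sorted_wrt (\<ge>) (desc_list q)"
  by (simp add: desc_list_def sorted_wrt_rev)

lemma desc_list_mset: "sorted_wrt (\<ge>) a \<Longrightarrow> desc_list (mset a) = a"
  unfolding desc_list_def sorted_list_of_multiset_mset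
  by (metis mset_rev properties_for_sort rev_rev_ident sorted_wrt_rev)

definition parts_msets :: "nat \<Rightarrow> nat multiset set" where
  "parts_msets i = {q. 0 \<notin># q \<and> \<Sum>\<^sub># q = i}"

lemma partition_number_eq_card: "partition_number i = card (parts_msets i)"
proof -
  have "bij_betw mset {a. sorted_wrt (\<ge>) a \<and> 0 \<notin> set a \<and> sum_list a = i} (parts_msets i)"
  proof (rule bij_betw_byWitness[of _ desc_list])
    show "desc_list ` parts_msets i \<subseteq> {a. sorted_wrt (\<ge>) a \<and> 0 \<notin> set a \<and> sum_list a = i}"
    proof safe
      fix q assume q: "q \<in> parts_msets i"
      show "sorted_wrt (\<ge>) (desc_list q)" by (rule desc_list_sorted)
      have "set (desc_list q) = set_mset q" by (metis mset_desc_list set_mset_mset)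
      then show "0 \<in> set (desc_list q) \<Longrightarrow> False" using q by (simp add: parts_msets_def)
      have "sum_list (desc_list q) = \<Sum>\<^sub># q" by (metis mset_desc_list sum_mset_sum_list)
      then show "sum_list (desc_list q) = i" using q by (simp add: parts_msets_def)
    qed
  qed (auto simp: parts_msets_def desc_list_mset sum_mset_sum_list)
  then show ?thesis unfolding partition_number_def by (rule bij_betw_same_card)
qed

lemma size_le_sum_mset: "0 \<notin># q \<Longrightarrow> size q \<le> \<Sum>\<^sub># (q :: nat multiset)"
  by (induction q) auto

lemma finite_small_msets: "finite {q :: nat multiset. 0 \<notin># q \<and> \<Sum>\<^sub># q \<le> d}"
proof (rule finite_subset)
  show "{q. 0 \<notin># q \<and> \<Sum>\<^sub># q \<le> d} \<subseteq> mset ` {xs. set xs \<subseteq> {..d} \<and> length xs \<le> d}"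
  proof
    fix q :: "nat multiset" assume "q \<in> {q. 0 \<notin># q \<and> \<Sum>\<^sub># q \<le> d}"
    then have q: "0 \<notin># q" "\<Sum>\<^sub># q \<le> d" by auto
    have "length (desc_list q) = size q" by (metis mset_desc_list size_mset)
    then have "length (desc_list q) \<le> d" using size_le_sum_mset[OF q(1)] q(2) by simp
    moreover have "set (desc_list q) = set_mset q" by (metis mset_desc_list set_mset_mset)
    moreover have "x \<le> d" if "x \<in># q" for x using multi_member_split[OF that] q(2) by auto
    ultimately have "set (desc_list q) \<subseteq> {..d}" "length (desc_list q) \<le> d" by auto
    then show "q \<in> mset ` {xs. set xs \<subseteq> {..d} \<and> length xs \<le> d}"
      by (intro image_eqI[of _ _ "desc_list q"]) auto
  qed
  show "finite (mset ` {xs. set xs \<subseteq> {..d} \<and> length xs \<le> d})"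
    by (intro finite_imageI finite_lists_length_le) simp
qed

lemma finite_no_one_msets: "finite (no_one_msets d)"
  by (rule finite_subset[OF _ finite_small_msets[of d]]) (fastforce simp: no_one_msets_def)

lemma finite_parts_msets: "finite (parts_msets d)"
  by (rule finite_subset[OF _ finite_small_msets[of d]]) (auto simp: parts_msets_def)

lemma replicate_mset_fill:
  assumes "\<And>x. x \<in># q \<Longrightarrow> \<not> P x \<Longrightarrow> x = c"
  shows "filter_mset P q + replicate_mset (size q - size (filter_mset P q)) c = q"
proof -
  have "filter_mset (\<lambda>x. \<not> P x) q = replicate_mset (size (filter_mset (\<lambda>x. \<not> P x) q)) c"
    using assms by (intro set_mset_subset_singletonD) auto
  moreover have q: "filter_mset P q + filter_mset (\<lambda>x. \<not> P x) q = q" by (simp flip: multiset_partition)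
  moreover have "size (filter_mset P q) + size (filter_mset (\<lambda>x. \<not> P x) q) = size q"
    by (metis q size_union)
  ultimately show ?thesis by (metis add_diff_cancel_left')
qed

text \<open>Filling up with ones turns these multisets into partitions of \<open>i\<close>.\<close>

lemma card_no_one_msets: "card (no_one_msets i) = partition_number i"
proof -
  have "bij_betw (\<lambda>q. q + replicate_mset (i - \<Sum>\<^sub># q) 1) (no_one_msets i) (parts_msets i)"
  proof (rule bij_betw_byWitness[of _ "filter_mset (\<lambda>x. 2 \<le> x)"])
    show "\<forall>q\<in>no_one_msets i. filter_mset (\<lambda>x. 2 \<le> x) (q + replicate_mset (i - \<Sum>\<^sub># q) 1) = q"
    proof
      fix q assume "q \<in> no_one_msets i"
      then have "filter_mset (\<lambda>x. 2 \<le> x) q = q" by (simp add: no_one_msets_def filter_mset_eq_conv)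
      moreover have "filter_mset (\<lambda>x. 2 \<le> x) (replicate_mset k (1::nat)) = {#}" for k
        by (induction k) auto
      ultimately show "filter_mset (\<lambda>x. 2 \<le> x) (q + replicate_mset (i - \<Sum>\<^sub># q) 1) = q" by simp
    qed
    show "\<forall>q\<in>parts_msets i. filter_mset (\<lambda>x. 2 \<le> x) q
        + replicate_mset (i - \<Sum>\<^sub># (filter_mset (\<lambda>x. 2 \<le> x) q)) 1 = q"
    proof
      fix q assume q: "q \<in> parts_msets i"
      let ?F = "filter_mset (\<lambda>x. 2 \<le> x) q"
      have fill: "?F + replicate_mset (size q - size ?F) 1 = q"
      proof (rule replicate_mset_fill)
        fix x assume "x \<in># q" "\<not> 2 \<le> x"
        moreover have "0 \<notin># q" using q by (simp add: parts_msets_def)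
        with \<open>x \<in># q\<close> have "x \<noteq> 0" by metis
        ultimately show "x = 1" by auto
      qed
      from arg_cong[OF this, of sum_mset] have "\<Sum>\<^sub># ?F + (size q - size ?F) = i"
        using q by (simp add: parts_msets_def)
      then show "?F + replicate_mset (i - \<Sum>\<^sub># ?F) 1 = q" using fill by auto
    qed
    show "(\<lambda>q. q + replicate_mset (i - \<Sum>\<^sub># q) 1) ` no_one_msets i \<subseteq> parts_msets i"
    proof safe
      fix q assume q: "q \<in> no_one_msets i"
      then have "0 \<notin># q" by (force simp: no_one_msets_def)
      then show "q + replicate_mset (i - \<Sum>\<^sub># q) 1 \<in> parts_msets i"
        using q by (simp add: no_one_msets_def parts_msets_def)
    qed
    show "filter_mset (\<lambda>x. 2 \<le> x) ` parts_msets i \<subseteq> no_one_msets i"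
    proof safe
      fix q assume q: "q \<in> parts_msets i"
      have "\<Sum>\<^sub># (filter_mset (\<lambda>x. 2 \<le> x) q) + \<Sum>\<^sub># (filter_mset (\<lambda>x. \<not> 2 \<le> x) q) = i"
        using q by (simp add: parts_msets_def flip: sum_mset.union multiset_partition)
      then show "filter_mset (\<lambda>x. 2 \<le> x) q \<in> no_one_msets i" by (auto simp: no_one_msets_def)
    qed
  qed
  from bij_betw_same_card[OF this] show ?thesis by (simp add: partition_number_eq_card)
qed

text \<open>Each codegree \<open>d - \<Sum> q\<close> counts the \<open>i < d\<close> that are at least \<open>\<Sum> q\<close>. So the sum counts, for each
  \<open>i < d\<close>, the multisets without ones of sum at most \<open>i\<close>, of which there are as many as partitions
  of \<open>i\<close>.\<close>

lemma sum_codegree_no_one_msets: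
  "(\<Sum>q\<in>no_one_msets d. d - \<Sum>\<^sub># q) = (\<Sum>i<d. partition_number i)"
proof -
  have "d - s = (\<Sum>i<d. if s \<le> i then 1 else 0)" for s
  proof -
    have "{..<d} \<inter> {i. s \<le> i} = {s..<d}" by auto
    then show ?thesis by (simp add: sum.If_cases)
  qed
  then have "(\<Sum>q\<in>no_one_msets d. d - \<Sum>\<^sub># q) = (\<Sum>q\<in>no_one_msets d. \<Sum>i<d. if \<Sum>\<^sub># q \<le> i then 1 else 0)"
    by simp
  also have "\<dots> = (\<Sum>i<d. \<Sum>q\<in>no_one_msets d. if \<Sum>\<^sub># q \<le> i then 1 else 0)" by (rule sum.swap)
  also have "\<dots> = (\<Sum>i<d. partition_number i)"
  proof (rule sum.cong[OF refl])
    fix i assume "i \<in> {..<d}"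
    then have "no_one_msets d \<inter> {q. \<Sum>\<^sub># q \<le> i} = no_one_msets i" by (auto simp: no_one_msets_def)
    then show "(\<Sum>q\<in>no_one_msets d. if \<Sum>\<^sub># q \<le> i then 1 else 0) = partition_number i"
      by (simp add: sum.If_cases finite_no_one_msets card_no_one_msets)
  qed
  finally show ?thesis .
qed

lemma card_padded_partitions:
  assumes "d \<le> n"
  shows "card (padded_partitions d n) = partition_number d" "finite (padded_partitions d n)"
proof -
  have bij: "bij_betw (\<lambda>a. filter_mset (\<lambda>x. x \<noteq> 0) (mset a)) (padded_partitions d n) (parts_msets d)"
  proof (rule bij_betw_byWitness[of _ "\<lambda>q. desc_list (q + replicate_mset (n - size q) 0)"])
    show "\<forall>a\<in>padded_partitions d n. desc_list (filter_mset (\<lambda>x. x \<noteq> 0) (mset a)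
        + replicate_mset (n - size (filter_mset (\<lambda>x. x \<noteq> 0) (mset a))) 0) = a"
    proof
      fix a assume a: "a \<in> padded_partitions d n"
      then have "size (mset a) = n" by (simp add: padded_partitions_def)
      then have "filter_mset (\<lambda>x. x \<noteq> 0) (mset a) + replicate_mset (n - size (filter_mset (\<lambda>x. x \<noteq> 0) (mset a))) 0 = mset a"
        using replicate_mset_fill[of "mset a" "\<lambda>x. x \<noteq> 0" 0] by simp
      then show "desc_list (filter_mset (\<lambda>x. x \<noteq> 0) (mset a)
        + replicate_mset (n - size (filter_mset (\<lambda>x. x \<noteq> 0) (mset a))) 0) = a"
        using a by (simp only: desc_list_mset padded_partitions_def mem_Collect_eq)
    qed
    have filter: "filter_mset (\<lambda>x. x \<noteq> 0) q = q" if "0 \<notin># q" for q :: "nat multiset"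
      using that by (intro multiset_eqI) (auto simp: not_in_iff)
    then show "\<forall>q\<in>parts_msets d. filter_mset (\<lambda>x. x \<noteq> 0) (mset (desc_list (q + replicate_mset (n - size q) 0))) = q"
      by (auto simp: parts_msets_def)
    show "(\<lambda>a. filter_mset (\<lambda>x. x \<noteq> 0) (mset a)) ` padded_partitions d n \<subseteq> parts_msets d"
    proof safe
      fix a assume a: "a \<in> padded_partitions d n"
      have "\<Sum>\<^sub># (filter_mset (\<lambda>x. x \<noteq> 0) q) = \<Sum>\<^sub># q" for q :: "nat multiset" by (induction q) auto
      then show "filter_mset (\<lambda>x. x \<noteq> 0) (mset a) \<in> parts_msets d"
        using a by (auto simp: parts_msets_def padded_partitions_def sum_mset_sum_list)
    qed
    show "(\<lambda>q. desc_list (q + replicate_mset (n - size q) 0)) ` parts_msets d \<subseteq> padded_partitions d n"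
    proof safe
      fix q assume q: "q \<in> parts_msets d"
      let ?q = "q + replicate_mset (n - size q) 0"
      have "size q \<le> n" using size_le_sum_mset[of q] q assms by (simp add: parts_msets_def)
      then have "length (desc_list ?q) = n" by (metis mset_desc_list size_mset size_union size_replicate_mset le_add_diff_inverse)
      moreover have "sum_list (desc_list ?q) = \<Sum>\<^sub># ?q" by (metis mset_desc_list sum_mset_sum_list)
      ultimately show "desc_list ?q \<in> padded_partitions d n"
        using q desc_list_sorted by (simp add: padded_partitions_def parts_msets_def)
    qed
  qed
  show "card (padded_partitions d n) = partition_number d"
    using bij_betw_same_card[OF bij] by (simp add: partition_number_eq_card)
  show "finite (padded_partitions d n)"
    using bij_betw_finite[OF bij] finite_parts_msets by blast
qed

section \<open>Generating the forms with zero average\<close>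

definition avg_zero_part :: "nat \<Rightarrow> nat \<Rightarrow> 'k::field mpoly set" where
  "avg_zero_part n d = {f \<in> graded_part n d. sym_avg {..<n} f = 0}"

context nonmodular
begin

lemma sym_avg_idem: "sym_avg {..<n} (sym_avg {..<n} f) = (sym_avg {..<n} f :: 'k mpoly)"
  by (rule sym_avg_fixed) (simp_all add: perm_act_sym_avg)

lemma stable_avg_zero_part: "stable n (avg_zero_part n d :: 'k mpoly set)"
  using stable_graded_part[of n d, where 'a = 'k]
  by (auto simp: stable_def avg_zero_part_def mpoly.subspace_def sym_avg_perm_act)

text \<open>Subtracting the average is an equivariant projection of all forms onto those with zero average, and
  it preserves types. So the generators found above can be projected and then packed.\<close>

theorem avg_zero_part_few_generators:
  assumes inf: "infinite (UNIV :: 'k set)" and d: "d < n" "1 \<le> d"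
    and r: "(\<Sum>i<d. partition_number i) \<le> r * (n - 1)"
  shows "\<exists>g. (\<forall>i<r. g i \<in> avg_zero_part n d) \<and> (avg_zero_part n d :: 'k mpoly set) \<subseteq> gspan n (g ` {..<r})"
proof -
  let ?V = "avg_zero_part n d :: 'k mpoly set"
  let ?P = "\<lambda>f. f - sym_avg {..<n} f :: 'k mpoly"
  obtain y :: "nat multiset \<Rightarrow> 'k mpoly" where
    y: "\<And>q. q \<in> no_one_msets d \<Longrightarrow> y q \<in> graded_part n d" 
       "\<And>q. q \<in> no_one_msets d \<Longrightarrow> tail_fixed n (d - \<Sum>\<^sub># q) (y q)"
    and gen: "graded_part n d \<subseteq> gspan n (y ` no_one_msets d)"
    using graded_part_generators[OF inf d(1)] by blast
  obtain qs where qs: "set qs = no_one_msets d" "distinct qs"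
    using finite_distinct_list[OF finite_no_one_msets] by blast
  have gens: "typed_gens ?V (map (\<lambda>q. d - \<Sum>\<^sub># q) qs)"
    unfolding typed_gens_def
  proof (intro exI[of _ "map (\<lambda>q. ?P (y q)) qs"] conjI)
    have "?P (y q) \<in> ?V \<and> tail_fixed n (d - \<Sum>\<^sub># q) (?P (y q))" if "q \<in> set qs" for q
    proof
      have q: "q \<in> no_one_msets d" using that qs by simp
      have "?P (y q) \<in> graded_part n d"
        by (intro mpoly.subspace_diff[OF graded_part_subspace] sym_avg_mem[OF stable_graded_part] y q) simp
      then show "?P (y q) \<in> ?V" by (simp add: avg_zero_part_def sym_avg_idem)
      have "perm_act \<sigma> (?P (y q)) = ?P (y q)" if \<sigma>: "\<sigma> permutes {d - \<Sum>\<^sub># q..<n}" for \<sigma>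
      proof -
        have "\<sigma> permutes {..<n}" by (rule permutes_subset[OF \<sigma>]) auto
        then show ?thesis using y(2)[OF q] \<sigma> by (simp add: perm_act_sym_avg tail_fixed_def)
      qed
      then show "tail_fixed n (d - \<Sum>\<^sub># q) (?P (y q))" by (simp add: tail_fixed_def)
    qed
    then show "list_all2 (\<lambda>t y. y \<in> ?V \<and> tail_fixed n t y) (map (\<lambda>q. d - \<Sum>\<^sub># q) qs) (map (\<lambda>q. ?P (y q)) qs)"
      by (simp add: list_all2_map1 list_all2_map2 list_all2_same)
    let ?E = "gspan n (set (map (\<lambda>q. ?P (y q)) qs))"
    have E: "stable n ?E" "mpoly.subspace ?E" by (rule stable_gspan stable_subspace[OF stable_gspan])+
    have "stable n {f. ?P f \<in> ?E}"
      unfolding stable_def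
    proof (intro conjI allI impI)
      have lin: "?P (f + g) = ?P f + ?P g" "?P (mscale c f) = mscale c (?P f)" "?P 0 = 0" for f g c
        by (simp_all add: mpoly.scale_right_diff_distrib)
      show "mpoly.subspace {f. ?P f \<in> ?E}"
        by (rule mpoly.subspaceI; unfold mem_Collect_eq lin)
           (rule mpoly.subspace_0[OF E(2)] mpoly.subspace_add[OF E(2)] mpoly.subspace_scale[OF E(2)]; assumption)+
      fix \<sigma> f assume \<sigma>: "\<sigma> permutes {..<n}" and f: "f \<in> {f. ?P f \<in> ?E}"
      have eq: "?P (perm_act \<sigma> f) = perm_act \<sigma> (?P f)"
        by (simp add: sym_avg_perm_act[OF \<sigma>] perm_act_sym_avg[OF \<sigma>])
      have "perm_act \<sigma> (?P f) \<in> ?E" by (rule stableD[OF E(1) \<sigma>]) (use f in \<open>rule CollectD\<close>)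
      then show "perm_act \<sigma> f \<in> {f. ?P f \<in> ?E}" unfolding mem_Collect_eq eq .
    qed
    then have "gspan n (y ` no_one_msets d) \<subseteq> {f. ?P f \<in> ?E}"
      by (rule gspan_minimal) (use qs in \<open>auto intro!: gspan_base\<close>)
    then have "?P f \<in> ?E" if "f \<in> ?V" for f using gen that by (auto simp: avg_zero_part_def)
    then show "?V \<subseteq> ?E" by (auto simp: avg_zero_part_def)
  qed
  have no_inv: "f = 0" if "f \<in> ?V" "\<And>\<sigma>. \<sigma> permutes {..<n} \<Longrightarrow> perm_act \<sigma> f = f" for f
    using that sym_avg_fixed[of "{..<n}" f] by (simp add: avg_zero_part_def)
  have N: "n = Suc (n - 1)" using d by simp
  have le: "\<forall>t\<in>set (map (\<lambda>q. d - \<Sum>\<^sub># q) qs). t \<le> n - 1" using d by auto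
  have "sum_list (map (\<lambda>q. d - \<Sum>\<^sub># q) qs) = (\<Sum>q\<in>no_one_msets d. d - \<Sum>\<^sub># q)"
    using sum.distinct_set_conv_list[OF qs(2), of "\<lambda>q. d - \<Sum>\<^sub># q"] qs(1) by simp
  then have sum: "sum_list (map (\<lambda>q. d - \<Sum>\<^sub># q) qs) \<le> r * (n - 1)"
    using r by (simp add: sum_codegree_no_one_msets)
  have "1 \<le> n - 1" using d by simp
  from few_generators[OF stable_avg_zero_part N no_inv gens le sum this] show ?thesis .
qed

end

section \<open>Ideals of the polynomial ring\<close>

lemma poly_ring_ring: "ring (poly_ring n :: 'k::field mpoly ring)"
  using poly_ring_cring by (rule cring.axioms)

lemma mconst_carrier: "mconst c \<in> carrier (poly_ring n)"
  by (rule graded_imp_carrier[OF mconst_graded])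

lemma poly_idealI:
  fixes I :: "'k::field mpoly set"
  assumes "I \<subseteq> carrier (poly_ring n)" "mpoly.subspace I"
    and mult: "\<And>x a. x \<in> carrier (poly_ring n) \<Longrightarrow> a \<in> I \<Longrightarrow> x * a \<in> I"
  shows "ideal I (poly_ring n)"
proof (rule idealI[OF poly_ring_ring])
  interpret R: ring "poly_ring n :: 'k mpoly ring" by (rule poly_ring_ring)
  show "subgroup I (add_monoid (poly_ring n))"
  proof (rule group.subgroupI)
    show "group (add_monoid (poly_ring n :: 'k mpoly ring))" by (rule R.a_group)
    show "I \<subseteq> carrier (add_monoid (poly_ring n))" using assms(1) by simp
    show "I \<noteq> {}" using mpoly.subspace_0[OF assms(2)] by blast
    show "a \<otimes>\<^bsub>add_monoid (poly_ring n)\<^esub> b \<in> I" if "a \<in> I" "b \<in> I" for a b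
      using that mpoly.subspace_add[OF assms(2)] by simp
    fix a assume a: "a \<in> I"
    then have "- a \<in> I" by (rule mpoly.subspace_neg[OF assms(2)])
    moreover have "\<ominus>\<^bsub>poly_ring n\<^esub> a = - a"
      using a \<open>- a \<in> I\<close> assms(1) by (intro R.minus_equality) auto
    ultimately show "inv\<^bsub>add_monoid (poly_ring n)\<^esub> a \<in> I" by (simp add: a_inv_def)
  qed
  fix a x :: "'k mpoly" assume "a \<in> I" "x \<in> carrier (poly_ring n)"
  then have "x * a \<in> I" by (intro mult)
  then show "x \<otimes>\<^bsub>poly_ring n\<^esub> a \<in> I" "a \<otimes>\<^bsub>poly_ring n\<^esub> x \<in> I"
    by (simp_all add: mult.commute[of a x])
qed

lemma ideal_mult:
  assumes "ideal I (poly_ring n)" "x \<in> carrier (poly_ring n)" "a \<in> I"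
  shows "x * a \<in> I"
  using ideal.I_l_closed[OF assms(1,3,2)] by simp

lemma ideal_subspace:
  assumes I: "ideal I (poly_ring n)"
  shows "mpoly.subspace I"
proof (rule mpoly.subspaceI)
  have "additive_subgroup I (poly_ring n)" using I by (simp add: ideal_def)
  note add = additive_subgroup.a_closed[OF this] and zero = additive_subgroup.zero_closed[OF this]
  show "0 \<in> I" using zero by simp
  show "x + y \<in> I" if "x \<in> I" "y \<in> I" for x y using add[OF that] by simp
  show "mscale c x \<in> I" if "x \<in> I" for c x
    unfolding mscale_def by (rule ideal_mult[OF I mconst_carrier that])
qed

lemma Idl_ideal: "S \<subseteq> carrier (poly_ring n) \<Longrightarrow> ideal (Idl\<^bsub>poly_ring n\<^esub> S) (poly_ring n)"
  by (rule ring.genideal_ideal[OF poly_ring_ring])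

lemma Idl_base: "S \<subseteq> carrier (poly_ring n) \<Longrightarrow> x \<in> S \<Longrightarrow> x \<in> Idl\<^bsub>poly_ring n\<^esub> S"
  using ring.genideal_self[OF poly_ring_ring] by blast

lemma Idl_minimal: "ideal I (poly_ring n) \<Longrightarrow> S \<subseteq> I \<Longrightarrow> Idl\<^bsub>poly_ring n\<^esub> S \<subseteq> I"
  by (rule ring.genideal_minimal[OF poly_ring_ring])

lemma Idl_union:
  assumes "S \<subseteq> carrier (poly_ring n)" "T \<subseteq> carrier (poly_ring n)"
  shows "Idl\<^bsub>poly_ring n\<^esub> S <+>\<^bsub>poly_ring n\<^esub> Idl\<^bsub>poly_ring n\<^esub> T = Idl\<^bsub>poly_ring n\<^esub> (S \<union> T)"
proof -
  let ?R = "poly_ring n :: 'a mpoly ring"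
  note I = Idl_ideal[OF assms(1)] Idl_ideal[OF assms(2)]
  have U: "S \<union> T \<subseteq> carrier ?R" using assms by blast
  have sub: "Idl\<^bsub>?R\<^esub> S \<union> Idl\<^bsub>?R\<^esub> T \<subseteq> carrier ?R"
    using ideal.Icarr[OF I(1)] ideal.Icarr[OF I(2)] by blast
  have "Idl\<^bsub>?R\<^esub> S <+>\<^bsub>?R\<^esub> Idl\<^bsub>?R\<^esub> T = Idl\<^bsub>?R\<^esub> (Idl\<^bsub>?R\<^esub> S \<union> Idl\<^bsub>?R\<^esub> T)"
    by (rule ring.union_genideal[OF poly_ring_ring I, symmetric])
  also have "\<dots> = Idl\<^bsub>?R\<^esub> (S \<union> T)"
  proof
    have "S \<subseteq> Idl\<^bsub>?R\<^esub> (S \<union> T)" "T \<subseteq> Idl\<^bsub>?R\<^esub> (S \<union> T)" using Idl_base[OF U] by blast+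
    then show "Idl\<^bsub>?R\<^esub> (Idl\<^bsub>?R\<^esub> S \<union> Idl\<^bsub>?R\<^esub> T) \<subseteq> Idl\<^bsub>?R\<^esub> (S \<union> T)"
      by (intro Idl_minimal Idl_ideal U Un_least)
    have "S \<union> T \<subseteq> Idl\<^bsub>?R\<^esub> (Idl\<^bsub>?R\<^esub> S \<union> Idl\<^bsub>?R\<^esub> T)"
      using Idl_base[OF assms(1)] Idl_base[OF assms(2)] Idl_base[OF sub] by blast
    then show "Idl\<^bsub>?R\<^esub> (S \<union> T) \<subseteq> Idl\<^bsub>?R\<^esub> (Idl\<^bsub>?R\<^esub> S \<union> Idl\<^bsub>?R\<^esub> T)"
      by (intro Idl_minimal Idl_ideal sub)
  qed
  finally show ?thesis .
qed

lemma graded_part_0: "f \<in> graded_part n 0 \<Longrightarrow> f = mconst (Poly_Mapping.lookup f 0)"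
proof (rule poly_mapping_eqI)
  fix m assume f: "f \<in> graded_part n 0"
  have "Poly_Mapping.lookup f m = 0" if "m \<noteq> 0"
  proof (rule ccontr)
    assume "Poly_Mapping.lookup f m \<noteq> 0"
    then have "mdeg m = 0" using f by (auto simp: graded_part_def in_keys_iff)
    then have "Poly_Mapping.lookup m i = 0" for i by (cases "i \<in> Poly_Mapping.keys m") (auto simp: mdeg_def in_keys_iff)
    then have "m = 0" by (intro poly_mapping_eqI) simp
    then show False using that by simp
  qed
  then show "Poly_Mapping.lookup f m = Poly_Mapping.lookup (mconst (Poly_Mapping.lookup f 0)) m"
    by (cases "m = 0") (auto simp: mconst_def lookup_single)
qed

text \<open>An ideal generated in degree \<open>d\<close> contains nothing new in degree \<open>d\<close>: the polynomials without
  components below degree \<open>d\<close> and with degree-\<open>d\<close> component in the span form an ideal.\<close>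

lemma Idl_graded_part:
  fixes B :: "'k::field mpoly set"
  assumes B: "B \<subseteq> graded_part n d"
  shows "Idl\<^bsub>poly_ring n\<^esub> B \<inter> graded_part n d = mpoly.span B"
proof
  have Bc: "B \<subseteq> carrier (poly_ring n)" using B graded_imp_carrier by blast
  have "B \<subseteq> Idl\<^bsub>poly_ring n\<^esub> B" using Idl_base[OF Bc] by blast
  then show "mpoly.span B \<subseteq> Idl\<^bsub>poly_ring n\<^esub> B \<inter> graded_part n d"
    using mpoly.span_minimal[OF _ ideal_subspace[OF Idl_ideal[OF Bc]]] mpoly.span_minimal[OF B graded_part_subspace]
    by blast
  define I :: "'k mpoly set" where "I = {f \<in> carrier (poly_ring n). hcomp d f \<in> mpoly.span B \<and> (\<forall>j<d. hcomp j f = 0)}"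
  have "ideal I (poly_ring n)"
  proof (rule poly_idealI)
    show "I \<subseteq> carrier (poly_ring n)" unfolding I_def by blast
    show "mpoly.subspace I"
    proof (rule mpoly.subspaceI; unfold I_def mem_Collect_eq)
      show "0 \<in> carrier (poly_ring n) \<and> hcomp d 0 \<in> mpoly.span B \<and> (\<forall>j<d. hcomp j 0 = 0)"
        by (simp add: mpoly.span_zero)
    next
      fix x y assume "x \<in> carrier (poly_ring n) \<and> hcomp d x \<in> mpoly.span B \<and> (\<forall>j<d. hcomp j x = 0)"
        "y \<in> carrier (poly_ring n) \<and> hcomp d y \<in> mpoly.span B \<and> (\<forall>j<d. hcomp j y = 0)"
      then show "x + y \<in> carrier (poly_ring n) \<and> hcomp d (x + y) \<in> mpoly.span B \<and> (\<forall>j<d. hcomp j (x + y) = 0)"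
        using mpoly.subspace_add[OF carrier_subspace, of x n y] by (simp add: mpoly.span_add del: poly_ring_sel)
    next
      fix c x assume "x \<in> carrier (poly_ring n) \<and> hcomp d x \<in> mpoly.span B \<and> (\<forall>j<d. hcomp j x = 0)"
      then show "mscale c x \<in> carrier (poly_ring n) \<and> hcomp d (mscale c x) \<in> mpoly.span B \<and> (\<forall>j<d. hcomp j (mscale c x) = 0)"
        using mpoly.subspace_scale[OF carrier_subspace, of x n c] by (simp add: mpoly.span_scale del: poly_ring_sel)
    qed
    fix x a :: "'k mpoly" assume x: "x \<in> carrier (poly_ring n)" and a: "a \<in> I"
    then have a': "a \<in> carrier (poly_ring n)" "hcomp d a \<in> mpoly.span B" "\<And>j. j < d \<Longrightarrow> hcomp j a = 0"
      unfolding I_def by blast+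
    obtain s where s: "x \<in> deg_le n 0 s" by (rule carrier_deg_le[OF x])
    have comp: "hcomp j (x * a) = (\<Sum>l\<le>s. if l \<le> j then hcomp l x * hcomp (j - l) a else 0)" for j
    proof -
      have "hcomp j (x * a) = hcomp j (\<Sum>l\<le>s. hcomp l x * a)"
        using sum_hcomp[OF s] by (simp flip: sum_distrib_right)
      then show ?thesis by (simp add: hcomp_mult_graded[OF hcomp_graded[OF x] a'(1)])
    qed
    have "hcomp j (x * a) = 0" if "j < d" for j
      unfolding comp using that a'(3) by (intro sum.neutral) simp
    moreover have "hcomp d (x * a) \<in> mpoly.span B"
    proof -
      have "hcomp d (x * a) = (\<Sum>l\<le>s. if l = 0 then hcomp 0 x * hcomp d a else 0)"
        unfolding comp
      proof (rule sum.cong[OF refl])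
        fix l show "(if l \<le> d then hcomp l x * hcomp (d - l) a else 0) = (if l = 0 then hcomp 0 x * hcomp d a else 0)"
          using a'(3)[of "d - l"] by (cases "l = 0") auto
      qed
      also have "\<dots> = hcomp 0 x * hcomp d a" by simp
      also have "\<dots> = mscale (Poly_Mapping.lookup (hcomp 0 x) 0) (hcomp d a)"
        unfolding mscale_def using graded_part_0[OF hcomp_graded[OF x]] by simp
      finally show ?thesis using a'(2) by (simp add: mpoly.span_scale)
    qed
    ultimately show "x * a \<in> I" unfolding I_def using carrier_mult[OF x a'(1)] by blast
  qed
  moreover have "B \<subseteq> I"
  proof
    fix b assume b: "b \<in> B"
    then have "hcomp j b = (if j = d then b else 0)" for j using B hcomp_eq by blast
    then show "b \<in> I" unfolding I_def using b Bc mpoly.span_base[of b B] by auto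
  qed
  ultimately have "Idl\<^bsub>poly_ring n\<^esub> B \<subseteq> I" by (rule Idl_minimal)
  then show "Idl\<^bsub>poly_ring n\<^esub> B \<inter> graded_part n d \<subseteq> mpoly.span B"
    unfolding I_def using hcomp_eq[of _ n d d, where 'a = 'k] by auto
qed

lemma symmetric_ideal_Idl:
  fixes B :: "'k::field mpoly set"
  assumes B: "B \<subseteq> carrier (poly_ring n)"
    and stab: "\<And>\<sigma> b. \<sigma> permutes {..<n} \<Longrightarrow> b \<in> B \<Longrightarrow> perm_act \<sigma> b \<in> Idl\<^bsub>poly_ring n\<^esub> B"
  shows "symmetric_ideal n (Idl\<^bsub>poly_ring n\<^esub> B)"
  unfolding symmetric_ideal_def
proof (intro conjI allI impI)
  let ?J = "Idl\<^bsub>poly_ring n\<^esub> B"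
  show J: "ideal ?J (poly_ring n)" by (rule Idl_ideal[OF B])
  fix \<sigma> f assume \<sigma>: "\<sigma> permutes {..<n}" and f: "f \<in> ?J"
  let ?I = "{f \<in> carrier (poly_ring n). perm_act \<sigma> f \<in> ?J}"
  have "ideal ?I (poly_ring n)"
  proof (rule poly_idealI)
    show "mpoly.subspace ?I"
      using carrier_subspace[of n, where 'a = 'k] ideal_subspace[OF J] by (simp add: mpoly.subspace_def del: poly_ring_sel)
    fix x a :: "'k mpoly" assume x: "x \<in> carrier (poly_ring n)" and a: "a \<in> ?I"
    then have "perm_act \<sigma> x * perm_act \<sigma> a \<in> ?J"
      by (intro ideal_mult[OF J perm_act_carrier[OF x \<sigma>]]) blast
    then show "x * a \<in> ?I" using carrier_mult[OF x] a by (simp del: poly_ring_sel)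
  qed blast
  moreover have "B \<subseteq> ?I" using B stab[OF \<sigma>] by blast
  ultimately have "?J \<subseteq> ?I" by (rule Idl_minimal)
  then show "perm_act \<sigma> f \<in> ?J" using f by blast
qed

section \<open>Orbits of monomials\<close>

text \<open>The exponent vector of the monomial \<open>\<sigma> \<cdot> \<^bold>x\<^sup>a\<close>.\<close>

definition exp_vec :: "nat \<Rightarrow> (nat \<Rightarrow> nat) \<Rightarrow> nat list \<Rightarrow> nat \<Rightarrow>\<^sub>0 nat" where
  "exp_vec n \<sigma> a = (\<Sum>i<n. Poly_Mapping.single (\<sigma> i) (a ! i))"

lemma perm_act_xpow: "length a = n \<Longrightarrow> perm_act \<sigma> (xpow a) = Poly_Mapping.single (exp_vec n \<sigma> a) 1"
proof -
  have pow: "mvar i ^ j = Poly_Mapping.single (Poly_Mapping.single i j) (1 :: 'a)" for i j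
    by (induction j) (simp_all add: mvar_def mult_single flip: single_add single_one)
  have prod: "(\<Prod>i<m. Poly_Mapping.single (g i) (1 :: 'a)) = Poly_Mapping.single (\<Sum>i<m. g i) 1"
    for m and g :: "nat \<Rightarrow> nat \<Rightarrow>\<^sub>0 nat"
    by (induction m) (simp_all add: mult_single)
  assume "length a = n"
  then have "perm_act \<sigma> (xpow a) = (\<Prod>i<n. mvar (\<sigma> i) ^ (a ! i) :: 'a mpoly)" by (simp add: xpow_def)
  then show "perm_act \<sigma> (xpow a) = Poly_Mapping.single (exp_vec n \<sigma> a) (1 :: 'a)"
    by (simp only: pow prod exp_vec_def)
qed

lemma lookup_exp_vec:
  assumes "\<sigma> permutes {..<n}" "j < n"
  shows "Poly_Mapping.lookup (exp_vec n \<sigma> a) (\<sigma> j) = a ! j"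
proof -
  have "Poly_Mapping.lookup (exp_vec n \<sigma> a) (\<sigma> j) = (\<Sum>i<n. if i = j then a ! i else 0)"
    unfolding exp_vec_def lookup_sum lookup_single when_def
    using permutes_inj[OF assms(1)] by (intro sum.cong) (auto simp: inj_eq)
  then show ?thesis using assms(2) by simp
qed

lemma keys_exp_vec:
  assumes "\<sigma> permutes {..<n}"
  shows "Poly_Mapping.keys (exp_vec n \<sigma> a) \<subseteq> {..<n}"
proof -
  have "Poly_Mapping.keys (exp_vec n \<sigma> a) \<subseteq> (\<Union>i<n. Poly_Mapping.keys (Poly_Mapping.single (\<sigma> i) (a ! i)))"
    unfolding exp_vec_def by (rule Poly_Mapping.keys_sum)
  also have "\<dots> \<subseteq> {..<n}" using permutes_in_image[OF assms] by auto
  finally show ?thesis .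
qed

lemma mdeg_exp_vec: "length a = n \<Longrightarrow> mdeg (exp_vec n \<sigma> a) = sum_list a"
proof -
  have "mdeg (\<Sum>i<m. Poly_Mapping.single (\<sigma> i) (a ! i)) = (\<Sum>i<m. a ! i)" for m
    by (induction m) auto
  then show "length a = n \<Longrightarrow> mdeg (exp_vec n \<sigma> a) = sum_list a"
    by (simp add: exp_vec_def sum_list_sum_nth atLeast0LessThan)
qed

text \<open>The partition whose orbit contains the monomial with exponent vector \<open>m\<close>.\<close>

definition shape :: "nat \<Rightarrow> (nat \<Rightarrow>\<^sub>0 nat) \<Rightarrow> nat list" where
  "shape n m = desc_list (mset (map (Poly_Mapping.lookup m) [0..<n]))"

lemma shape_exp_vec:
  assumes \<sigma>: "\<sigma> permutes {..<n}" and a: "a \<in> padded_partitions d n"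
  shows "shape n (exp_vec n \<sigma> a) = a"
proof -
  let ?l = "map (Poly_Mapping.lookup (exp_vec n \<sigma> a)) [0..<n]"
  have len: "length a = n" using a by (simp add: padded_partitions_def)
  have "permute_list \<sigma> ?l = a"
  proof (rule nth_equalityI)
    show "length (permute_list \<sigma> ?l) = length a" using len by simp
    fix i assume "i < length (permute_list \<sigma> ?l)"
    then have "i < n" by simp
    then show "permute_list \<sigma> ?l ! i = a ! i"
      using \<sigma> permutes_in_image[OF \<sigma>, of i] lookup_exp_vec[OF \<sigma>] by (simp add: permute_list_nth)
  qed
  then have "mset ?l = mset a" using mset_permute_list[of \<sigma> ?l] \<sigma> by simp
  then show ?thesis using a by (simp add: shape_def desc_list_mset padded_partitions_def)
qed

lemma monomial_in_orbit:
  assumes "Poly_Mapping.keys m \<subseteq> {..<n}" "mdeg m = d"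
  obtains \<sigma> a where "\<sigma> permutes {..<n}" "a \<in> padded_partitions d n" "m = exp_vec n \<sigma> a"
proof -
  let ?l = "map (Poly_Mapping.lookup m) [0..<n]"
  let ?a = "shape n m"
  have ms: "mset ?a = mset ?l" by (simp add: shape_def)
  then have len: "length ?a = n" using mset_eq_length by fastforce
  have "sum_list ?a = sum_list ?l" using ms by (metis sum_mset_sum_list)
  also have "\<dots> = d" using assms mdeg_superset[of "{..<n}" m]
    by (simp add: sum_list_sum_nth atLeast0LessThan)
  finally have a: "?a \<in> padded_partitions d n"
    using len desc_list_sorted by (simp add: padded_partitions_def shape_def)
  obtain \<sigma> where "\<sigma> permutes {..<length ?l}" "permute_list \<sigma> ?l = ?a"
    using mset_eq_permutation[OF ms] by blast
  then have \<sigma>: "\<sigma> permutes {..<n}" and pl: "permute_list \<sigma> ?l = ?a" by simp_all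
  have "m = exp_vec n \<sigma> ?a"
  proof (rule poly_mapping_eqI)
    fix k show "Poly_Mapping.lookup m k = Poly_Mapping.lookup (exp_vec n \<sigma> ?a) k"
    proof (cases "k < n")
      case True
      then obtain j where j: "j < n" "k = \<sigma> j"
        using permutes_image[OF \<sigma>] by (metis imageE lessThan_iff)
      have "?a ! j = permute_list \<sigma> ?l ! j" by (simp only: pl)
      also have "\<dots> = Poly_Mapping.lookup m k"
        using \<sigma> j True by (simp add: permute_list_nth)
      finally show ?thesis using lookup_exp_vec[OF \<sigma> j(1)] j(2) by simp
    next
      case False
      then have "k \<notin> Poly_Mapping.keys m" "k \<notin> Poly_Mapping.keys (exp_vec n \<sigma> ?a)"
        using assms(1) keys_exp_vec[OF \<sigma>] by blast+
      then show ?thesis by (simp add: in_keys_iff)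
    qed
  qed
  then show ?thesis using that \<sigma> a by blast
qed

text \<open>The sum of the coefficients over one orbit of monomials: an invariant functional, and therefore
  zero on differences of monomials of the same orbit.\<close>

definition shape_coeff :: "nat \<Rightarrow> nat list \<Rightarrow> 'k::field mpoly \<Rightarrow> 'k" where
  "shape_coeff n a f = (\<Sum>m\<in>Poly_Mapping.keys f. if shape n m = a then Poly_Mapping.lookup f m else 0)"

lemma shape_coeff_superset:
  assumes "finite X" "Poly_Mapping.keys f \<subseteq> X"
  shows "shape_coeff n a f = (\<Sum>m\<in>X. if shape n m = a then Poly_Mapping.lookup f m else 0)"
  unfolding shape_coeff_def
  by (rule sum.mono_neutral_left) (use assms in \<open>auto simp: in_keys_iff\<close>)

lemma shape_coeff_add: "shape_coeff n a (f + g) = shape_coeff n a f + shape_coeff n a g"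
proof -
  let ?X = "Poly_Mapping.keys f \<union> Poly_Mapping.keys g"
  have "Poly_Mapping.keys (f + g) \<subseteq> ?X" by (rule Poly_Mapping.keys_add)
  then show ?thesis
    by (simp add: shape_coeff_superset[of ?X] lookup_add if_distrib flip: sum.distrib)
       (rule sum.cong, auto simp: lookup_add)
qed

lemma shape_coeff_mscale: "shape_coeff n a (mscale c f) = c * shape_coeff n a f"
proof -
  have "Poly_Mapping.keys (mscale c f) \<subseteq> Poly_Mapping.keys f" by (auto simp: in_keys_iff)
  then show ?thesis
    by (simp add: shape_coeff_superset[of "Poly_Mapping.keys f"] sum_distrib_left if_distrib cong: if_cong)
qed

lemma shape_coeff_kernel_subspace: "mpoly.subspace {f. shape_coeff n a f = 0}"
  by (simp add: mpoly.subspace_def shape_coeff_add shape_coeff_mscale) (simp add: shape_coeff_def)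

lemma shape_coeff_monomial:
  assumes "\<sigma> permutes {..<n}" "b \<in> padded_partitions d n"
  shows "shape_coeff n a (perm_act \<sigma> (xpow b)) = (if a = b then 1 else 0)"
proof -
  have "length b = n" using assms(2) by (simp add: padded_partitions_def)
  then show ?thesis using shape_exp_vec[OF assms] by (auto simp: perm_act_xpow shape_coeff_def)
qed

lemma xpow_graded:
  assumes "a \<in> padded_partitions d n"
  shows "xpow a \<in> graded_part n d"
proof -
  have len: "length a = n" and "sum_list a = d" using assms by (simp_all add: padded_partitions_def)
  then have "Poly_Mapping.single (exp_vec n id a) 1 \<in> graded_part n d"
    by (intro single_graded keys_exp_vec) (simp_all add: permutes_id mdeg_exp_vec)
  then show ?thesis by (simp flip: perm_act_xpow[OF len])
qed

text \<open>Every monomial of degree \<open>d\<close> is a translate of some \<open>\<^bold>x\<^sup>a\<close>, so membership of all forms in a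
  subspace can be tested on these translates.\<close>

lemma graded_part_subset_by_orbits:
  assumes V: "mpoly.subspace V"
    and "\<And>\<sigma> a. \<sigma> permutes {..<n} \<Longrightarrow> a \<in> padded_partitions d n \<Longrightarrow> perm_act \<sigma> (xpow a) \<in> V"
  shows "graded_part n d \<subseteq> V"
proof
  fix f :: "'a mpoly" assume "f \<in> graded_part n d"
  then show "f \<in> V"
    unfolding graded_part_supp_in
  proof (rule supp_in_span[OF V])
    fix m assume "m \<in> {m. Poly_Mapping.keys m \<subseteq> {..<n} \<and> mdeg m = d}"
    then obtain \<sigma> a where "\<sigma> permutes {..<n}" "a \<in> padded_partitions d n" "m = exp_vec n \<sigma> a"
      using monomial_in_orbit by blast
    then show "Poly_Mapping.single m 1 \<in> V"
      using assms(2)[of \<sigma> a] by (simp add: padded_partitions_def perm_act_xpow)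
  qed
qed

section \<open>The ideal and its component of degree d\<close>

text \<open>The generators of the ideal, made closed under the group in their second part. In the first part a
  translate of a generator is a difference of two generators.\<close>

definition orbit_gens :: "nat \<Rightarrow> nat \<Rightarrow> nat list set \<Rightarrow> 'k::field mpoly set" where
  "orbit_gens n d A =
    {xpow a - perm_act \<sigma> (xpow a) | \<sigma> a. \<sigma> permutes {..<n} \<and> a \<in> padded_partitions d n \<and> a \<notin> A}
    \<union> {perm_act \<sigma> (xpow a) | \<sigma> a. \<sigma> permutes {..<n} \<and> a \<in> A}"

context
  fixes n d :: nat and A :: "nat list set"
  assumes dn: "d \<le> n" and A: "A \<subseteq> padded_partitions d n"
begin

lemma orbit_gens_graded: "orbit_gens n d A \<subseteq> graded_part n d"
  unfolding orbit_gens_def using A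
  by (auto intro!: mpoly.subspace_diff[OF graded_part_subspace] perm_act_graded xpow_graded)

lemma orbit_gens_memI:
  assumes "\<sigma> permutes {..<n}" "a \<in> A"
  shows "perm_act \<sigma> (xpow a) \<in> mpoly.span (orbit_gens n d A)"
  using assms by (intro mpoly.span_base) (auto simp: orbit_gens_def)

lemma orbit_gens_diff:
  assumes "\<sigma> permutes {..<n}" "\<tau> permutes {..<n}" "a \<in> padded_partitions d n"
  shows "perm_act \<sigma> (xpow a) - perm_act \<tau> (xpow a) \<in> mpoly.span (orbit_gens n d A)"
proof (cases "a \<in> A")
  case True
  then show ?thesis using assms by (intro mpoly.span_diff orbit_gens_memI)
next
  case False
  then have "(xpow a - perm_act \<tau> (xpow a)) - (xpow a - perm_act \<sigma> (xpow a)) \<in> mpoly.span (orbit_gens n d A)"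
    using assms by (intro mpoly.span_diff mpoly.span_base) (auto simp: orbit_gens_def)
  then show ?thesis by simp
qed

lemma perm_act_orbit_gens:
  assumes \<sigma>: "\<sigma> permutes {..<n}" and b: "b \<in> orbit_gens n d A"
  shows "perm_act \<sigma> b \<in> mpoly.span (orbit_gens n d A)"
  using b[unfolded orbit_gens_def]
proof (elim UnE CollectE exE conjE)
  fix \<tau> a assume "b = xpow a - perm_act \<tau> (xpow a)" "\<tau> permutes {..<n}" "a \<in> padded_partitions d n"
  then show "perm_act \<sigma> b \<in> mpoly.span (orbit_gens n d A)"
    using orbit_gens_diff[OF \<sigma> permutes_compose[OF _ \<sigma>]] by (simp add: perm_act_perm_act)
next
  fix \<tau> a assume "b = perm_act \<tau> (xpow a)" "\<tau> permutes {..<n}" "a \<in> A"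
  then show "perm_act \<sigma> b \<in> mpoly.span (orbit_gens n d A)"
    using orbit_gens_memI[OF permutes_compose[OF _ \<sigma>]] by (simp add: perm_act_perm_act)
qed

text \<open>A basis of the span of the generators, together with the monomials \<open>\<^bold>x\<^sup>a\<close> for \<open>a \<notin> A\<close>, is a basis of all
  forms of degree \<open>d\<close>. The functional belonging to \<open>a\<close> vanishes on the span and on all other
  monomials of this family but not on \<open>\<^bold>x\<^sup>a\<close>, which gives the independence.\<close>

lemma dim_orbit_gens:
  "int (mpoly.dim (mpoly.span (orbit_gens n d A) :: 'k::field mpoly set)) =
    int (mpoly.dim (graded_part n d :: 'k mpoly set)) - (int (partition_number d) - int (card A))"
proof -
  let ?S = "mpoly.span (orbit_gens n d A) :: 'k mpoly set"
  let ?PP = "padded_partitions d n"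
  let ?R = "graded_part n d :: 'k mpoly set"
  note fin = card_padded_partitions(2)[OF dn]
  obtain B where B: "B \<subseteq> ?S" "mpoly.independent B" "?S \<subseteq> mpoly.span B" "card B = mpoly.dim ?S"
    using mpoly.basis_exists by blast
  have SR: "?S \<subseteq> ?R" by (rule mpoly.span_minimal[OF orbit_gens_graded graded_part_subspace])
  define M where "M = (\<lambda>(\<sigma>, a). perm_act \<sigma> (xpow a) :: 'k mpoly) ` ({\<sigma>. \<sigma> permutes {..<n}} \<times> ?PP)"
  have "finite M" unfolding M_def using fin by (intro finite_imageI finite_cartesian_product finite_permutations) auto
  moreover have "?R \<subseteq> mpoly.span M"
    by (rule graded_part_subset_by_orbits[OF mpoly.subspace_span], rule mpoly.span_base) (auto simp: M_def)
  then have "B \<subseteq> mpoly.span M" using B(1) SR by blast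
  ultimately have finB: "finite B" using mpoly.independent_span_bound[OF _ B(2)] by blast
  have coeff: "shape_coeff n a (xpow b) = (if a = b then 1 else (0::'k))" if "b \<in> ?PP" for a b
    by (rule shape_coeff_monomial[OF permutes_id that, unfolded perm_act_id])
  have inj: "inj_on (xpow :: nat list \<Rightarrow> 'k mpoly) (?PP - A)"
    using coeff by (intro inj_onI) (metis Diff_iff zero_neq_one)
  have ker: "?S \<subseteq> {f. shape_coeff n c f = 0}" if c: "c \<in> ?PP - A" for c
  proof (rule mpoly.span_minimal[OF _ shape_coeff_kernel_subspace], rule subsetI, rule CollectI)
    fix b assume "b \<in> (orbit_gens n d A :: 'k mpoly set)"
    then show "shape_coeff n c b = 0"
      unfolding orbit_gens_def
    proof (elim UnE CollectE exE conjE)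
      fix \<sigma> a assume b: "b = xpow a - perm_act \<sigma> (xpow a)" and a: "\<sigma> permutes {..<n}" "a \<in> ?PP"
      have "shape_coeff n c (b + perm_act \<sigma> (xpow a)) = shape_coeff n c (xpow a :: 'k mpoly)" by (simp add: b)
      then show ?thesis using a by (simp add: shape_coeff_add shape_coeff_monomial coeff)
    next
      fix \<sigma> a assume "b = perm_act \<sigma> (xpow a)" "\<sigma> permutes {..<n}" "a \<in> A"
      moreover from this have "a \<in> ?PP" "c \<noteq> a" using A c by auto
      ultimately show ?thesis by (simp add: shape_coeff_monomial[of \<sigma> n a d c])
    qed
  qed
  have indep: "mpoly.independent (B \<union> xpow ` C) \<and> B \<inter> xpow ` C = {}" if "finite C" "C \<subseteq> ?PP - A" for C
    using that
  proof (induction C rule: finite_induct)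
    case empty
    then show ?case using B by simp
  next
    case (insert c C)
    have "B \<union> xpow ` C \<subseteq> {f. shape_coeff n c f = 0}"
      using B(1) ker[of c] insert.prems insert.hyps(2) coeff by auto
    then have sub: "mpoly.span (B \<union> xpow ` C) \<subseteq> {f. shape_coeff n c f = 0}"
      by (rule mpoly.span_minimal[OF _ shape_coeff_kernel_subspace])
    have "shape_coeff n c (xpow c) = (1::'k)" using coeff[of c c] insert.prems by simp
    then have notin: "xpow c \<notin> mpoly.span (B \<union> xpow ` C)" using sub by auto
    then have "mpoly.independent (insert (xpow c) (B \<union> xpow ` C))"
      using insert.IH insert.prems by (intro mpoly.independent_insertI) auto
    moreover have "xpow c \<notin> B" using notin mpoly.span_base by blast
    ultimately show ?case using insert by simp
  qed
  let ?C = "xpow ` (?PP - A) :: 'k mpoly set"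
  have "finite (?PP - A)" using fin by simp
  note indep = indep[OF this order_refl]
  have "mpoly.dim ?R = card (B \<union> ?C)"
  proof (rule mpoly.dim_unique)
    show "B \<union> ?C \<subseteq> ?R" using B(1) SR xpow_graded by blast
    show "mpoly.independent (B \<union> ?C)" using indep by blast
    show "?R \<subseteq> mpoly.span (B \<union> ?C)"
    proof (rule graded_part_subset_by_orbits[OF mpoly.subspace_span])
      fix \<sigma> a assume \<sigma>: "\<sigma> permutes {..<n}" and a: "a \<in> ?PP"
      have SB: "?S \<subseteq> mpoly.span (B \<union> ?C)" using B(3) mpoly.span_mono[of B "B \<union> ?C"] by blast
      show "perm_act \<sigma> (xpow a) \<in> mpoly.span (B \<union> ?C)"
      proof (cases "a \<in> A")
        case True
        then show ?thesis using orbit_gens_memI[OF \<sigma>] SB by blast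
      next
        case False
        have "perm_act \<sigma> (xpow a) - xpow a \<in> mpoly.span (B \<union> ?C)"
          using orbit_gens_diff[OF \<sigma> permutes_id a] SB by auto
        moreover have "xpow a \<in> mpoly.span (B \<union> ?C)" using a False by (intro mpoly.span_base) auto
        ultimately have "(perm_act \<sigma> (xpow a) - xpow a) + xpow a \<in> mpoly.span (B \<union> ?C)" by (rule mpoly.span_add)
        then show ?thesis by simp
      qed
    qed
  qed simp
  also have "\<dots> = card B + card ?C" using finB fin indep by (intro card_Un_disjoint) auto
  also have "card ?C = card (?PP - A)" using inj by (rule card_image)
  also have "\<dots> = partition_number d - card A"
    using fin A finite_subset by (subst card_Diff_subset) (auto simp: card_padded_partitions(1)[OF dn])
  finally have "mpoly.dim ?R = mpoly.dim ?S + (partition_number d - card A)" using B(4) by simp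
  moreover have "card A \<le> partition_number d"
    using card_mono[OF fin A] by (simp add: card_padded_partitions(1)[OF dn])
  ultimately show ?thesis by simp
qed

end

section \<open>Few generators of the ideal\<close>

context nonmodular
begin

text \<open>The generators are \<open>f\<^sub>i = avg \<^bold>x\<^sup>a + g\<^sub>i\<close>, where \<open>a\<close> is the \<open>i\<close>-th element of \<open>A\<close> and the \<open>g\<^sub>i\<close> generate the
  forms with zero average. Since \<open>avg f\<^sub>i = avg \<^bold>x\<^sup>a\<close>, the module generated by the \<open>f\<^sub>i\<close> contains both
  summands. It therefore contains all forms with zero average, in particular all differences of
  monomials of one orbit, and then also the monomials \<open>\<^bold>x\<^sup>a\<close> for \<open>a \<in> A\<close>.\<close>

lemma ideal_few_generators:
  fixes A :: "nat list set"
  assumes inf: "infinite (UNIV :: 'k set)" and d: "1 \<le> d" "d < n"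
    and A: "A \<subseteq> padded_partitions d n" "finite A" "card A = r"
    and r: "(\<Sum>i<d. partition_number i) \<le> r * (n - 1)"
  shows "r_generated n r (Idl\<^bsub>poly_ring n\<^esub> (orbit_gens n d A) :: 'k mpoly set)"
proof -
  let ?J = "Idl\<^bsub>poly_ring n\<^esub> (orbit_gens n d A) :: 'k mpoly set"
  let ?S = "mpoly.span (orbit_gens n d A) :: 'k mpoly set"
  let ?avg = "sym_avg {..<n} :: 'k mpoly \<Rightarrow> 'k mpoly"
  have dn: "d \<le> n" using d by simp
  note graded = orbit_gens_graded[OF dn A(1)]
  have carr: "(orbit_gens n d A :: 'k mpoly set) \<subseteq> carrier (poly_ring n)"
    using graded graded_imp_carrier by blast
  note J = Idl_ideal[OF carr]
  have SJ: "?S \<subseteq> ?J" using Idl_graded_part[OF graded] by blast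
  have S_stable: "stable n ?S" by (rule stable_span) (rule perm_act_orbit_gens[OF dn A(1)])
  obtain g where g: "\<And>i. i < r \<Longrightarrow> g i \<in> avg_zero_part n d"
    and gen: "(avg_zero_part n d :: 'k mpoly set) \<subseteq> gspan n (g ` {..<r})"
    using avg_zero_part_few_generators[OF inf d(2,1) r] by blast
  obtain h where h: "bij_betw h {..<r} A"
    using ex_bij_betw_nat_finite[OF A(2)] A(3) by (auto simp: atLeast0LessThan)
  have hA: "h i \<in> A" if "i < r" for i using bij_betwE[OF h] that by blast
  define f where "f i = ?avg (xpow (h i)) + g i" for i
  have x_graded: "xpow a \<in> graded_part n d" if "a \<in> padded_partitions d n" for a
    using that by (rule xpow_graded)
  have zero_in_S: "avg_zero_part n d \<subseteq> ?S"
  proof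
    fix u :: "'k mpoly" assume u: "u \<in> avg_zero_part n d"
    let ?V = "{u. u - ?avg u \<in> ?S}"
    have "graded_part n d \<subseteq> ?V"
    proof (rule graded_part_subset_by_orbits)
      have "0 - ?avg 0 \<in> ?S" by (simp add: mpoly.span_zero)
      moreover have "x + y - ?avg (x + y) \<in> ?S" if "x - ?avg x \<in> ?S" "y - ?avg y \<in> ?S" for x y
        using mpoly.span_add[OF that] by (simp add: algebra_simps)
      moreover have "mscale c x - ?avg (mscale c x) \<in> ?S" if "x - ?avg x \<in> ?S" for c x
        using mpoly.span_scale[OF that, of c] by (simp add: mpoly.scale_right_diff_distrib)
      ultimately show "mpoly.subspace ?V" by (intro mpoly.subspaceI) simp_all
      fix \<sigma> a assume \<sigma>: "\<sigma> permutes {..<n}" and a: "a \<in> padded_partitions d n"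
      have "perm_act \<sigma> (xpow a) - ?avg (perm_act \<sigma> (xpow a)) \<in> ?S"
      proof (rule diff_sym_avg_mem[OF order_refl mpoly.subspace_span])
        fix \<tau> assume "\<tau> permutes {..<n}"
        then show "perm_act \<sigma> (xpow a) - perm_act \<tau> (perm_act \<sigma> (xpow a)) \<in> ?S"
          unfolding perm_act_perm_act by (intro orbit_gens_diff[OF dn A(1) \<sigma> _ a] permutes_compose \<sigma>)
      qed
      then show "perm_act \<sigma> (xpow a) \<in> ?V" by simp
    qed
    then have "u - ?avg u \<in> ?S" using u by (auto simp: avg_zero_part_def)
    then show "u \<in> ?S" using u by (simp add: avg_zero_part_def)
  qed
  have fS: "f i \<in> ?S" if "i < r" for i
  proof -
    have "xpow (h i) \<in> ?S" using orbit_gens_memI[OF dn A(1) permutes_id hA[OF that]] by simp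
    then have "?avg (xpow (h i)) \<in> ?S" by (intro sym_avg_mem[OF S_stable order_refl])
    then show ?thesis unfolding f_def using zero_in_S g[OF that] by (intro mpoly.span_add) auto
  qed
  let ?F = "{perm_act \<sigma> u | \<sigma> u. \<sigma> permutes {..<n} \<and> u \<in> f ` {..<r}}"
  have FS: "?F \<subseteq> ?S" using fS stableD[OF S_stable] by blast
  have SR: "?S \<subseteq> graded_part n d" by (rule mpoly.span_minimal[OF graded graded_part_subspace])
  have Fc: "?F \<subseteq> carrier (poly_ring n)" using FS SR graded_imp_carrier by blast
  let ?K = "Idl\<^bsub>poly_ring n\<^esub> ?F"
  note K = Idl_ideal[OF Fc]
  have fK: "gspan n (f ` {..<r}) \<subseteq> ?K"
    unfolding gspan_def using Idl_base[OF Fc] by (intro mpoly.span_minimal ideal_subspace[OF K]) blast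
  let ?E = "gspan n (f ` {..<r})"
  have E: "stable n ?E" by (rule stable_gspan)
  have fE: "f i \<in> ?E" if "i < r" for i using that by (intro gspan_base) simp
  have avg_f: "?avg (f i) = ?avg (xpow (h i))" if "i < r" for i
    using g[OF that] by (simp add: f_def sym_avg_idem avg_zero_part_def)
  have avgE: "?avg (xpow (h i)) \<in> ?E" if "i < r" for i
    using sym_avg_mem[OF E order_refl fE[OF that]] avg_f[OF that] by simp
  have "g i \<in> ?E" if "i < r" for i
    using mpoly.subspace_diff[OF stable_subspace[OF E] fE[OF that] avgE[OF that]] by (simp add: f_def)
  then have "gspan n (g ` {..<r}) \<subseteq> ?E" by (intro gspan_minimal[OF E]) auto
  then have zeroE: "avg_zero_part n d \<subseteq> ?E" using gen by blast
  have "orbit_gens n d A \<subseteq> ?E"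
    unfolding orbit_gens_def
  proof safe
    fix \<sigma> a assume \<sigma>: "\<sigma> permutes {..<n}" and a: "a \<in> padded_partitions d n"
    have "xpow a - perm_act \<sigma> (xpow a) \<in> graded_part n d"
      using x_graded[OF a] by (intro mpoly.subspace_diff[OF graded_part_subspace] perm_act_graded \<sigma>)
    then have "xpow a - perm_act \<sigma> (xpow a) \<in> avg_zero_part n d"
      by (simp add: avg_zero_part_def sym_avg_perm_act[OF \<sigma>])
    then show "xpow a - perm_act \<sigma> (xpow a) \<in> ?E" using zeroE by blast
  next
    fix \<sigma> a assume \<sigma>: "\<sigma> permutes {..<n}" and a: "a \<in> A"
    obtain i where i: "i < r" "a = h i" using a h by (auto simp: bij_betw_def)
    have "xpow a - ?avg (xpow a) \<in> graded_part n d"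
      using x_graded A(1) a by (intro mpoly.subspace_diff[OF graded_part_subspace] sym_avg_mem[OF stable_graded_part]) auto
    then have "xpow a - ?avg (xpow a) \<in> avg_zero_part n d" by (simp add: avg_zero_part_def sym_avg_idem)
    then have "(xpow a - ?avg (xpow a)) + ?avg (xpow a) \<in> ?E"
      using zeroE avgE[OF i(1)] i(2) by (intro mpoly.subspace_add[OF stable_subspace[OF E]]) auto
    then show "perm_act \<sigma> (xpow a) \<in> ?E" using stableD[OF E \<sigma>] by simp
  qed
  then have "?J \<subseteq> ?K" using fK by (intro Idl_minimal[OF K]) blast
  moreover have "?K \<subseteq> ?J" using FS SJ by (intro Idl_minimal[OF J]) blast
  ultimately have "?J = sym_genideal n (f ` {..<r})" unfolding sym_genideal_def by blast
  moreover have "\<forall>i<r. f i \<in> graded_part n d" using fS SR by blast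
  ultimately show ?thesis unfolding r_generated_def by blast
qed

end

text \<open>A positive characteristic is prime, and a prime above \<open>n\<close> does not divide \<open>n!\<close>.\<close>

lemma fact_nonzero_of_char:
  assumes "CHAR('k::field) = 0 \<or> CHAR('k) > n"
  shows "(of_nat (fact n) :: 'k) \<noteq> 0"
proof
  assume "(of_nat (fact n) :: 'k) = 0"
  then have dvd: "CHAR('k) dvd fact n" by (simp add: of_nat_eq_0_iff_char_dvd)
  then have pos: "CHAR('k) > n" using assms by auto
  then have "prime CHAR('k)" by (intro prime_CHAR_semidom) simp
  then show False using dvd pos by (simp add: prime_dvd_fact_iff)
qed

theorem proposition5p6:
  fixes n d r :: nat
    and A :: "nat list set"
    and J :: "'k::field mpoly set"
  assumes "infinite (UNIV :: 'k set)"
    and "CHAR('k) = 0 \<or> CHAR('k) > n"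
    and "1 \<le> d" and "d \<le> n" and "1 \<le> r"
    and "A \<subseteq> padded_partitions d n" and "card A = r"
    and "J =
      Idl\<^bsub>poly_ring n\<^esub> {xpow a - perm_act \<sigma> (xpow a) | \<sigma> a.
          \<sigma> permutes {..<n} \<and> a \<in> padded_partitions d n \<and> a \<notin> A}
      <+>\<^bsub>poly_ring n\<^esub> sym_genideal n (xpow ` A)"
  shows "symmetric_ideal n J \<and> generated_in_degree n d J
    \<and> int (mpoly.dim (J \<inter> graded_part n d)) =
        int (mpoly.dim (graded_part n d :: 'k mpoly set)) - (int (partition_number d) - int r)
    \<and> (n > d \<and> real n \<ge> 1 + real (\<Sum>i = 0..d - 1. partition_number i) / real r
        \<longrightarrow> r_generated n r J)"
proof -
  let ?B = "orbit_gens n d A :: 'k mpoly set"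
  note A = assms(6)
  note graded = orbit_gens_graded[OF assms(4) A]
  have carr: "?B \<subseteq> carrier (poly_ring n)"
    by (rule order_trans[OF graded]) (rule subsetI, erule graded_imp_carrier)
  let ?B1 = "{xpow a - perm_act \<sigma> (xpow a) | \<sigma> a.
      \<sigma> permutes {..<n} \<and> a \<in> padded_partitions d n \<and> a \<notin> A} :: 'k mpoly set"
  let ?B2 = "{perm_act \<sigma> (xpow a) | \<sigma> a. \<sigma> permutes {..<n} \<and> a \<in> A} :: 'k mpoly set"
  have B: "?B = ?B1 \<union> ?B2" by (simp only: orbit_gens_def)
  have "{perm_act \<sigma> f | \<sigma> f. \<sigma> permutes {..<n} \<and> f \<in> xpow ` A} = ?B2"
    by (intro Collect_cong) (auto simp: image_iff)
  then have "J = Idl\<^bsub>poly_ring n\<^esub> ?B1 <+>\<^bsub>poly_ring n\<^esub> Idl\<^bsub>poly_ring n\<^esub> ?B2"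
    unfolding assms(8) sym_genideal_def by (simp only:)
  also have "\<dots> = Idl\<^bsub>poly_ring n\<^esub> (?B1 \<union> ?B2)"
    by (rule Idl_union; rule order_trans[OF _ carr]) (simp_all only: B Un_upper1 Un_upper2)
  finally have J: "J = Idl\<^bsub>poly_ring n\<^esub> ?B" by (simp only: B)
  have span: "J \<inter> graded_part n d = mpoly.span ?B" unfolding J by (rule Idl_graded_part[OF graded])
  have "symmetric_ideal n J"
    unfolding J
  proof (rule symmetric_ideal_Idl[OF carr])
    fix \<sigma> b assume "\<sigma> permutes {..<n}" "b \<in> ?B"
    then have "perm_act \<sigma> b \<in> mpoly.span ?B" by (rule perm_act_orbit_gens[OF assms(4) A])
    then show "perm_act \<sigma> b \<in> Idl\<^bsub>poly_ring n\<^esub> ?B" using span unfolding J by blast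
  qed
  moreover have "generated_in_degree n d J" unfolding generated_in_degree_def J using graded by blast
  moreover have "int (mpoly.dim (J \<inter> graded_part n d)) =
        int (mpoly.dim (graded_part n d :: 'k mpoly set)) - (int (partition_number d) - int r)"
    unfolding span using dim_orbit_gens[OF assms(4) A] assms(7) by simp
  moreover have "r_generated n r J"
    if "n > d" "real n \<ge> 1 + real (\<Sum>i = 0..d - 1. partition_number i) / real r"
  proof -
    interpret nonmodular n "TYPE('k)"
      by unfold_locales (rule fact_nonzero_of_char[OF assms(2)])
    have "{0..d - 1} = {..<d}" using assms(3) by auto
    then have "real (\<Sum>i<d. partition_number i) / real r \<le> real n - 1" using that(2) by simp
    then have "real (\<Sum>i<d. partition_number i) \<le> (real n - 1) * real r"
      using assms(5) by (simp add: pos_divide_le_eq)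
    also have "\<dots> = real (r * (n - 1))" using that(1) by (simp add: of_nat_diff mult.commute)
    finally have "(\<Sum>i<d. partition_number i) \<le> r * (n - 1)" by (simp only: of_nat_le_iff)
    moreover have "finite A" using assms(5,7) card.infinite by fastforce
    ultimately show ?thesis
      unfolding J by (intro ideal_few_generators assms that(1)) 
  qed
  ultimately show ?thesis by blast
qed

end
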